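(* Let $\beta>0$. There exists a non-trivial element of $\mathcal{M}_\beta^\bot$ that vanishes on the negative semi-axis $\mathbb{R}_-$ if and only if $\beta\ge 4$. Moreover, if $\beta=4$, the subspace of elements of $\mathcal{M}_\beta^\bot$ vanishing on $\mathbb{R}_-$ is one-dimensional, while if $\beta>4$, the subspace of elements of $\mathcal{M}_\beta^\bot$ vanishing on $\mathbb{R}_-$ is infinite-dimensional.
   Context: For $\beta>0$, $$\mathcal{M}_\beta^\bot=\Big\{f\in L^1(\mathbb{R}):\ \int_{\mathbb{R}} f(x)e^{i n\pi x}\,dx=\int_{\mathbb{R}} f(x)e^{i n\pi\beta/x}\,dx=0\ \text{ for all } n\in\mathbb{Z}\Big\},$$ where functions are complex-valued and identified when equal almost everywhere; "vanishes on $\mathbb{R}_-$" means almost everywhere on $\mathbb{R}_-=(-\infty,0)$. *)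

theory Defs
  imports "HOL-Analysis.Analysis"
begin

text \<open>
  The complex vector space \<open>L\<^sup>1(\<real>)\<close> as a type: integrable functions modulo equality almost
  everywhere. Borel representatives suffice, since every Lebesgue measurable function agrees
  almost everywhere with a Borel measurable one.
\<close>

definition L1_rel :: "(real \<Rightarrow> complex) \<Rightarrow> (real \<Rightarrow> complex) \<Rightarrow> bool" where
  "L1_rel f g \<longleftrightarrow> integrable lborel f \<and> integrable lborel g \<and> (AE x in lborel. f x = g x)"

quotient_type L1 = "real \<Rightarrow> complex" / partial: L1_rel
proof (rule part_equivpI)
  show "\<exists>f. L1_rel f f"
    by (rule exI[of _ "\<lambda>_. 0"]) (simp add: L1_rel_def)
  show "symp L1_rel"
    by (rule sympI) (auto simp: L1_rel_def elim: AE_mp)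
  show "transp L1_rel"
    by (rule transpI) (auto simp: L1_rel_def)
qed

instantiation L1 :: ab_group_add
begin

lift_definition zero_L1 :: L1 is "\<lambda>_. 0"
  by (simp add: L1_rel_def)

lift_definition plus_L1 :: "L1 \<Rightarrow> L1 \<Rightarrow> L1" is "\<lambda>f g x. f x + g x"
  by (auto simp: L1_rel_def)

lift_definition uminus_L1 :: "L1 \<Rightarrow> L1" is "\<lambda>f x. - f x"
  by (auto simp: L1_rel_def)

lift_definition minus_L1 :: "L1 \<Rightarrow> L1 \<Rightarrow> L1" is "\<lambda>f g x. f x - g x"
  by (auto simp: L1_rel_def)

instance
  by standard (transfer; auto simp: L1_rel_def algebra_simps)+

end

lift_definition L1_scale :: "complex \<Rightarrow> L1 \<Rightarrow> L1" is "\<lambda>c f x. c * f x"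
  by (auto simp: L1_rel_def)

global_interpretation L1: vector_space L1_scale
  by standard (transfer; auto simp: L1_rel_def algebra_simps)+

lemma integral_times_bounded_cong:
  fixes f g h :: "real \<Rightarrow> complex"
  assumes "L1_rel f g" and [measurable]: "h \<in> borel_measurable borel"
  shows "(LINT x|lborel. f x * h x) = (LINT x|lborel. g x * h x)"
proof (rule integral_cong_AE)
  have [measurable]: "f \<in> borel_measurable borel" "g \<in> borel_measurable borel"
    using assms(1) by (auto simp: L1_rel_def dest: borel_measurable_integrable)
  show "(\<lambda>x. f x * h x) \<in> borel_measurable lborel" "(\<lambda>x. g x * h x) \<in> borel_measurable lborel"
    by measurable
  show "AE x in lborel. f x * h x = g x * h x"
    using assms(1) by (auto simp: L1_rel_def)
qed

text \<open>The value of \<open>\<beta> / x\<close> at \<open>x = 0\<close> is irrelevant, as a single point is a null set.\<close>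

lift_definition in_M_perp :: "real \<Rightarrow> L1 \<Rightarrow> bool" is
  "\<lambda>\<beta> f. \<forall>n::int.
     (LINT x|lborel. f x * exp (\<i> * of_int n * of_real pi * of_real x)) = 0 \<and>
     (LINT x|lborel. f x * exp (\<i> * of_int n * of_real pi * of_real (\<beta> / x))) = 0"
proof -
  fix \<beta> :: real and f g :: "real \<Rightarrow> complex"
  assume fg: "L1_rel f g"
  have "(LINT x|lborel. f x * exp (\<i> * of_int n * of_real pi * of_real x)) =
        (LINT x|lborel. g x * exp (\<i> * of_int n * of_real pi * of_real x))"
       "(LINT x|lborel. f x * exp (\<i> * of_int n * of_real pi * of_real (\<beta> / x))) =
        (LINT x|lborel. g x * exp (\<i> * of_int n * of_real pi * of_real (\<beta> / x)))" for n :: int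
    by (rule integral_times_bounded_cong[OF fg]; measurable)+
  then show "?thesis \<beta> f g" by simp
qed

definition M_perp :: "real \<Rightarrow> L1 set" where
  "M_perp \<beta> = {F. in_M_perp \<beta> F}"

lift_definition vanishes_on_neg :: "L1 \<Rightarrow> bool" is
  "\<lambda>f. AE x in lborel. x < 0 \<longrightarrow> f x = 0"
  unfolding L1_rel_def by (auto elim: AE_mp)

definition M_perp_pos :: "real \<Rightarrow> L1 set" where
  "M_perp_pos \<beta> = {F \<in> M_perp \<beta>. vanishes_on_neg F}"

lemma integrable_times_bounded:
  fixes f h :: "real \<Rightarrow> complex"
  assumes f: "integrable lborel f" and [measurable]: "h \<in> borel_measurable borel"
    and h: "\<And>x. norm (h x) \<le> 1"
  shows "integrable lborel (\<lambda>x. f x * h x)"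
proof (rule Bochner_Integration.integrable_bound[OF f])
  have [measurable]: "f \<in> borel_measurable borel"
    using f by (auto dest: borel_measurable_integrable)
  show "(\<lambda>x. f x * h x) \<in> borel_measurable lborel"
    by measurable
  show "AE x in lborel. norm (f x * h x) \<le> norm (f x)"
    using h by (intro AE_I2) (simp add: norm_mult mult_left_le)
qed

lemma integrable_times_exp:
  assumes "integrable lborel f"
  shows "integrable lborel (\<lambda>x. f x * exp (\<i> * of_int n * of_real pi * of_real x))"
    and "integrable lborel (\<lambda>x. f x * exp (\<i> * of_int n * of_real pi * of_real (\<beta> / x)))"
  by (rule integrable_times_bounded[OF assms]; (measurable | simp))+

lemma subspace_M_perp: "L1.subspace (M_perp \<beta>)"
  unfolding M_perp_def
proof (rule L1.subspaceI; unfold mem_Collect_eq)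
  show "in_M_perp \<beta> 0"
    by transfer simp
  show "in_M_perp \<beta> (F + G)" if "in_M_perp \<beta> F" "in_M_perp \<beta> G" for F G
    using that
    by transfer (simp add: L1_rel_def distrib_right integrable_times_exp
        Bochner_Integration.integral_add del: of_real_divide)
  show "in_M_perp \<beta> (L1_scale c F)" if "in_M_perp \<beta> F" for c F
    using that by transfer (simp add: mult.assoc)
qed

lemma subspace_M_perp_pos: "L1.subspace (M_perp_pos \<beta>)"
proof -
  have "L1.subspace (Collect vanishes_on_neg)"
  proof (rule L1.subspaceI; unfold mem_Collect_eq)
    show "vanishes_on_neg 0"
      by transfer simp
    show "vanishes_on_neg (F + G)" if "vanishes_on_neg F" "vanishes_on_neg G" for F G
      using that by transfer auto
    show "vanishes_on_neg (L1_scale c F)" if "vanishes_on_neg F" for c F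
      using that by transfer auto
  qed
  moreover have "M_perp_pos \<beta> = M_perp \<beta> \<inter> Collect vanishes_on_neg"
    by (auto simp: M_perp_pos_def)
  ultimately show ?thesis
    using subspace_M_perp by (simp add: L1.subspace_inter)
qed

text \<open>
  \<open>L1.dim\<close> is 0 for a subspace without a finite basis, so a dimension of 1 is meaningful, whereas
  infinite dimension has to be expressed as not lying in the span of any finite set.
\<close>

definition infinite_dimensional :: "L1 set \<Rightarrow> bool" where
  "infinite_dimensional V \<longleftrightarrow> \<not> (\<exists>B. finite B \<and> V \<subseteq> L1.span B)"

end

theory Submission
  imports Defs "HOL-Real_Asymp.Real_Asymp"
begin

text \<open>
  Put \<open>\<gamma> = \<beta> / 4\<close> and rescale by \<open>x = 2 t\<close>. For \<open>f\<close> on the positive half-line the two families of conditions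
  say that the periodizations (with period 1) of \<open>f\<close> and of \<open>s \<mapsto> \<gamma> / s\<^sup>2 \<cdot> f (\<gamma> / s)\<close> vanish.

  If \<open>\<gamma> \<le> 1\<close>, eliminating \<open>f\<close> on \<open>(1, \<infinity>)\<close> shows that \<open>f\<close> on \<open>(0, 1)\<close> is invariant under two steps
  of the Gauss-type map \<open>t \<mapsto> frac (\<gamma> / t)\<close> on \<open>(0, \<gamma>)\<close>, and determines \<open>f\<close>. The transfer operator preserves
  the cone of all \<open>k \<ge> 0\<close> with \<open>k\<close> decreasing and \<open>(1 + s)\<^sup>2 k(s)\<close> increasing, on which \<open>sup k \<le> 4 inf k\<close>.
  For \<open>\<gamma> < 1\<close> a fixed proportion of the mass therefore escapes into \<open>[\<gamma>, 1)\<close> in every step, so \<open>f = 0\<close>.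
  For \<open>\<gamma> = 1\<close> the image of the cone lies in its interior, with a fixed multiple of the invariant density
  \<open>1 / (1 + s)\<close> to spare; hence the Gauss map is mixing and \<open>f\<close> is a multiple of that density on \<open>(0, 1)\<close>.

  If \<open>\<gamma> > 1\<close>, there is a smooth cutoff \<open>w\<close> supported in \<open>(0, \<surd>\<gamma>)\<close> whose translates sum to 1. The ansatz
  \<open>f = H - inversion \<gamma> H\<close>, \<open>H = h + w \<cdot> u\<close> with periodic \<open>u\<close> leads to \<open>u - T u = b\<close>, where \<open>T\<close> contracts the total
  variation up to a multiple of the \<open>L\<^sup>1\<close> norm, because \<open>t \<mapsto> \<gamma> / t\<close> is expanding on the support of \<open>w\<close>.
  Hence the equation is solvable under finitely many linear conditions on \<open>h\<close>, and \<open>h\<close> ranges over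
  an infinite-dimensional space.
\<close>

section \<open>Fourier coefficients and fractional parts\<close>

text \<open>The threshold has one geometric source. The map t -> \<gamma> / t has derivative of
  modulus \<gamma> / t^2, which exceeds 1 exactly for t < \<surd>\<gamma>. A continuous cutoff
  supported in (0, \<surd>\<gamma>) whose integer translates sum to 1 exists only when
  \<surd>\<gamma> > 1; for \<gamma> \<le> 1 there is no room left and uniqueness has to come from
  dynamics. For uniqueness the obstacle is that \<open>f\<close> is merely integrable and
  complex-valued. Hence no operator is applied to \<open>f\<close> itself: its integral over a set
  is compared with its integral over iterated preimages. The transfer operator acts only on
  densities in the cone, and what it yields there is carried over to sets or, by approximation, to
  \<open>f\<close>. For existence no Banach space is set up. At each point all operators involved
  are finite combinations of point evaluations, so a Neumann series that converges uniformly solves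
  the equation. Its sum is only known to be continuous, which is enough for an integrable function.
  The solutions are chosen one by one, not linearly in \<open>h\<close>, so the finitely many
  obstructions are recorded as vectors and cancelled by linear algebra.\<close>

lemma borel_measurable_power_int[measurable]:
  fixes e :: "'a \<Rightarrow> complex"
  assumes [measurable]: "e \<in> borel_measurable M"
  shows "(\<lambda>x. e x powi n) \<in> borel_measurable M"
  unfolding power_int_def by (cases "n \<ge> 0") simp_all

text \<open>Letting \<open>f\<close> vary and asking for all moments makes the claim stable under
  products: after multiplication by one polynomial the new function again has all moments zero. On
  the unit circle real and imaginary part are combinations of \<open>e\<close> and its inverse, so a
  linear factor only shifts the index by one in either direction.\<close>

lemma circle_moments_zero_polynomial:
  fixes e :: "'a \<Rightarrow> complex" and g :: "complex \<Rightarrow> real"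
  assumes [measurable]: "e \<in> borel_measurable M" and e: "\<And>x. norm (e x) = 1"
    and g: "real_polynomial_function g"
    and f: "integrable M f" "\<And>n::int. (LINT x|M. f x * e x powi n) = 0"
  shows "integrable M (\<lambda>x. f x * complex_of_real (g (e x))) \<and>
         (\<forall>n::int. (LINT x|M. f x * of_real (g (e x)) * e x powi n) = 0)"
  using g f
proof (induction arbitrary: f)
  case (linear h f)
  have e0: "e x \<noteq> 0" for x using e[of x] by auto
  define c where "c = complex_of_real (h 1)"
  define d where "d = complex_of_real (h \<i>)"
  interpret h: bounded_linear h by fact
  have h: "h z = Re z * h 1 + Im z * h \<i>" for z
  proof -
    have "z = Re z *\<^sub>R 1 + Im z *\<^sub>R \<i>" by (simp add: complex_eq_iff)
    then show ?thesis by (metis h.add h.scaleR real_scaleR_def)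
  qed
  have cnj_e: "cnj (e x) = e x powi (-1)" for x
  proof -
    have "e x * cnj (e x) = 1" using complex_norm_square[of "e x"] e[of x] by simp
    then show ?thesis by (simp add: power_int_minus inverse_unique)
  qed
  have eq: "of_real (h (e x)) = (c / 2 - \<i> * d / 2) * e x powi 1 + (c / 2 + \<i> * d / 2) * e x powi (-1)" for x
    unfolding cnj_e[symmetric] power_int_1_right
    by (subst h) (simp add: c_def d_def complex_eq_iff algebra_simps)
  have int: "integrable M (\<lambda>x. f x * e x powi n)" for n :: int
    by (rule Bochner_Integration.integrable_bound[OF linear(2)])
       (use linear(2) in \<open>auto simp: norm_mult norm_power_int e\<close>)
  have eq2: "f x * of_real (h (e x)) * e x powi n =
      (c / 2 - \<i> * d / 2) * (f x * e x powi (n + 1)) + (c / 2 + \<i> * d / 2) * (f x * e x powi (n - 1))" for x n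
  proof -
    have "e x powi 1 * e x powi n = e x powi (n + 1)" "e x powi (-1) * e x powi n = e x powi (n - 1)"
      using power_int_add[of "e x" 1 n] power_int_add[of "e x" "-1" n] e0[of x]
      by (auto simp: add.commute simp del: power_int_1_right power_int_minus1_right)
    then show ?thesis unfolding eq by (simp only: distrib_left distrib_right mult.assoc mult.left_commute)
  qed
  have "integrable M (\<lambda>x. f x * of_real (h (e x)) * e x powi 0)"
    unfolding eq2 by (intro Bochner_Integration.integrable_add integrable_mult_right int)
  moreover have "(LINT x|M. f x * of_real (h (e x)) * e x powi n) = 0" for n
    unfolding eq2 using int linear(3)
    by (subst Bochner_Integration.integral_add) (auto intro!: integrable_mult_right)
  ultimately show ?case by simp
next
  case (const c f)
  have "(LINT x|M. f x * complex_of_real c * e x powi n) = of_real c * (LINT x|M. f x * e x powi n)" for n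
    by (subst integral_mult_right_zero[symmetric]) (simp add: mult_ac)
  with const show ?case by simp
next
  case (add g1 g2 f)
  have 1: "integrable M (\<lambda>x. f x * of_real (g1 (e x)))" "integrable M (\<lambda>x. f x * of_real (g2 (e x)))"
    using add.IH add.prems by blast+
  have int: "integrable M (\<lambda>x. f x * of_real (g (e x)) * e x powi n)"
    if "integrable M (\<lambda>x. f x * of_real (g (e x)))" for n and g :: "complex \<Rightarrow> real"
    by (rule Bochner_Integration.integrable_bound[OF that])
       (use that in \<open>auto simp: norm_mult norm_power_int e\<close>)
  show ?case
    using 1 add.IH add.prems int[OF 1(1)] int[OF 1(2)] by (simp add: algebra_simps)
next
  case (mult g1 g2 f)
  have "integrable M (\<lambda>x. f x * of_real (g1 (e x)))" "(LINT x|M. f x * of_real (g1 (e x)) * e x powi n) = 0" for n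
    using mult.IH(1) mult.prems by blast+
  then show ?case
    using mult.IH(2)[of "\<lambda>x. f x * of_real (g1 (e x))"] by (simp add: mult.assoc)
qed

text \<open>Trigonometric moments determine a complex measure on the circle: Stone-Weierstrass leads
  from polynomials to continuous functions, ramps around a closed set lead to its indicator, and the
  closed sets are an intersection-stable generator.\<close>

lemma circle_moments_zero_borel:
  fixes e :: "'a \<Rightarrow> complex"
  assumes [measurable]: "e \<in> borel_measurable M" and e: "\<And>x. norm (e x) = 1"
    and f: "integrable M f" "\<And>n::int. (LINT x|M. f x * e x powi n) = 0"
    and B: "B \<in> sets borel"
  shows "(LINT x|M. f x * indicator B (e x)) = 0"
proof -
  have [measurable]: "f \<in> borel_measurable M" using f(1) by auto
  have bdd: "integrable M (\<lambda>x. f x * g x)" if [measurable]: "g \<in> borel_measurable M" and "\<And>x. norm (g x) \<le> C"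
    for g :: "'a \<Rightarrow> complex" and C
  proof (rule Bochner_Integration.integrable_bound)
    show "integrable M (\<lambda>x. C * norm (f x))" using f(1) by simp
    have "norm (f x) * norm (g x) \<le> \<bar>C\<bar> * norm (f x)" for x
      using mult_right_mono[OF order_trans[OF that(2)[of x] abs_ge_self], of "norm (f x)"] by (simp add: mult.commute)
    then show "AE x in M. norm (f x * g x) \<le> norm (C * norm (f x))"
      by (auto simp: norm_mult abs_mult)
  qed simp
  have cont: "(LINT x|M. f x * of_real (\<phi> (e x))) = 0" if \<phi>: "continuous_on UNIV \<phi>" for \<phi> :: "complex \<Rightarrow> real"
  proof -
    define I where "I = (LINT x|M. norm (f x))"
    have I: "I \<ge> 0" by (simp add: I_def)
    have [measurable]: "\<phi> \<in> borel_measurable borel" using \<phi> by (rule borel_measurable_continuous_onI)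
    have "norm (LINT x|M. f x * of_real (\<phi> (e x))) \<le> 0 + \<epsilon>" if "\<epsilon> > 0" for \<epsilon>
    proof -
      have pos: "\<epsilon> / (I + 1) > 0" using that I by simp
      obtain g where g: "real_polynomial_function g"
        and gd: "\<And>z. z \<in> sphere 0 1 \<Longrightarrow> \<bar>\<phi> z - g z\<bar> < \<epsilon> / (I + 1)"
        using Stone_Weierstrass_real_polynomial_function[of "sphere 0 1" \<phi>, OF _ _ pos] \<phi>
        by (metis compact_sphere continuous_on_subset subset_UNIV)
      have gm[measurable]: "g \<in> borel_measurable borel"
        using g by (intro borel_measurable_continuous_onI continuous_on_polymonial_function)
           (simp flip: real_polynomial_function_eq)
      have d: "\<bar>\<phi> (e x) - g (e x)\<bar> \<le> \<epsilon> / (I + 1)" for x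
        using gd[of "e x"] e[of x] by (auto intro: less_imp_le)
      note P = circle_moments_zero_polynomial[OF assms(1) e g f]
      have P0: "(LINT x|M. f x * of_real (g (e x))) = 0"
        using P[THEN conjunct2, rule_format, of 0] by simp
      have int1: "integrable M (\<lambda>x. f x * of_real (\<phi> (e x) - g (e x)))"
        by (rule bdd[where C = "\<epsilon> / (I + 1)"]) (use d in \<open>auto simp flip: of_real_diff\<close>)
      have "(LINT x|M. f x * of_real (\<phi> (e x))) = (LINT x|M. f x * of_real (\<phi> (e x) - g (e x)) + f x * of_real (g (e x)))"
        by (simp add: algebra_simps)
      also have "\<dots> = (LINT x|M. f x * of_real (\<phi> (e x) - g (e x)))"
        using int1 P P0 by (subst Bochner_Integration.integral_add) auto
      also have "norm \<dots> \<le> (LINT x|M. norm (f x * of_real (\<phi> (e x) - g (e x))))"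
        by (rule integral_norm_bound)
      also have "\<dots> \<le> (LINT x|M. norm (f x) * (\<epsilon> / (I + 1)))"
      proof (rule integral_mono)
        show "norm (f x * of_real (\<phi> (e x) - g (e x))) \<le> norm (f x) * (\<epsilon> / (I + 1))" for x
          unfolding norm_mult norm_of_real by (rule mult_left_mono[OF d]) simp
      qed (use f(1) int1 in auto)
      also have "\<dots> = I * (\<epsilon> / (I + 1))" by (simp add: I_def)
      also have "\<dots> \<le> \<epsilon>" using I that by (simp add: field_simps)
      finally show ?thesis by simp
    qed
    then have "norm (LINT x|M. f x * of_real (\<phi> (e x))) \<le> 0" by (rule field_le_epsilon)
    then show ?thesis by simp
  qed
  have bI: "integrable M (\<lambda>x. f x * indicator C (e x))" if [measurable]: "C \<in> sets borel" for C
    by (rule bdd[where C = 1]) (auto simp: indicator_def)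
  have "Int_stable (Collect closed :: complex set set)"
    by (auto simp: Int_stable_def)
  moreover have "Collect closed \<subseteq> Pow (UNIV :: complex set)" by simp
  moreover have "B \<in> sigma_sets UNIV (Collect closed)"
    using B by (simp add: borel_eq_closed)
  ultimately show ?thesis
  proof (induction rule: sigma_sets_induct_disjoint[where \<Omega> = UNIV and G = "Collect closed"])
    case (basic K)
    then have K: "closed K" by simp
    show ?case
    \<comment> \<open>The value \<open>infdist z {}\<close> is 0 by convention, so for the empty set
      the ramps below would be constantly 1 instead of tending to the indicator.\<close>
    proof (cases "K = {}")
      case False
      define \<phi> where "\<phi> k z = max 0 (1 - real k * infdist z K)" for k z
      have c: "continuous_on UNIV (\<phi> k)" for k
        unfolding \<phi>_def by (intro continuous_intros)
      then have [measurable]: "\<phi> k \<in> borel_measurable borel" for k by (rule borel_measurable_continuous_onI)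
      have [measurable]: "K \<in> sets borel" using K by simp
      have lim: "(\<lambda>k. \<phi> k z) \<longlonglongrightarrow> indicator K z" for z
      proof (cases "z \<in> K")
        case True
        then show ?thesis by (simp add: \<phi>_def)
      next
        case F: False
        then have p: "infdist z K > 0" using K False infdist_pos_not_in_closed by blast
        have "\<phi> k z = 0" if "k \<ge> nat \<lceil>1 / infdist z K\<rceil>" for k
        proof -
          have "1 / infdist z K \<le> real k" using that by linarith
          then show ?thesis using p by (simp add: \<phi>_def field_simps)
        qed
        then have "eventually (\<lambda>k. \<phi> k z = 0) sequentially" unfolding eventually_sequentially by blast
        with F show ?thesis by (simp add: tendsto_eventually)
      qed
      have "(\<lambda>k. LINT x|M. f x * of_real (\<phi> k (e x))) \<longlonglongrightarrow> (LINT x|M. f x * of_real (indicator K (e x)))"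
      proof (rule integral_dominated_convergence[where w = "\<lambda>x. norm (f x)"])
        show "AE x in M. (\<lambda>k. f x * complex_of_real (\<phi> k (e x))) \<longlonglongrightarrow> f x * complex_of_real (indicat_real K (e x))"
          by (intro AE_I2 tendsto_intros lim)
        have "\<bar>\<phi> k z\<bar> \<le> 1" for k z by (auto simp: \<phi>_def infdist_nonneg)
        then show "AE x in M. cmod (f x * complex_of_real (\<phi> k (e x))) \<le> cmod (f x)" for k
          by (intro AE_I2) (simp add: norm_mult mult_left_le)
      qed (use f(1) in auto)
      then show ?thesis
        using cont[OF c] by (auto simp: of_real_indicator LIMSEQ_const_iff)
    qed simp
  next
    case (compl C)
    then have [measurable]: "C \<in> sets borel" by (simp add: borel_eq_closed)
    have "(LINT x|M. f x * indicator (UNIV - C) (e x)) = (LINT x|M. f x * e x powi 0 - f x * indicator C (e x))"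
      by (intro Bochner_Integration.integral_cong) (auto simp: indicator_def)
    also have "\<dots> = 0"
      using f compl bI[of C] f(2)[of 0] by (subst Bochner_Integration.integral_diff) auto
    finally show ?case .
  next
    case (union A)
    then have [measurable]: "A i \<in> sets borel" for i by (auto simp: borel_eq_closed)
    have "(LINT x:(\<Union>i. e -` A i \<inter> space M)|M. f x) = (\<Sum>i. LINT x:(e -` A i \<inter> space M)|M. f x)"
    proof (rule lebesgue_integral_countable_add)
      show "set_integrable M (\<Union>i. e -` A i \<inter> space M) f"
        unfolding set_integrable_def using f(1) by (intro integrable_mult_indicator) auto
    qed (use union(1) in \<open>auto simp: disjoint_family_on_def\<close>)
    moreover have "(LINT x:(e -` C \<inter> space M)|M. f x) = (LINT x|M. f x * indicator C (e x))" for C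
      unfolding set_lebesgue_integral_def by (intro Bochner_Integration.integral_cong) (auto simp: indicator_def)
    moreover have "(\<Union>i. e -` A i \<inter> space M) = e -` (\<Union>i. A i) \<inter> space M" by auto
    ultimately show ?case using union(3) by simp
  qed simp_all
qed

text \<open>On the unit circle this is the inverse of \<open>t \<mapsto> exp (2 \<pi> i t)\<close> on \<open>[0, 1)\<close>.\<close>

definition circle_coord :: "complex \<Rightarrow> real" where
  "circle_coord z = (if Im z \<ge> 0 then arccos (max (-1) (min 1 (Re z))) / (2 * pi)
                     else 1 - arccos (max (-1) (min 1 (Re z))) / (2 * pi))"

lemma borel_measurable_circle_coord[measurable]: "circle_coord \<in> borel_measurable borel"
proof -
  have "continuous_on UNIV (\<lambda>x::real. arccos (max (-1) (min 1 x)))"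
    by (rule continuous_on_compose2[OF continuous_on_arccos']) (auto intro!: continuous_intros)
  then have [measurable]: "(\<lambda>x::real. arccos (max (-1) (min 1 x))) \<in> borel_measurable borel"
    by (rule borel_measurable_continuous_onI)
  show ?thesis unfolding circle_coord_def by measurable
qed

lemma circle_coord_cis: "circle_coord (cis (2 * pi * t)) = frac t"
proof -
  define s where "s = frac t"
  have s: "0 \<le> s" "s < 1" by (auto simp: s_def frac_lt_1)
  have "2 * pi * t = 2 * pi * s + 2 * pi * of_int \<lfloor>t\<rfloor>" by (simp add: s_def frac_def algebra_simps)
  then have "cis (2 * pi * t) = cis (2 * pi * s)"
    by (metis cis_multiple_2pi cis_mult mult.right_neutral Ints_of_int)
  moreover have "circle_coord (cis (2 * pi * s)) = s"
  proof (cases "s \<le> 1/2")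
    case True
    then have "sin (2 * pi * s) \<ge> 0" using s by (intro sin_ge_zero) auto
    moreover have "arccos (cos (2 * pi * s)) = 2 * pi * s" using s True by (intro arccos_cos) auto
    ultimately show ?thesis by (simp add: circle_coord_def)
  next
    case False
    then have "sin (2 * pi * (1 - s)) > 0" using s by (intro sin_gt_zero) auto
    then have "sin (2 * pi * s) < 0" by (simp add: right_diff_distrib sin_diff)
    moreover have "arccos (cos (2 * pi * (1 - s))) = 2 * pi * (1 - s)"
      using s False by (intro arccos_cos) auto
    then have "arccos (cos (2 * pi * s)) = 2 * pi * (1 - s)" by (simp add: right_diff_distrib cos_diff)
    ultimately show ?thesis by (simp add: circle_coord_def)
  qed
  ultimately show ?thesis by (simp add: s_def)
qed

text \<open>The fractional part of \<open>\<theta> x\<close> depends only on the point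
  \<open>cis (2 * pi * \<theta> x)\<close> of the circle, from which \<open>circle_coord\<close>
  recovers it; the event is therefore a Borel event on the circle.\<close>

lemma fourier_zero_imp_frac_zero:
  fixes \<theta> :: "'a \<Rightarrow> real"
  assumes [measurable]: "\<theta> \<in> borel_measurable M" and f: "integrable M f"
    and z: "\<And>n::int. (LINT x|M. f x * exp (\<i> * of_int n * of_real (2 * pi * \<theta> x))) = 0"
    and [measurable]: "A \<in> sets borel"
  shows "(LINT x|M. f x * indicator A (frac (\<theta> x))) = 0"
proof -
  define B where "B = circle_coord -` A \<inter> space borel"
  have B[measurable]: "B \<in> sets borel" unfolding B_def by measurable
  have [measurable]: "(\<lambda>x. cis (2 * pi * \<theta> x)) \<in> borel_measurable M"
    by (rule measurable_compose[of _ _ borel cis, OF _ borel_measurable_continuous_onI]) (auto intro: continuous_on_cis continuous_on_id)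
  have "(LINT x|M. f x * indicator B (cis (2 * pi * \<theta> x))) = 0"
  proof (rule circle_moments_zero_borel)
    fix n :: int
    have "cis (2 * pi * \<theta> x) powi n = exp (\<i> * of_int n * of_real (2 * pi * \<theta> x))" for x
      unfolding cis_power_int by (simp add: cis_conv_exp mult_ac)
    then show "(LINT x|M. f x * cis (2 * pi * \<theta> x) powi n) = 0"
      using z[of n] by simp
  qed (use f B in auto)
  then show ?thesis by (simp add: B_def indicator_def circle_coord_cis)
qed

section \<open>The transfer operator of the Gauss-type maps\<close>

lemma borel_measurable_frac[measurable]: "(frac :: real \<Rightarrow> real) \<in> borel_measurable borel"
  unfolding frac_def by measurable

section \<open>Folding the half-line into the unit interval, and the substitution t -> \<gamma> /
  t\<close>

lemma summable_inverse_Suc_square: "summable (\<lambda>j. 1 / real (Suc j) ^ 2)"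
  using inverse_power_summable[of 2, where 'a = real] summable_Suc_iff[of "\<lambda>n. 1 / real n ^ 2"]
  by (simp add: inverse_eq_divide)

lemma integral_unfold_unit_interval:
  fixes g :: "real \<Rightarrow> 'b::{banach, second_countable_topology}"
  assumes "set_integrable lborel {real m..} g"
  shows "(LINT y:{real m..}|lborel. g y) = (\<Sum>j. LINT s:{0..<1}|lborel. g (s + real (j + m)))"
proof -
  have U: "(\<Union>j. {real (j + m)..<real (j + m) + 1}) = {real m..}"
  proof (intro set_eqI iffI)
    fix x assume "x \<in> {real m..}"
    then have x: "real m \<le> x" by simp
    then have "x \<in> {real (nat \<lfloor>x\<rfloor> - m + m)..<real (nat \<lfloor>x\<rfloor> - m + m) + 1}"
      by (auto simp: le_nat_floor)
    then show "x \<in> (\<Union>j. {real (j + m)..<real (j + m) + 1})" by blast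
  qed auto
  have "(LINT y:{real m..}|lborel. g y) = (\<Sum>j. LINT y:{real (j + m)..<real (j + m) + 1}|lborel. g y)"
    unfolding U[symmetric]
    by (rule lebesgue_integral_countable_add) (use assms U in auto)
  moreover have "(LINT y:{real (j + m)..<real (j + m) + 1}|lborel. g y) = (LINT s:{0..<1}|lborel. g (s + real (j + m)))" for j
    unfolding set_lebesgue_integral_def
    by (subst lborel_integral_real_affine[where c = 1 and t = "real (j + m)"])
       (auto simp: indicator_def add.commute intro!: Bochner_Integration.integral_cong)
  ultimately show ?thesis by simp
qed

lemma
  fixes k :: "real \<Rightarrow> 'b::euclidean_space"
  assumes \<gamma>: "\<gamma> > 0" and [measurable]: "k \<in> borel_measurable borel"
    and k: "set_integrable lborel {0<..} k"
  shows set_integrable_inversion: "set_integrable lborel {0<..} (\<lambda>s. (\<gamma> / s\<^sup>2) *\<^sub>R k (\<gamma> / s))"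
    and set_integral_inversion:
      "(LINT s:{0<..}|lborel. (\<gamma> / s\<^sup>2) *\<^sub>R k (\<gamma> / s)) = (LINT t:{0<..}|lborel. k t)"
proof -
  \<comment> \<open>The change of variables below speaks about completed Lebesgue measure; Borel
    measurability of the integrand is what brings its conclusion back to
    \<open>lborel\<close>.\<close>
  have [measurable]: "(\<lambda>x. indicat_real {0<..} x *\<^sub>R (\<gamma> / x\<^sup>2) *\<^sub>R k (\<gamma> / x)) \<in> borel_measurable lborel"
    by measurable
  have im: "(\<lambda>s. \<gamma> / s) ` {0<..} = {0<..}"
    using \<gamma> by (auto simp: image_iff intro!: bexI[where x = "\<gamma> / x" for x])
  have inj: "inj_on (\<lambda>s. \<gamma> / s) {0<..}"
    using \<gamma> by (auto simp: inj_on_def)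
  have der: "((\<lambda>s. \<gamma> / s) has_field_derivative (- \<gamma> / s\<^sup>2)) (at s within {0<..})" if "s \<in> {0<..}" for s
    using that by (auto intro!: derivative_eq_intros simp: power2_eq_square)
  have kl: "k absolutely_integrable_on {0<..}"
    using k unfolding set_integrable_def by (simp add: integrable_completion)
  have "(\<lambda>s. \<bar>- \<gamma> / s\<^sup>2\<bar> *\<^sub>R k (\<gamma> / s)) absolutely_integrable_on {0<..} \<and>
      integral {0<..} (\<lambda>s. \<bar>- \<gamma> / s\<^sup>2\<bar> *\<^sub>R k (\<gamma> / s)) = integral {0<..} k"
    using has_absolute_integral_change_of_variables_real[of "{0<..}" "\<lambda>s. \<gamma> / s" "\<lambda>s. - \<gamma> / s\<^sup>2" k "integral {0<..} k"]
      der inj im kl by auto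
  then have 1: "(\<lambda>s. (\<gamma> / s\<^sup>2) *\<^sub>R k (\<gamma> / s)) absolutely_integrable_on {0<..}"
      "integral {0<..} (\<lambda>s. (\<gamma> / s\<^sup>2) *\<^sub>R k (\<gamma> / s)) = integral {0<..} k"
    using \<gamma> by auto
  show 2: "set_integrable lborel {0<..} (\<lambda>s. (\<gamma> / s\<^sup>2) *\<^sub>R k (\<gamma> / s))"
    using 1(1) unfolding set_integrable_def by (simp add: integrable_completion)
  show "(LINT s:{0<..}|lborel. (\<gamma> / s\<^sup>2) *\<^sub>R k (\<gamma> / s)) = (LINT t:{0<..}|lborel. k t)"
    using 1(2) set_borel_integral_eq_integral(2)[OF 2] set_borel_integral_eq_integral(2)[OF k] by simp
qed

text \<open>The map lives on (0, \<gamma>) only, so for \<gamma> < 1 points of [\<gamma>, 1) have no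
  image and are lost. Accordingly \<open>(gauss_preimage \<gamma> ^^ n) UNIV\<close> is the set of
  points for which n steps can be carried out.\<close>

definition gauss_preimage :: "real \<Rightarrow> real set \<Rightarrow> real set" where
  "gauss_preimage \<gamma> A = {t. 0 < t \<and> t < \<gamma> \<and> frac (\<gamma> / t) \<in> A}"

text \<open>The Perron-Frobenius operator of t -> frac (\<gamma> / t). Since t < \<gamma> means
  \<gamma> / t > 1, the inverse branches are s -> \<gamma> / (s + j) with j starting at 1; the
  weights are their Jacobians.\<close>

definition transfer_op :: "real \<Rightarrow> (real \<Rightarrow> real) \<Rightarrow> real \<Rightarrow> real" where
  "transfer_op \<gamma> k s = (\<Sum>j. \<gamma> / (s + real (Suc j))\<^sup>2 * k (\<gamma> / (s + real (Suc j))))"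

lemma gauss_preimage_borel[measurable (raw)]:
  assumes [measurable]: "A \<in> sets borel"
  shows "gauss_preimage \<gamma> A \<in> sets borel"
  unfolding gauss_preimage_def by measurable

lemma gauss_preimage_power_borel:
  "A \<in> sets borel \<Longrightarrow> (gauss_preimage \<gamma> ^^ n) A \<in> sets borel"
  by (induction n) (auto intro: gauss_preimage_borel)

lemma borel_measurable_transfer_op[measurable (raw)]:
  assumes [measurable]: "k \<in> borel_measurable borel"
  shows "transfer_op \<gamma> k \<in> borel_measurable borel"
  unfolding transfer_op_def by measurable

lemma set_integrable_bounded_unit:
  fixes g :: "real \<Rightarrow> real"
  assumes [measurable]: "g \<in> borel_measurable borel" and "\<And>s. s \<in> {0<..<1} \<Longrightarrow> \<bar>g s\<bar> \<le> C"
  shows "set_integrable lborel {0<..<1} g"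
  unfolding set_integrable_def
proof (rule Bochner_Integration.integrable_bound)
  show "integrable lborel (\<lambda>s::real. indicat_real {0<..<1} s * C)" by (intro integrable_mult_left integrable_real_indicator) auto
  show "AE s in lborel. norm (indicat_real {0<..<1} s *\<^sub>R g s) \<le> norm (indicat_real {0<..<1} s * C)"
    using assms(2) by (intro AE_I2) (force simp: indicator_def)
qed simp

context
  fixes \<gamma> :: real and k :: "real \<Rightarrow> real" and B :: real
  assumes \<gamma>: "0 < \<gamma>" "\<gamma> \<le> 1" and k: "\<And>s. s \<in> {0<..<1} \<Longrightarrow> 0 \<le> k s \<and> k s \<le> B"
begin

lemma branch_in_unit:
  assumes "s \<in> {0<..<1}"
  shows "\<gamma> / (s + real (Suc j)) \<in> {0<..<1}"
  using assms \<gamma> by (auto simp: field_simps)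

lemma branch_bounds:
  assumes "s \<in> {0<..<1}"
  shows "0 \<le> \<gamma> / (s + real (Suc j))\<^sup>2 * k (\<gamma> / (s + real (Suc j)))"
    and "\<gamma> / (s + real (Suc j))\<^sup>2 * k (\<gamma> / (s + real (Suc j))) \<le> B * (1 / real (Suc j) ^ 2)"
proof -
  note kk = k[OF branch_in_unit[OF assms, of j]]
  have "\<gamma> / (s + real (Suc j))\<^sup>2 \<le> 1 / real (Suc j) ^ 2"
    using assms \<gamma> by (intro frac_le power_mono) auto
  then show "\<gamma> / (s + real (Suc j))\<^sup>2 * k (\<gamma> / (s + real (Suc j))) \<le> B * (1 / real (Suc j) ^ 2)"
    using kk \<gamma> by (subst (2) mult.commute) (intro mult_mono, auto)
  show "0 \<le> \<gamma> / (s + real (Suc j))\<^sup>2 * k (\<gamma> / (s + real (Suc j)))"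
    using kk \<gamma> by simp
qed

lemma summable_transfer_op:
  assumes "s \<in> {0<..<1}"
  shows "summable (\<lambda>j. \<gamma> / (s + real (Suc j))\<^sup>2 * k (\<gamma> / (s + real (Suc j))))"
proof (rule summable_comparison_test')
  show "summable (\<lambda>j. B * (1 / real (Suc j) ^ 2))"
    by (intro summable_mult summable_inverse_Suc_square)
  show "norm (\<gamma> / (s + real (Suc j))\<^sup>2 * k (\<gamma> / (s + real (Suc j)))) \<le> B * (1 / real (Suc j) ^ 2)" if "j \<ge> 0" for j
    using branch_bounds[OF assms, of j] by simp
qed

lemma transfer_op_nonneg: "s \<in> {0<..<1} \<Longrightarrow> 0 \<le> transfer_op \<gamma> k s"
  unfolding transfer_op_def by (intro suminf_nonneg summable_transfer_op branch_bounds)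

text \<open>Replacing t by \<gamma> / t sends (0, \<gamma>) to (1, \<infinity>) and turns frac
  (\<gamma> / t) into the fractional part of the new variable. Cutting (1, \<infinity>) at the
  integers then gives one piece per inverse branch, and the bound by inverse squares allows the sum
  to be exchanged with the integral.\<close>

lemma integral_transfer_op:
  assumes [measurable]: "k \<in> borel_measurable borel" "A \<in> sets borel"
  shows "(LINT t:{0<..<1}|lborel. k t * indicator (gauss_preimage \<gamma> A) t) =
         (LINT s:{0<..<1}|lborel. transfer_op \<gamma> k s * indicator A s)"
proof -
  define p where "p t = indicat_real {0<..<\<gamma>} t * k t * indicator A (frac (\<gamma> / t))" for t
  define q where "q s = (\<gamma> / s\<^sup>2) *\<^sub>R p (\<gamma> / s)" for s
  have [measurable]: "p \<in> borel_measurable borel" unfolding p_def by measurable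
  have p0: "p t = 0" if "t \<le> 0 \<or> t \<ge> 1" for t using that \<gamma> by (auto simp: p_def indicator_def)
  have pB: "\<bar>p t\<bar> \<le> B" if "t \<in> {0<..<1}" for t
    using k[OF that] by (auto simp: p_def indicator_def)
  have "set_integrable lborel {0<..<1} p"
    by (rule set_integrable_bounded_unit[OF _ pB]) auto
  also have "set_integrable lborel {0<..<1} p \<longleftrightarrow> set_integrable lborel {0<..} p"
    unfolding set_integrable_def by (intro Bochner_Integration.integrable_cong) (auto simp: indicator_def p0)
  finally have ip: "set_integrable lborel {0<..} p" .
  note iq = set_integrable_inversion[OF \<gamma>(1) _ ip, folded q_def]
  note sq = set_integral_inversion[OF \<gamma>(1) _ ip, folded q_def]
  have q0: "q s = 0" if "0 < s" "s \<le> 1" for s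
    using that \<gamma> by (auto simp: q_def p_def indicator_def field_simps)
  have iq1: "set_integrable lborel {real 1..} q"
    by (rule set_integrable_subset[OF iq]) auto
  have br: "(LINT s:{0..<1}|lborel. q (s + real (j + 1))) =
      (LINT s|lborel. indicator {0<..<1} s * (\<gamma> / (s + real (Suc j))\<^sup>2 * k (\<gamma> / (s + real (Suc j)))) * indicator A s)" for j
    unfolding set_lebesgue_integral_def
  proof (rule integral_cong_AE)
    have "AE s in lborel. s \<noteq> (0::real)" by (rule AE_lborel_singleton)
    then show "AE s in lborel. indicat_real {0..<1} s *\<^sub>R q (s + real (j + 1)) =
       indicator {0<..<1} s * (\<gamma> / (s + real (Suc j))\<^sup>2 * k (\<gamma> / (s + real (Suc j)))) * indicator A s"
    proof eventually_elim
      case (elim s)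
      show ?case
      proof (cases "s \<in> {0<..<1}")
        case True
        have "frac (s + real (Suc j)) = s"
          using True by (simp add: frac_unique_iff)
        moreover have "\<gamma> / (s + real (Suc j)) < \<gamma>" using True \<gamma> by (simp add: divide_less_eq)
        ultimately show ?thesis using True \<gamma> branch_in_unit[OF True, of j]
          by (simp add: q_def p_def indicator_def)
      qed (use elim in \<open>auto simp: indicator_def\<close>)
    qed
  qed (auto simp: q_def)
  have "(LINT t:{0<..<1}|lborel. k t * indicator (gauss_preimage \<gamma> A) t) = (LINT t:{0<..}|lborel. p t)"
    unfolding set_lebesgue_integral_def using \<gamma>
    by (intro Bochner_Integration.integral_cong) (auto simp: indicator_def p_def gauss_preimage_def)
  also have "\<dots> = (LINT s:{0<..}|lborel. q s)" using sq by simp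
  also have "\<dots> = (LINT s:{real 1..}|lborel. q s)"
    unfolding set_lebesgue_integral_def
    by (intro Bochner_Integration.integral_cong) (auto simp: indicator_def q0)
  also have "\<dots> = (\<Sum>j. LINT s:{0..<1}|lborel. q (s + real (j + 1)))"
    by (rule integral_unfold_unit_interval[OF iq1])
  also have "\<dots> = (\<Sum>j. LINT s|lborel. indicator {0<..<1} s * (\<gamma> / (s + real (Suc j))\<^sup>2 * k (\<gamma> / (s + real (Suc j)))) * indicator A s)"
    by (simp only: br)
  also have "\<dots> = (LINT s|lborel. (\<Sum>j. indicator {0<..<1} s * (\<gamma> / (s + real (Suc j))\<^sup>2 * k (\<gamma> / (s + real (Suc j)))) * indicator A s))"
  proof (rule integral_suminf[symmetric])
    let ?g = "\<lambda>j s. indicat_real {0<..<1} s * (\<gamma> / (s + real (Suc j))\<^sup>2 * k (\<gamma> / (s + real (Suc j)))) * indicator A s"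
    have bd: "\<bar>?g j s\<bar> \<le> indicator {0<..<1} s * (B * (1 / real (Suc j) ^ 2))" for j s
      using branch_bounds[of s j] by (auto simp: indicator_def)
    have int1: "integrable lborel (\<lambda>s::real. indicat_real {0<..<1} s * (B * (1 / real (Suc j) ^ 2)))" for j
      by (intro integrable_mult_left integrable_real_indicator) auto
    show i: "integrable lborel (?g j)" for j
    proof (rule Bochner_Integration.integrable_bound[OF int1[of j]])
      show "AE s in lborel. norm (?g j s) \<le> norm (indicat_real {0<..<1} s * (B * (1 / real (Suc j) ^ 2)))"
        unfolding real_norm_def by (intro AE_I2 order_trans[OF bd abs_ge_self])
    qed simp
    show "AE s in lborel. summable (\<lambda>j. norm (?g j s))"
    proof (intro AE_I2)
      fix s :: real
      have "summable (\<lambda>j. indicat_real {0<..<1} s * (B * (1 / real (Suc j) ^ 2)))"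
        by (intro summable_mult summable_inverse_Suc_square)
      then show "summable (\<lambda>j. norm (?g j s))"
        by (rule summable_comparison_test') (use bd in \<open>simp only: real_norm_def abs_idempotent\<close>)
    qed
    show "summable (\<lambda>j. LINT s|lborel. norm (?g j s))"
    proof (rule summable_comparison_test')
      show "summable (\<lambda>j. B * (1 / real (Suc j) ^ 2))"
        by (intro summable_mult summable_inverse_Suc_square)
      fix j :: nat assume "j \<ge> 0"
      have "(LINT s|lborel. norm (?g j s)) \<le> (LINT s::real|lborel. indicator {0<..<1} s * (B * (1 / real (Suc j) ^ 2)))"
        by (rule integral_mono[OF integrable_norm[OF i] int1]) (simp only: real_norm_def bd)
      then show "norm (LINT s|lborel. norm (?g j s)) \<le> B * (1 / real (Suc j) ^ 2)" by simp
    qed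
  qed
  also have "\<dots> = (LINT s:{0<..<1}|lborel. transfer_op \<gamma> k s * indicator A s)"
    unfolding set_lebesgue_integral_def
  proof (rule Bochner_Integration.integral_cong[OF refl])
    fix s :: real
    show "(\<Sum>j. indicat_real {0<..<1} s * (\<gamma> / (s + real (Suc j))\<^sup>2 * k (\<gamma> / (s + real (Suc j)))) * indicator A s)
        = indicat_real {0<..<1} s *\<^sub>R (transfer_op \<gamma> k s * indicator A s)"
      using suminf_mult2[OF summable_transfer_op, of s "indicator A s"]
      by (cases "s \<in> {0<..<1}") (auto simp: transfer_op_def)
  qed
  finally show ?thesis .
qed

end

section \<open>An invariant cone\<close>

text \<open>For positive differentiable \<open>k\<close> the monotonicity conditions say that the
  logarithmic derivative lies between -2 / (1 + s) and 0. The density 1 / (1 + s), with logarithmic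
  derivative -1 / (1 + s), sits in the middle and so has room on both sides.\<close>

definition gauss_cone :: "(real \<Rightarrow> real) set" where
  "gauss_cone = {k. k \<in> borel_measurable borel \<and> (\<forall>s\<in>{0<..<1}. 0 \<le> k s) \<and>
     (\<forall>s t. 0 < s \<longrightarrow> s \<le> t \<longrightarrow> t < 1 \<longrightarrow> k t \<le> k s \<and> (1 + s)\<^sup>2 * k s \<le> (1 + t)\<^sup>2 * k t)}"

definition unit_mass :: "(real \<Rightarrow> real) \<Rightarrow> real" where
  "unit_mass k = (LINT s:{0<..<1}|lborel. k s)"

lemma gauss_coneD:
  assumes "k \<in> gauss_cone"
  shows "k \<in> borel_measurable borel" "s \<in> {0<..<1} \<Longrightarrow> 0 \<le> k s"
    "0 < s \<Longrightarrow> s \<le> t \<Longrightarrow> t < 1 \<Longrightarrow> k t \<le> k s"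
    "0 < s \<Longrightarrow> s \<le> t \<Longrightarrow> t < 1 \<Longrightarrow> (1 + s)\<^sup>2 * k s \<le> (1 + t)\<^sup>2 * k t"
  using assms by (auto simp: gauss_cone_def)

text \<open>To the right of \<open>s\<close> the function can only drop by the range of (1 + s)^2 on
  the unit interval, which is the factor 4; to the left of \<open>s\<close> it is at least as
  large.\<close>

lemma gauss_cone_ratio:
  assumes k: "k \<in> gauss_cone" and s: "s \<in> {0<..<1}" and t: "t \<in> {0<..<1}"
  shows "k s \<le> 4 * k t"
proof (cases "s \<le> t")
  case True
  have "k s * 1 \<le> k s * (1 + s)\<^sup>2"
    using gauss_coneD(2)[OF k s] s by (intro mult_left_mono) (auto simp: power2_eq_square algebra_simps)
  also have "\<dots> \<le> (1 + t)\<^sup>2 * k t"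
    using gauss_coneD(4)[OF k _ True] s t by (simp add: mult.commute)
  also have "\<dots> \<le> 2\<^sup>2 * k t"
    using t gauss_coneD(2)[OF k t] by (intro mult_right_mono power_mono) auto
  finally show ?thesis by simp
next
  case False
  then have "k s \<le> k t" using gauss_coneD(3)[OF k, of t s] s t by auto
  then show ?thesis using gauss_coneD(2)[OF k t] by simp
qed

lemma gauss_cone_bounds:
  assumes k: "k \<in> gauss_cone" and s: "s \<in> {0<..<1}"
  shows "0 \<le> k s \<and> k s \<le> 4 * k (1 / 2)"
  using gauss_coneD(2)[OF k s] gauss_cone_ratio[OF k s, of "1 / 2"] by simp

lemma set_integrable_gauss_cone:
  assumes "k \<in> gauss_cone"
  shows "set_integrable lborel {0<..<1} k"
  using gauss_cone_bounds[OF assms] gauss_coneD(1)[OF assms]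
  by (intro set_integrable_bounded_unit[where C = "4 * k (1 / 2)"]) auto

lemma unit_mass_nonneg: "k \<in> gauss_cone \<Longrightarrow> 0 \<le> unit_mass k"
  unfolding unit_mass_def set_lebesgue_integral_def
  by (intro integral_nonneg_AE AE_I2) (auto simp: indicator_def gauss_coneD(2))

lemma set_integral_unit_const: "(LINT s:{0<..<1::real}|lborel. (c::real)) = c"
  by (simp add: set_lebesgue_integral_def)

lemma unit_mass_le:
  assumes k: "k \<in> gauss_cone" and t: "t \<in> {0<..<1}"
  shows "unit_mass k \<le> 4 * k t"
proof -
  have "unit_mass k \<le> (LINT s:{0<..<1::real}|lborel. 4 * k t)"
    unfolding unit_mass_def
    by (rule set_integral_mono[OF set_integrable_gauss_cone[OF k]])
       (use gauss_cone_ratio[OF k _ t] in \<open>auto simp: set_integrable_def\<close>)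
  then show ?thesis by (simp add: set_integral_unit_const)
qed

text \<open>Each inverse branch is decreasing and so exchanges the two cone conditions. For x =
  \<gamma> / (s + j), x^2 k(x) is (x / (1 + x))^2 times (1 + x)^2 k(x), a product of functions
  increasing in x and hence decreasing in s. Conversely (1 + s) / (s + j) is nondecreasing for j
  \<ge> 1, and k(x) is nondecreasing in s because \<open>k\<close> decreases.\<close>

lemma transfer_term_mono:
  fixes \<gamma> :: real
  assumes k: "k \<in> gauss_cone" and \<gamma>: "0 < \<gamma>" "\<gamma> \<le> 1" and st: "0 < s" "s \<le> t" "t < 1"
  shows "\<gamma> / (t + real (Suc j))\<^sup>2 * k (\<gamma> / (t + real (Suc j))) \<le> \<gamma> / (s + real (Suc j))\<^sup>2 * k (\<gamma> / (s + real (Suc j)))"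
    and "(1 + s)\<^sup>2 * (\<gamma> / (s + real (Suc j))\<^sup>2 * k (\<gamma> / (s + real (Suc j)))) \<le>
         (1 + t)\<^sup>2 * (\<gamma> / (t + real (Suc j))\<^sup>2 * k (\<gamma> / (t + real (Suc j))))"
proof -
  define x where "x = \<gamma> / (s + real (Suc j))"
  define y where "y = \<gamma> / (t + real (Suc j))"
  have xy: "0 < y" "y \<le> x" "x < 1"
    using st \<gamma> by (auto simp: x_def y_def field_simps)
  have e1: "\<gamma> / (s + real (Suc j))\<^sup>2 = x\<^sup>2 / \<gamma>" "\<gamma> / (t + real (Suc j))\<^sup>2 = y\<^sup>2 / \<gamma>"
    using \<gamma> by (auto simp: x_def y_def power_divide power2_eq_square)
  have "y / (1 + y) \<le> x / (1 + x)" using xy by (simp add: field_simps)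
  then have le: "(y / (1 + y))\<^sup>2 * ((1 + y)\<^sup>2 * k y) \<le> (x / (1 + x))\<^sup>2 * ((1 + x)\<^sup>2 * k x)"
    by (rule mult_mono[OF power_mono]) (use xy gauss_coneD(2)[OF k, of y] gauss_coneD(4)[OF k, of y x] in auto)
  have eq: "(z / (1 + z))\<^sup>2 * ((1 + z)\<^sup>2 * k z) = z\<^sup>2 * k z" if "z > 0" for z
    using that by (simp add: power_divide)
  have "y\<^sup>2 * k y \<le> x\<^sup>2 * k x" using le eq[of x] eq[of y] xy by simp
  then show "\<gamma> / (t + real (Suc j))\<^sup>2 * k (\<gamma> / (t + real (Suc j))) \<le> \<gamma> / (s + real (Suc j))\<^sup>2 * k (\<gamma> / (s + real (Suc j)))"
    unfolding e1 x_def[symmetric] y_def[symmetric] using \<gamma> by (simp add: divide_right_mono)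
  have "(1 + s) / (s + real (Suc j)) \<le> (1 + t) / (t + real (Suc j))"
    using st by (simp add: field_simps mult_right_mono)
  then have "((1 + s) / (s + real (Suc j)))\<^sup>2 * (\<gamma> * k x) \<le> ((1 + t) / (t + real (Suc j)))\<^sup>2 * (\<gamma> * k y)"
    using xy gauss_coneD(2,3)[OF k] \<gamma> st by (intro mult_mono power_mono) auto
  then show "(1 + s)\<^sup>2 * (\<gamma> / (s + real (Suc j))\<^sup>2 * k (\<gamma> / (s + real (Suc j)))) \<le>
         (1 + t)\<^sup>2 * (\<gamma> / (t + real (Suc j))\<^sup>2 * k (\<gamma> / (t + real (Suc j))))"
    unfolding x_def[symmetric] y_def[symmetric] by (simp add: power_divide mult_ac)
qed

lemma transfer_op_gauss_cone:
  assumes k: "k \<in> gauss_cone" and \<gamma>: "0 < \<gamma>" "\<gamma> \<le> 1"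
  shows "transfer_op \<gamma> k \<in> gauss_cone"
proof -
  note b = gauss_cone_bounds[OF k]
  have sm: "summable (\<lambda>j. \<gamma> / (r + real (Suc j))\<^sup>2 * k (\<gamma> / (r + real (Suc j))))" if "r \<in> {0<..<1}" for r
    by (rule summable_transfer_op[OF \<gamma> _ that]) (rule b)
  have "transfer_op \<gamma> k t \<le> transfer_op \<gamma> k s \<and> (1 + s)\<^sup>2 * transfer_op \<gamma> k s \<le> (1 + t)\<^sup>2 * transfer_op \<gamma> k t"
    if st: "0 < s" "s \<le> t" "t < 1" for s t
  proof
    show "transfer_op \<gamma> k t \<le> transfer_op \<gamma> k s"
      unfolding transfer_op_def using st by (intro suminf_le sm transfer_term_mono(1)[OF k \<gamma> st]) auto
    show "(1 + s)\<^sup>2 * transfer_op \<gamma> k s \<le> (1 + t)\<^sup>2 * transfer_op \<gamma> k t"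
    proof -
      have st': "s \<in> {0<..<1}" "t \<in> {0<..<1}" using st by auto
      have "(1 + r)\<^sup>2 * transfer_op \<gamma> k r = (\<Sum>j. (1 + r)\<^sup>2 * (\<gamma> / (r + real (Suc j))\<^sup>2 * k (\<gamma> / (r + real (Suc j)))))"
        if "r \<in> {0<..<1}" for r
        unfolding transfer_op_def by (rule suminf_mult[OF sm[OF that], symmetric])
      from this[OF st'(1)] this[OF st'(2)] show ?thesis
        by (simp only:) (intro suminf_le summable_mult sm st' transfer_term_mono(2)[OF k \<gamma> st])
    qed
  qed
  then show ?thesis
    using transfer_op_nonneg[OF \<gamma> b] gauss_coneD(1)[OF k] by (auto simp: gauss_cone_def)
qed

lemma one_gauss_cone: "(\<lambda>_. 1) \<in> gauss_cone"
  by (auto simp: gauss_cone_def intro!: power_mono)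

section \<open>Escape of mass through the hole\<close>

lemma gauss_preimage_mono: "A \<subseteq> B \<Longrightarrow> gauss_preimage \<gamma> A \<subseteq> gauss_preimage \<gamma> B"
  by (auto simp: gauss_preimage_def)

lemma gauss_preimage_power_mono: "A \<subseteq> B \<Longrightarrow> (gauss_preimage \<gamma> ^^ n) A \<subseteq> (gauss_preimage \<gamma> ^^ n) B"
  by (induction n) (simp_all add: gauss_preimage_mono)

lemma gauss_survivors_decseq: "decseq (\<lambda>n. (gauss_preimage \<gamma> ^^ n) UNIV)"
proof (rule decseq_SucI)
  show "(gauss_preimage \<gamma> ^^ Suc n) UNIV \<subseteq> (gauss_preimage \<gamma> ^^ n) UNIV" for n
    by (simp only: funpow_Suc_right o_apply gauss_preimage_power_mono subset_UNIV)
qed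

text \<open>A cone function gives the hole \<open>[\<gamma>, 1)\<close> at least the fraction \<open>(1 - \<gamma>) / 4\<close> of its mass.\<close>

lemma gauss_survivor_mass:
  assumes k: "k \<in> gauss_cone" and \<gamma>: "0 < \<gamma>" "\<gamma> \<le> 1"
  shows "(LINT t:{0<..<1}|lborel. k t * indicator ((gauss_preimage \<gamma> ^^ n) UNIV) t) \<le> (1 - (1 - \<gamma>) / 4) ^ n * unit_mass k"
  using k
proof (induction n arbitrary: k)
  case 0
  then show ?case by (simp add: unit_mass_def)
next
  case (Suc n)
  note k = Suc.prems
  note b = gauss_cone_bounds[OF k]
  have [measurable]: "k \<in> borel_measurable borel" using gauss_coneD(1)[OF k] .
  have km: "unit_mass (transfer_op \<gamma> k) \<le> (1 - (1 - \<gamma>) / 4) * unit_mass k"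
  proof -
    have "unit_mass (transfer_op \<gamma> k) = (LINT t:{0<..<1}|lborel. k t * indicator (gauss_preimage \<gamma> UNIV) t)"
      using integral_transfer_op[OF \<gamma> b, where A = UNIV] by (simp add: unit_mass_def)
    also have "\<dots> \<le> (LINT t:{0<..<1}|lborel. k t - indicator {\<gamma>..<1} t * (unit_mass k / 4))"
    proof (rule set_integral_mono)
      show "set_integrable lborel {0<..<1} (\<lambda>t. k t * indicat_real (gauss_preimage \<gamma> UNIV) t)"
        proof (rule set_integrable_bounded_unit[where C = "4 * k (1 / 2)"])
        have [measurable]: "gauss_preimage \<gamma> UNIV \<in> sets borel" by (rule gauss_preimage_borel) simp
        show "(\<lambda>t. k t * indicat_real (gauss_preimage \<gamma> UNIV) t) \<in> borel_measurable borel" by measurable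
        show "\<bar>k s * indicat_real (gauss_preimage \<gamma> UNIV) s\<bar> \<le> 4 * k (1 / 2)" if "s \<in> {0<..<1}" for s
          using b[OF that] by (auto simp: indicator_def)
      qed
      have "set_integrable lborel {0<..<1} (\<lambda>t. indicator {\<gamma>..<1} t * (unit_mass k / 4))"
        using unit_mass_nonneg[OF k]
        by (intro set_integrable_bounded_unit[where C = "unit_mass k / 4"]) (auto simp: indicator_def)
      then show "set_integrable lborel {0<..<1} (\<lambda>t. k t - indicator {\<gamma>..<1} t * (unit_mass k / 4))"
        by (intro set_integral_diff set_integrable_gauss_cone[OF k])
      show "k t * indicat_real (gauss_preimage \<gamma> UNIV) t \<le> k t - indicator {\<gamma>..<1} t * (unit_mass k / 4)"
        if "t \<in> {0<..<1}" for t
        using that unit_mass_le[OF k that] gauss_coneD(2)[OF k that]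
        by (auto simp: indicator_def gauss_preimage_def)
    qed
    also have "\<dots> = unit_mass k - (LINT t:{0<..<1}|lborel. indicator {\<gamma>..<1} t * (unit_mass k / 4))"
      unfolding unit_mass_def[of k]
      using unit_mass_nonneg[OF k]
      by (intro set_integral_diff set_integrable_gauss_cone[OF k] set_integrable_bounded_unit[where C = "unit_mass k / 4"])
         (auto simp: indicator_def unit_mass_def)
    also have "(LINT t:{0<..<1}|lborel. indicator {\<gamma>..<1} t * (unit_mass k / 4)) = (LINT t|lborel. indicator {\<gamma>..<1} t * (unit_mass k / 4))"
      unfolding set_lebesgue_integral_def using \<gamma> by (intro Bochner_Integration.integral_cong) (auto simp: indicator_def)
    also have "\<dots> = (1 - \<gamma>) * (unit_mass k / 4)" using \<gamma> by simp
    finally show ?thesis by (simp add: algebra_simps)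
  qed
  have "(LINT t:{0<..<1}|lborel. k t * indicator ((gauss_preimage \<gamma> ^^ Suc n) UNIV) t) =
      (LINT t:{0<..<1}|lborel. transfer_op \<gamma> k t * indicator ((gauss_preimage \<gamma> ^^ n) UNIV) t)"
    using integral_transfer_op[OF \<gamma> b, where A = "(gauss_preimage \<gamma> ^^ n) UNIV"] gauss_preimage_power_borel by simp
  also have "\<dots> \<le> (1 - (1 - \<gamma>) / 4) ^ n * unit_mass (transfer_op \<gamma> k)"
    by (rule Suc.IH[OF transfer_op_gauss_cone[OF k \<gamma>]])
  also have "\<dots> \<le> (1 - (1 - \<gamma>) / 4) ^ n * ((1 - (1 - \<gamma>) / 4) * unit_mass k)"
    using km \<gamma> by (intro mult_left_mono) auto
  finally show ?case by (simp add: mult_ac)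
qed

text \<open>The constant 1 belongs to the cone, so the Lebesgue measure of the survivors inside the
  unit interval decays geometrically; the rate is below 1 because the hole has positive
  length.\<close>

lemma gauss_survivors_AE:
  assumes \<gamma>: "0 < \<gamma>" "\<gamma> < 1"
  shows "AE t in lborel. \<exists>n. t \<notin> (gauss_preimage \<gamma> ^^ n) UNIV"
proof -
  define S where "S n = (gauss_preimage \<gamma> ^^ n) UNIV" for n
  have [measurable]: "S n \<in> sets borel" for n
    unfolding S_def by (rule gauss_preimage_power_borel) simp
  define T where "T = (\<Inter>n. S n)"
  have [measurable]: "T \<in> sets borel" unfolding T_def by measurable
  \<comment> \<open>Zero steps impose no restriction at all, so the inclusion is read off from the
    survivors of one step.\<close>
  have T1: "T \<subseteq> {0<..<1}" using \<gamma> unfolding T_def S_def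
    by (intro order_trans[OF INT_lower[of 1]]) (auto simp: gauss_preimage_def)
  have fin: "emeasure lborel T < \<infinity>"
    using emeasure_mono[OF T1, of lborel] by (simp add: order_le_less_trans)
  have le: "measure lborel T \<le> (1 - (1 - \<gamma>) / 4) ^ n" for n
  proof -
    have "measure lborel T = (LINT t:{0<..<1}|lborel. indicator T t)"
      using T1 unfolding set_lebesgue_integral_def
      by (simp add: indicator_inter_arith[symmetric] Int_absorb1)
    also have "\<dots> \<le> (LINT t:{0<..<1}|lborel. 1 * indicator (S n) t)"
      by (intro set_integral_mono set_integrable_bounded_unit[where C = 1])
         (auto simp: indicator_def T_def)
    also have "\<dots> \<le> (1 - (1 - \<gamma>) / 4) ^ n * unit_mass (\<lambda>_. 1)"
      unfolding S_def using \<gamma> by (intro gauss_survivor_mass one_gauss_cone) auto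
    finally show ?thesis by (simp add: unit_mass_def set_integral_unit_const)
  qed
  have "(\<lambda>n. (1 - (1 - \<gamma>) / 4) ^ n) \<longlonglongrightarrow> 0"
    using \<gamma> by (intro LIMSEQ_realpow_zero) auto
  from LIMSEQ_le_const[OF this] le have "measure lborel T \<le> 0" by blast
  then have "measure lborel T = 0" by (simp add: measure_le_0_iff)
  then have "T \<in> null_sets lborel"
    using fin by (auto simp: null_sets_def measure_def enn2real_eq_0_iff)
  then have "AE t in lborel. t \<notin> T" by (rule AE_not_in)
  then show ?thesis by (auto simp: T_def S_def)
qed

section \<open>Uniqueness in the subcritical case\<close>

text \<open>Both families of Fourier conditions in measure form: the complex measure with density
  \<open>f\<close> is pushed forward to 0 by frac t and by frac (\<gamma> / t). Vanishing for t
  \<le> 0 is demanded at every point, which can be arranged by the choice of the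
  representative.\<close>

definition frac_annihilated :: "real \<Rightarrow> (real \<Rightarrow> complex) \<Rightarrow> bool" where
  "frac_annihilated \<gamma> f \<longleftrightarrow> integrable lborel f \<and> (\<forall>t\<le>0. f t = 0) \<and>
     (\<forall>A\<in>sets borel. (LINT t|lborel. f t * indicator A (frac t)) = 0 \<and>
                       (LINT t|lborel. f t * indicator A (frac (\<gamma> / t))) = 0)"

lemma integrable_mult_indicator_complex:
  fixes f :: "real \<Rightarrow> complex"
  assumes "integrable lborel f" and [measurable]: "Measurable.pred borel P"
  shows "integrable lborel (\<lambda>t. f t * indicator {t. P t} t)"
proof -
  have "integrable lborel (\<lambda>t. indicator {t. P t} t *\<^sub>R f t)"
    by (rule integrable_mult_indicator[OF _ assms(1)]) simp
  then show ?thesis by (rule Bochner_Integration.integrable_cong[THEN iffD1, rotated 2]) (auto simp: indicator_def)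
qed

text \<open>The first condition for \<open>A\<close> and the second for
  \<open>gauss_preimage \<gamma> A\<close> contain the same contribution of (1, \<infinity>): for t
  > 1 the point \<gamma> / t lies in (0, \<gamma>), and one further step leads to frac t. Comparing
  the two eliminates \<open>f\<close> on (1, \<infinity>).\<close>

lemma integral_gauss_preimage_twice:
  assumes \<gamma>: "0 < \<gamma>" "\<gamma> \<le> 1" and f: "frac_annihilated \<gamma> f"
    and A: "A \<in> sets borel" "A \<subseteq> {0<..<1}"
  shows "(LINT t|lborel. f t * indicator A t) =
         (LINT t|lborel. f t * indicator (gauss_preimage \<gamma> (gauss_preimage \<gamma> A)) t)"
proof -
  note [measurable] = A(1) gauss_preimage_borel
  have fi: "integrable lborel f" and f0: "\<And>t. t \<le> 0 \<Longrightarrow> f t = 0"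
    using f by (auto simp: frac_annihilated_def)
  let ?g = "\<lambda>t. f t * indicator {t. 1 < t \<and> frac t \<in> A} t"
  have int: "integrable lborel ?g" "integrable lborel (\<lambda>t. f t * indicator {t. t \<in> A} t)"
    "integrable lborel (\<lambda>t. f t * indicator {t. t \<in> gauss_preimage \<gamma> (gauss_preimage \<gamma> A)} t)"
    by (intro integrable_mult_indicator_complex[OF fi]; measurable)+
  have "f t * indicator A (frac t) = f t * indicator {t. t \<in> A} t + ?g t" for t
  proof (cases "t \<le> 0 \<or> t \<ge> 1")
    case True
    then show ?thesis using A(2) f0[of t] by (cases "t = 1") (auto simp: indicator_def)
  next
    case False
    then have "frac t = t" by (simp add: frac_eq)
    then show ?thesis using False by (auto simp: indicator_def)
  qed
  moreover have "f t * indicator (gauss_preimage \<gamma> A) (frac (\<gamma> / t)) =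
      ?g t + f t * indicator {t. t \<in> gauss_preimage \<gamma> (gauss_preimage \<gamma> A)} t" for t
  proof -
    consider "t \<le> 0" | "0 < t" "t < \<gamma>" | "t = \<gamma>" | "\<gamma> < t" by linarith
    then show ?thesis
    proof cases
      case 1
      then show ?thesis by (simp add: f0)
    next
      case 2
      then show ?thesis using \<gamma> by (auto simp: indicator_def gauss_preimage_def)
    next
      case 3
      then show ?thesis using \<gamma> by (auto simp: indicator_def gauss_preimage_def)
    next
      \<comment> \<open>For \<gamma> < t \<le> 1 the point \<gamma> / t falls into the hole
        [\<gamma>, 1), so only t > 1 contributes.\<close>
      case 4
      then have "0 < \<gamma> / t" "\<gamma> / t < 1" using \<gamma> by auto
      then have "frac (\<gamma> / t) = \<gamma> / t" by (simp add: frac_eq)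
      moreover have "\<gamma> / t < \<gamma> \<longleftrightarrow> 1 < t" using 4 \<gamma> by (simp add: divide_less_eq)
      ultimately show ?thesis using 4 \<gamma> by (auto simp: indicator_def gauss_preimage_def)
    qed
  qed
  moreover have "(LINT t|lborel. f t * indicator A (frac t)) = 0"
      "(LINT t|lborel. f t * indicator (gauss_preimage \<gamma> A) (frac (\<gamma> / t))) = 0"
    using f A(1) gauss_preimage_borel[OF A(1)] by (auto simp: frac_annihilated_def)
  ultimately have eq: "(LINT t|lborel. f t * indicator {t. t \<in> A} t) + (LINT t|lborel. ?g t) = 0"
      "(LINT t|lborel. ?g t) + (LINT t|lborel. f t * indicator {t. t \<in> gauss_preimage \<gamma> (gauss_preimage \<gamma> A)} t) = 0"
    using int by (simp_all flip: Bochner_Integration.integral_add)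
  have "a = c" if "a + b = 0" "b + c = 0" for a b c :: complex
    using that by (metis add.commute add_left_cancel)
  from this[OF eq] show ?thesis by simp
qed

lemma gauss_preimage_subset_unit: "\<gamma> \<le> 1 \<Longrightarrow> gauss_preimage \<gamma> A \<subseteq> {0<..<1}"
  by (auto simp: gauss_preimage_def)

lemma integral_gauss_preimage_even:
  assumes \<gamma>: "0 < \<gamma>" "\<gamma> \<le> 1" and f: "frac_annihilated \<gamma> f"
    and A: "A \<in> sets borel" "A \<subseteq> {0<..<1}"
  shows "(LINT t|lborel. f t * indicator A t) =
         (LINT t|lborel. f t * indicator ((gauss_preimage \<gamma> ^^ (2 * n)) A) t)"
proof (induction n)
  case (Suc n)
  have "(gauss_preimage \<gamma> ^^ (2 * n)) A \<subseteq> {0<..<1}"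
    using A(2) gauss_preimage_subset_unit[OF \<gamma>(2)] by (cases "2 * n") auto
  then show ?case
    using integral_gauss_preimage_twice[OF \<gamma> f gauss_preimage_power_borel[OF A(1)]] Suc by simp
qed simp

text \<open>Once \<open>f\<close> vanishes on (0, 1), the second condition alone recovers the rest:
  for t > \<gamma> the number \<gamma> / t is its own fractional part, so every measurable subset of
  (\<gamma>, \<infinity>) can be tested by a suitable \<open>A\<close>.\<close>

lemma frac_annihilated_eq_0:
  assumes \<gamma>: "0 < \<gamma>" "\<gamma> \<le> 1" and f: "frac_annihilated \<gamma> f"
    and 0: "\<And>A. A \<in> sets borel \<Longrightarrow> A \<subseteq> {0<..<1} \<Longrightarrow> (LINT t|lborel. f t * indicator A t) = 0"
  shows "AE t in lborel. f t = 0"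
proof -
  have fi: "integrable lborel f" and f0: "\<And>t. t \<le> 0 \<Longrightarrow> f t = 0"
    using f by (auto simp: frac_annihilated_def)
  have [measurable]: "f \<in> borel_measurable borel" using fi by auto
  have "AE t in lborel. f t * indicator {t. 0 < t \<and> t < 1} t = 0"
  proof (rule sigma_finite_measure.density_zero[OF sigma_finite_lborel])
    show "integrable lborel (\<lambda>t. f t * indicator {t. 0 < t \<and> t < 1} t)"
      by (rule integrable_mult_indicator_complex[OF fi]) measurable
    fix S :: "real set" assume S: "S \<in> sets lborel"
    then have "(LINT t|lborel. f t * indicator (S \<inter> {0<..<1}) t) = 0" by (intro 0) auto
    then show "(LINT t:S|lborel. f t * indicator {t. 0 < t \<and> t < 1} t) = 0"
      unfolding set_lebesgue_integral_def
      by (rule trans[rotated]) (auto intro!: Bochner_Integration.integral_cong simp: indicator_def)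
  qed
  moreover have "AE t in lborel. t \<noteq> 1" "AE t in lborel. t \<noteq> \<gamma>" by (rule AE_lborel_singleton)+
  ultimately have z: "AE t in lborel. t \<le> \<gamma> \<longrightarrow> f t = 0"
  proof eventually_elim
    case (elim t)
    then show ?case using f0[of t] \<gamma> by (cases "t \<le> 0") (auto simp: indicator_def split: if_splits)
  qed
  show ?thesis
  proof (rule sigma_finite_measure.density_zero[OF sigma_finite_lborel fi])
    fix S :: "real set" assume "S \<in> sets lborel"
    then have [measurable]: "S \<in> sets borel" by simp
    define A where "A = {s. 0 < s \<and> s < 1 \<and> \<gamma> / s \<in> S}"
    have [measurable]: "A \<in> sets borel" unfolding A_def by measurable
    have "(LINT t:S|lborel. f t) = (LINT t|lborel. f t * indicator A (frac (\<gamma> / t)))"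
      unfolding set_lebesgue_integral_def
    proof (rule integral_cong_AE)
      show "AE t in lborel. indicat_real S t *\<^sub>R f t = f t * indicator A (frac (\<gamma> / t))"
        using z
      proof eventually_elim
        case (elim t)
        show ?case
        proof (cases "\<gamma> < t")
          case True
          then have "0 < \<gamma> / t" "\<gamma> / t < 1" using \<gamma> by auto
          then have "frac (\<gamma> / t) = \<gamma> / t" by (simp add: frac_eq)
          with True \<open>0 < \<gamma> / t\<close> \<open>\<gamma> / t < 1\<close> show ?thesis using \<gamma> by (auto simp: indicator_def A_def)
        qed (use elim in auto)
      qed
    qed auto
    also have "\<dots> = 0" using f by (auto simp: frac_annihilated_def)
    finally show "(LINT t:S|lborel. f t) = 0" .
  qed
qed

text \<open>The integral over \<open>A\<close> equals the integral over the 2n-th preimage, all of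
  whose points survive 2n steps. Almost every point escapes, so dominated convergence gives
  0.\<close>

lemma frac_annihilated_subcritical:
  assumes \<gamma>: "0 < \<gamma>" "\<gamma> < 1" and f: "frac_annihilated \<gamma> f"
  shows "AE t in lborel. f t = 0"
proof (rule frac_annihilated_eq_0[OF \<gamma>(1) less_imp_le[OF \<gamma>(2)] f])
  fix A :: "real set" assume A: "A \<in> sets borel" "A \<subseteq> {0<..<1}"
  have fi: "integrable lborel f" using f by (auto simp: frac_annihilated_def)
  have [measurable]: "f \<in> borel_measurable borel" using fi by auto
  have [measurable]: "(gauss_preimage \<gamma> ^^ n) A \<in> sets borel" for n
    by (rule gauss_preimage_power_borel[OF A(1)])
  have "(\<lambda>n. LINT t|lborel. f t * indicator ((gauss_preimage \<gamma> ^^ (2 * n)) A) t) \<longlonglongrightarrow> (LINT t::real|lborel. 0)"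
  proof (rule integral_dominated_convergence[where w = "\<lambda>t. norm (f t)"])
    show "AE t in lborel. (\<lambda>n. f t * indicator ((gauss_preimage \<gamma> ^^ (2 * n)) A) t) \<longlonglongrightarrow> 0"
      using gauss_survivors_AE[OF \<gamma>]
    proof eventually_elim
      case (elim t)
      then obtain N where N: "t \<notin> (gauss_preimage \<gamma> ^^ N) UNIV" by blast
      have "t \<notin> (gauss_preimage \<gamma> ^^ (2 * n)) A" if "n \<ge> N" for n
        using N decseqD[OF gauss_survivors_decseq, of N "2 * n"] gauss_preimage_power_mono[of A UNIV "2 * n" \<gamma>] that
        by auto
      then have "eventually (\<lambda>n. f t * indicator ((gauss_preimage \<gamma> ^^ (2 * n)) A) t = 0) sequentially"
        unfolding eventually_sequentially by (intro exI[of _ N]) simp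
      then show ?case by (rule tendsto_eventually)
    qed
  qed (use fi in \<open>auto simp: norm_mult indicator_def\<close>)
  then show "(LINT t|lborel. f t * indicator A t) = 0"
    using integral_gauss_preimage_even[OF \<gamma>(1) less_imp_le[OF \<gamma>(2)] f A]
    by (simp add: LIMSEQ_const_iff)
qed

section \<open>Mixing of the Gauss map and the critical case\<close>

definition gauss_density :: "real \<Rightarrow> real" where
  "gauss_density s = 1 / (1 + s)"

text \<open>The product (1 + s)(1 + t) lies between 1 and 4. The upper estimate serves to subtract a
  small multiple of the density without leaving the cone, the lower one to absorb a Lipschitz
  function by a large multiple.\<close>

lemma gauss_density_diff:
  assumes "0 < s" "s \<le> t" "t < 1"
  shows "(t - s) / 4 \<le> gauss_density s - gauss_density t" "gauss_density s - gauss_density t \<le> t - s"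
proof -
  have eq: "gauss_density s - gauss_density t = (t - s) / ((1 + s) * (1 + t))"
    using assms by (simp add: gauss_density_def field_simps)
  have "(1 + s) * (1 + t) \<le> 2 * 2" using assms by (intro mult_mono) auto
  moreover have "1 * 1 \<le> (1 + s) * (1 + t)" using assms by (intro mult_mono) auto
  ultimately show "(t - s) / 4 \<le> gauss_density s - gauss_density t" "gauss_density s - gauss_density t \<le> t - s"
    unfolding eq using assms frac_le[of "t - s" "t - s" "(1 + s) * (1 + t)" 4]
      frac_le[of "t - s" "t - s" 1 "(1 + s) * (1 + t)"] by auto
qed

lemma gauss_density_cone: "gauss_density \<in> gauss_cone"
proof -
  have "gauss_density t \<le> gauss_density s \<and> (1 + s)\<^sup>2 * gauss_density s \<le> (1 + t)\<^sup>2 * gauss_density t"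
    if "0 < s" "s \<le> t" "t < 1" for s t
    using that by (auto simp: gauss_density_def power2_eq_square divide_left_mono)
  then show ?thesis by (auto simp: gauss_cone_def gauss_density_def[abs_def])
qed

text \<open>With x = s + j the term of the j-th branch equals 1 / x - 1 / (x + 1), so the series
  telescopes.\<close>

lemma transfer_op_gauss_density:
  assumes "s \<in> {0<..<1}"
  shows "transfer_op 1 gauss_density s = gauss_density s"
proof -
  have "(\<lambda>j. 1 / (s + real (j + 1))) \<longlonglongrightarrow> 0"
    by real_asymp
  then have "(\<lambda>j. 1 / (s + real (Suc j))) \<longlonglongrightarrow> 0" by simp
  from telescope_sums'[OF this]
  have "(\<lambda>j. 1 / (s + real (Suc j)) - 1 / (s + real (Suc (Suc j)))) sums (1 / (s + 1))" by simp
  moreover have "1 / (s + real (Suc j)) - 1 / (s + real (Suc (Suc j))) =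
      1 / (s + real (Suc j))\<^sup>2 * gauss_density (1 / (s + real (Suc j)))" for j
  proof -
    define x where "x = s + real (Suc j)"
    have x: "x > 0" using assms by (simp add: x_def)
    have "1 / x - 1 / (x + 1) = 1 / x\<^sup>2 * gauss_density (1 / x)"
      using x by (simp add: gauss_density_def field_simps power2_eq_square)
    then show ?thesis by (simp add: x_def add_ac)
  qed
  ultimately show ?thesis
    by (simp add: transfer_op_def gauss_density_def sums_iff add.commute)
qed

lemma unit_mass_gauss_density: "unit_mass gauss_density = ln 2"
proof -
  have "(LBINT s. gauss_density s * indicator {0..1} s) = ln (1 + 1) - ln (1 + 0)"
  proof (rule integral_FTC_Icc_real)
    fix s :: real assume "0 \<le> s" "s \<le> 1"
    then show "DERIV (\<lambda>s. ln (1 + s)) s :> gauss_density s" "isCont gauss_density s"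
      by (auto intro!: derivative_eq_intros continuous_intros simp: gauss_density_def[abs_def])
  qed simp
  moreover have "unit_mass gauss_density = (LBINT s. gauss_density s * indicator {0..1} s)"
    unfolding unit_mass_def set_lebesgue_integral_def
  proof (rule integral_cong_AE)
    have "AE s in lborel. s \<noteq> (0::real)" "AE s in lborel. s \<noteq> (1::real)" by (rule AE_lborel_singleton)+
    then show "AE s in lborel. indicat_real {0<..<1} s *\<^sub>R gauss_density s = gauss_density s * indicat_real {0..1} s"
      by eventually_elim (auto simp: indicator_def)
  qed (use gauss_coneD(1)[OF gauss_density_cone] in auto)
  ultimately show ?thesis by simp
qed

text \<open>Writing m for the mass, k \<ge> m / 4 on the unit interval, and single branches already
  have slack. The first branch gives decrease at least (m / 4) * 4 (t - s) / 81, where 81 bounds (2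
  + s)^2 (2 + t)^2; this is the tight requirement. The increase of the weighted function has the
  larger margin m (t - s) / 36, and positivity has m / 16.\<close>

lemma gauss_cone_minorization:
  assumes k: "k \<in> gauss_cone"
  shows "(\<lambda>s. transfer_op 1 k s - unit_mass k / 81 * gauss_density s) \<in> gauss_cone"
proof -
  define m where "m = unit_mass k"
  have m0: "0 \<le> m" using unit_mass_nonneg[OF k] by (simp add: m_def)
  have mk: "m / 4 \<le> k t" if "t \<in> {0<..<1}" for t using unit_mass_le[OF k that] by (simp add: m_def)
  have one: "(0::real) < 1" "(1::real) \<le> 1" by auto
  let ?T = "\<lambda>s j. 1 / (s + real (Suc j))\<^sup>2 * k (1 / (s + real (Suc j)))"
  have sm: "summable (?T s)" if "s \<in> {0<..<1}" for s
    by (rule summable_transfer_op[OF one _ that]) (rule gauss_cone_bounds[OF k])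
  have T0: "0 \<le> ?T s j" if "s \<in> {0<..<1}" for s j
    by (rule branch_bounds(1)[OF one _ that]) (rule gauss_cone_bounds[OF k])
  have Csum: "transfer_op 1 k s = (\<Sum>j. ?T s j)" for s by (simp add: transfer_op_def)
  have in1: "1 / (s + real (Suc j)) \<in> {0<..<1}" if "s \<in> {0<..<1}" for s j
    using that by (auto simp: field_simps)
  have pos: "0 \<le> transfer_op 1 k s - m / 81 * gauss_density s" if s: "s \<in> {0<..<1}" for s
  proof -
    have "1 / 4 * (m / 4) \<le> ?T s 0"
    proof (rule mult_mono)
      have "(s + real (Suc 0))\<^sup>2 \<le> 2\<^sup>2" using s by (intro power_mono) auto
      then show "1 / 4 \<le> 1 / (s + real (Suc 0))\<^sup>2" using s by (intro frac_le) auto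
    qed (use mk[OF in1[OF s, of 0]] m0 in auto)
    also have "?T s 0 \<le> transfer_op 1 k s"
      using sum_le_suminf[OF sm[OF s], of "{0}"] T0[OF s] by (simp add: Csum)
    finally have "m / 16 \<le> transfer_op 1 k s" by simp
    moreover have "m / 81 * gauss_density s \<le> m / 81 * 1"
      using s m0 by (intro mult_left_mono) (auto simp: gauss_density_def)
    ultimately show ?thesis using m0 by linarith
  qed
  have dec: "transfer_op 1 k t - m / 81 * gauss_density t \<le> transfer_op 1 k s - m / 81 * gauss_density s"
    if st: "0 < s" "s \<le> t" "t < 1" for s t
  proof -
    have s: "s \<in> {0<..<1}" and t: "t \<in> {0<..<1}" using st by auto
    define x where "x = 1 / (s + 1)"
    define y where "y = 1 / (t + 1)"
    have xy: "0 < y" "y \<le> x" "x < 1" using st by (auto simp: x_def y_def field_simps)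
    \<comment> \<open>The slack comes from x / (1 + x) = 1 / (2 + s): the factor (1 + x)^2 k(x) is
      only known to be nondecreasing, but it is bounded below by m / 4.\<close>
    have A: "m / 4 * ((t - s) * 4 / 81) \<le> x\<^sup>2 * k x - y\<^sup>2 * k y"
    proof -
      define W where "W = (1 + y)\<^sup>2 * k y"
      have "m / 4 * 1 \<le> k y * (1 + y)\<^sup>2"
        using xy mk[of y] m0 by (intro mult_mono) (auto simp: power2_eq_square algebra_simps)
      then have W: "m / 4 \<le> W" by (simp add: W_def mult.commute)
      have "W \<le> (1 + x)\<^sup>2 * k x" unfolding W_def using gauss_coneD(4)[OF k] xy by blast
      then have "(x / (1 + x))\<^sup>2 * W \<le> (x / (1 + x))\<^sup>2 * ((1 + x)\<^sup>2 * k x)" by (rule mult_left_mono) simp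
      also have "\<dots> = x\<^sup>2 * k x" using xy by (simp add: power_divide)
      finally have 1: "(x / (1 + x))\<^sup>2 * W \<le> x\<^sup>2 * k x" .
      have 2: "y\<^sup>2 * k y = (y / (1 + y))\<^sup>2 * W" using xy by (simp add: W_def power_divide)
      have e: "x / (1 + x) = 1 / (2 + s)" "y / (1 + y) = 1 / (2 + t)"
        using st by (auto simp: x_def y_def field_simps)
      have "(1 / (2 + s))\<^sup>2 - (1 / (2 + t))\<^sup>2 = ((t - s) * (4 + s + t)) / ((2 + s)\<^sup>2 * (2 + t)\<^sup>2)"
      proof -
        have "(1 / (2 + s))\<^sup>2 - (1 / (2 + t))\<^sup>2 = ((2 + t)\<^sup>2 - (2 + s)\<^sup>2) / ((2 + s)\<^sup>2 * (2 + t)\<^sup>2)"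
          using st by (simp add: power_divide diff_frac_eq)
        also have "(2 + t)\<^sup>2 - (2 + s)\<^sup>2 = (t - s) * (4 + s + t)" by algebra
        finally show ?thesis .
      qed
      also have "\<dots> \<ge> ((t - s) * 4) / (3\<^sup>2 * 3\<^sup>2)"
        using st by (intro frac_le mult_mono power_mono mult_left_mono) auto
      finally have d: "(t - s) * 4 / 81 \<le> (x / (1 + x))\<^sup>2 - (y / (1 + y))\<^sup>2" unfolding e by simp
      have "m / 4 * ((t - s) * 4 / 81) \<le> W * ((x / (1 + x))\<^sup>2 - (y / (1 + y))\<^sup>2)"
        by (rule mult_mono[OF W d]) (use W m0 st in auto)
      also have "\<dots> \<le> x\<^sup>2 * k x - y\<^sup>2 * k y" using 1 2 by (simp add: algebra_simps)
      finally show ?thesis .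
    qed
    have "?T s 0 - ?T t 0 \<le> (\<Sum>j. ?T s j - ?T t j)"
      using sum_le_suminf[OF summable_diff[OF sm[OF s] sm[OF t]], of "{0}"]
        transfer_term_mono(1)[OF k one st] by simp
    also have "\<dots> = transfer_op 1 k s - transfer_op 1 k t"
      unfolding Csum by (rule suminf_diff[symmetric, OF sm[OF s] sm[OF t]])
    finally have "x\<^sup>2 * k x - y\<^sup>2 * k y \<le> transfer_op 1 k s - transfer_op 1 k t"
      by (simp add: x_def y_def power_divide)
    moreover have "m / 81 * (gauss_density s - gauss_density t) \<le> m / 81 * (t - s)"
      using gauss_density_diff(2)[OF st] m0 by (intro mult_left_mono) auto
    moreover have "m / 4 * ((t - s) * 4 / 81) = m / 81 * (t - s)" by simp
    ultimately show ?thesis using A unfolding right_diff_distrib by linarith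
  qed
  have inc: "(1 + s)\<^sup>2 * (transfer_op 1 k s - m / 81 * gauss_density s) \<le> (1 + t)\<^sup>2 * (transfer_op 1 k t - m / 81 * gauss_density t)"
    if st: "0 < s" "s \<le> t" "t < 1" for s t
  proof -
    have s: "s \<in> {0<..<1}" and t: "t \<in> {0<..<1}" using st by auto
    \<comment> \<open>For the first branch the weight (1 + s) / (s + 1) is constant and guarantees
      no gain, so the second branch is used.\<close>
    have kxy: "k (1 / (s + 2)) \<le> k (1 / (t + 2))" "m / 4 \<le> k (1 / (s + 2))"
      using gauss_coneD(3)[OF k, of "1 / (t + 2)" "1 / (s + 2)"] mk[of "1 / (s + 2)"] st
      by (auto simp: frac_le)
    have "(1 + t) / (2 + t) - (1 + s) / (2 + s) = (t - s) / ((2 + s) * (2 + t))"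
      using st by (simp add: field_simps)
    also have "\<dots> \<ge> (t - s) / (3 * 3)"
      using st by (intro frac_le mult_mono) auto
    finally have u: "(t - s) / 9 \<le> (1 + t) / (2 + t) - (1 + s) / (2 + s)" by simp
    have v: "1 \<le> (1 + t) / (2 + t) + (1 + s) / (2 + s)"
    proof -
      have "1 / 2 \<le> (1 + r) / (2 + r)" if "0 < r" for r :: real using that by (simp add: field_simps)
      from this[of s] this[of t] show ?thesis using st by linarith
    qed
    have "(t - s) / 9 * 1 \<le> ((1 + t) / (2 + t) - (1 + s) / (2 + s)) * ((1 + t) / (2 + t) + (1 + s) / (2 + s))"
    proof (rule mult_mono[OF u v])
      show "0 \<le> (1 + t) / (2 + t) - (1 + s) / (2 + s)" by (rule order_trans[OF _ u]) (use st in simp)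
    qed simp
    then have w: "(t - s) / 9 \<le> ((1 + t) / (2 + t))\<^sup>2 - ((1 + s) / (2 + s))\<^sup>2"
      by (simp add: power2_eq_square algebra_simps)
    have "m / 4 * ((t - s) / 9) \<le> k (1 / (s + 2)) * (((1 + t) / (2 + t))\<^sup>2 - ((1 + s) / (2 + s))\<^sup>2)"
      by (rule mult_mono[OF kxy(2) w]) (use kxy(2) m0 st in auto)
    also have "\<dots> \<le> ((1 + t) / (2 + t))\<^sup>2 * k (1 / (t + 2)) - ((1 + s) / (2 + s))\<^sup>2 * k (1 / (s + 2))"
      using mult_left_mono[OF kxy(1), of "((1 + t) / (2 + t))\<^sup>2"] by (simp add: algebra_simps)
    also have "\<dots> = (1 + t)\<^sup>2 * ?T t 1 - (1 + s)\<^sup>2 * ?T s 1"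
      by (simp add: power_divide add.commute)
    also have "\<dots> \<le> (\<Sum>j. (1 + t)\<^sup>2 * ?T t j - (1 + s)\<^sup>2 * ?T s j)"
      using sum_le_suminf[OF summable_diff[OF summable_mult[OF sm[OF t]] summable_mult[OF sm[OF s]]], of "{1}" "(1 + t)\<^sup>2" "(1 + s)\<^sup>2"]
        transfer_term_mono(2)[OF k one st] by simp
    also have "\<dots> = (1 + t)\<^sup>2 * transfer_op 1 k t - (1 + s)\<^sup>2 * transfer_op 1 k s"
      unfolding Csum suminf_mult[OF sm[OF t], symmetric] suminf_mult[OF sm[OF s], symmetric]
      by (rule suminf_diff[symmetric, OF summable_mult[OF sm[OF t]] summable_mult[OF sm[OF s]]])
    finally have "m / 4 * ((t - s) / 9) \<le> (1 + t)\<^sup>2 * transfer_op 1 k t - (1 + s)\<^sup>2 * transfer_op 1 k s" .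
    moreover have g: "(1 + r)\<^sup>2 * gauss_density r = 1 + r" if "0 < r" for r
      using that by (simp add: gauss_density_def power2_eq_square)
    have "m / 81 * t - m / 81 * s \<le> m / 4 * ((t - s) / 9)"
    proof -
      have "m * (t - s) / 81 \<le> m * (t - s) / 36"
        using m0 st by (intro divide_left_mono) auto
      moreover have "m / 81 * t - m / 81 * s = m * (t - s) / 81" by (simp add: right_diff_distrib diff_divide_distrib)
      ultimately show ?thesis by simp
    qed
    moreover have "(1 + r)\<^sup>2 * (T - m / 81 * gauss_density r) = (1 + r)\<^sup>2 * T - m / 81 * (1 + r)" if "0 < r" for r T
    proof -
      have "(1 + r)\<^sup>2 * (T - m / 81 * gauss_density r) = (1 + r)\<^sup>2 * T - m / 81 * ((1 + r)\<^sup>2 * gauss_density r)"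
        by (simp only: right_diff_distrib mult.left_commute)
      then show ?thesis by (simp only: g[OF that])
    qed
    from this[of t] this[of s] have
      "(1 + t)\<^sup>2 * (transfer_op 1 k t - m / 81 * gauss_density t) = (1 + t)\<^sup>2 * transfer_op 1 k t - (m / 81 + m / 81 * t)"
      "(1 + s)\<^sup>2 * (transfer_op 1 k s - m / 81 * gauss_density s) = (1 + s)\<^sup>2 * transfer_op 1 k s - (m / 81 + m / 81 * s)"
      using st by (simp_all only: distrib_left mult_1_right order_less_le_trans)
    ultimately show ?thesis by linarith
  qed
  have "(\<lambda>s. transfer_op 1 k s - m / 81 * gauss_density s) \<in> borel_measurable borel"
    using gauss_coneD(1)[OF k] gauss_coneD(1)[OF gauss_density_cone] by measurable
  then show ?thesis
    unfolding m_def[symmetric] gauss_cone_def using pos dec inc by blast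
qed

section \<open>Exponential mixing of the Gauss map for densities in the cone\<close>

definition gauss_measure :: "real set \<Rightarrow> real" where
  "gauss_measure A = (LINT t:{0<..<1}|lborel. gauss_density t * indicator A t) / ln 2"

lemma set_integrable_cone_indicator:
  assumes k: "k \<in> gauss_cone" and [measurable]: "A \<in> sets borel"
  shows "set_integrable lborel {0<..<1} (\<lambda>t. k t * indicator A t)"
proof (rule set_integrable_bounded_unit[where C = "4 * k (1 / 2)"])
  have [measurable]: "k \<in> borel_measurable borel" by (rule gauss_coneD(1)[OF k])
  show "(\<lambda>t. k t * indicat_real A t) \<in> borel_measurable borel" by measurable
  show "\<bar>k s * indicat_real A s\<bar> \<le> 4 * k (1 / 2)" if "s \<in> {0<..<1}" for s
    using gauss_cone_bounds[OF k that] by (auto simp: indicator_def)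
qed

lemma gauss_measure_bounds: "A \<in> sets borel \<Longrightarrow> 0 \<le> gauss_measure A \<and> gauss_measure A \<le> 1"
proof
  assume A: "A \<in> sets borel"
  show "0 \<le> gauss_measure A"
    unfolding gauss_measure_def set_lebesgue_integral_def
    by (intro divide_nonneg_nonneg integral_nonneg_AE AE_I2) (auto simp: indicator_def gauss_density_def)
  have "(LINT t:{0<..<1}|lborel. gauss_density t * indicator A t) \<le> unit_mass gauss_density"
    unfolding unit_mass_def
    by (intro set_integral_mono set_integrable_cone_indicator set_integrable_gauss_cone gauss_density_cone A)
       (auto simp: indicator_def gauss_density_def)
  then show "gauss_measure A \<le> 1" by (simp add: gauss_measure_def unit_mass_gauss_density)
qed

lemma integral_gauss_preimage_power:
  assumes k: "k \<in> gauss_cone" and A: "A \<in> sets borel"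
  shows "(LINT t:{0<..<1}|lborel. k t * indicator ((gauss_preimage 1 ^^ Suc n) A) t) =
         (LINT t:{0<..<1}|lborel. transfer_op 1 k t * indicator ((gauss_preimage 1 ^^ n) A) t)"
proof -
  have "(LINT t:{0<..<1}|lborel. k t * indicator (gauss_preimage 1 ((gauss_preimage 1 ^^ n) A)) t) =
         (LINT t:{0<..<1}|lborel. transfer_op 1 k t * indicator ((gauss_preimage 1 ^^ n) A) t)"
    by (rule integral_transfer_op[where B = "4 * k (1 / 2)"])
       (use gauss_cone_bounds[OF k] gauss_coneD(1)[OF k] gauss_preimage_power_borel[OF A] in auto)
  then show ?thesis by simp
qed

lemma gauss_measure_invariant:
  assumes A: "A \<in> sets borel"
  shows "gauss_measure ((gauss_preimage 1 ^^ n) A) = gauss_measure A"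
proof (induction n)
  case (Suc n)
  have "gauss_measure ((gauss_preimage 1 ^^ Suc n) A) =
      (LINT t:{0<..<1}|lborel. transfer_op 1 gauss_density t * indicator ((gauss_preimage 1 ^^ n) A) t) / ln 2"
    unfolding gauss_measure_def integral_gauss_preimage_power[OF gauss_density_cone A] ..
  also have "\<dots> = gauss_measure ((gauss_preimage 1 ^^ n) A)"
    unfolding gauss_measure_def
    by (intro arg_cong2[where f = "(/)"] set_lebesgue_integral_cong) (auto simp: transfer_op_gauss_density)
  finally show ?case using Suc by simp
qed simp

lemma gauss_mixing_rate_bounds: "0 \<le> 1 - ln 2 / (81::real)" "1 - ln 2 / 81 < (1::real)"
proof -
  have "ln 2 < (1::real)" "0 < ln (2::real)" by (rule ln_2_less_1) simp
  then show "0 \<le> 1 - ln 2 / (81::real)" "1 - ln 2 / 81 < (1::real)" by simp_all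
qed

text \<open>One step splits off the fraction ln 2 / 81 of the mass as a multiple of the invariant
  density. That part contributes exactly its limit value from then on, and the remainder is again in
  the cone. Hence the error is bounded by the mass of what has not yet been split off.\<close>

lemma gauss_cone_mixing:
  assumes k: "k \<in> gauss_cone" and A: "A \<in> sets borel"
  shows "\<bar>(LINT t:{0<..<1}|lborel. k t * indicator ((gauss_preimage 1 ^^ n) A) t) - unit_mass k * gauss_measure A\<bar>
         \<le> (1 - ln 2 / 81) ^ n * unit_mass k"
  using k
proof (induction n arbitrary: k)
  case 0
  note k = \<open>k \<in> gauss_cone\<close>
  have "(LINT t:{0<..<1}|lborel. k t * indicator A t) \<le> unit_mass k"
    unfolding unit_mass_def
    by (intro set_integral_mono set_integrable_cone_indicator set_integrable_gauss_cone k A)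
       (auto simp: indicator_def gauss_coneD(2)[OF k])
  moreover have "0 \<le> (LINT t:{0<..<1}|lborel. k t * indicator A t)"
    unfolding set_lebesgue_integral_def
    by (intro integral_nonneg_AE AE_I2) (auto simp: indicator_def gauss_coneD(2)[OF k])
  moreover have "0 \<le> unit_mass k * gauss_measure A" "unit_mass k * gauss_measure A \<le> unit_mass k * 1"
    using gauss_measure_bounds[OF A] unit_mass_nonneg[OF k] by (auto intro: mult_left_le)
  ultimately show ?case by simp
next
  case (Suc n)
  note k = Suc.prems
  define m where "m = unit_mass k"
  define k' where "k' s = transfer_op 1 k s - m / 81 * gauss_density s" for s
  have k': "k' \<in> gauss_cone" using gauss_cone_minorization[OF k] by (simp add: k'_def[abs_def] m_def)
  have T: "transfer_op 1 k s = k' s + m / 81 * gauss_density s" for s by (simp add: k'_def)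
  have Tm: "(LINT t:{0<..<1}|lborel. transfer_op 1 k t * indicator B t) =
      (LINT t:{0<..<1}|lborel. k' t * indicator B t) + m * ln 2 / 81 * gauss_measure B" if B: "B \<in> sets borel" for B
  proof -
    have "(LINT t:{0<..<1}|lborel. transfer_op 1 k t * indicator B t) =
        (LINT t:{0<..<1}|lborel. k' t * indicator B t + m / 81 * (gauss_density t * indicator B t))"
      by (simp add: T algebra_simps)
    also have "\<dots> = (LINT t:{0<..<1}|lborel. k' t * indicator B t) + m / 81 * (LINT t:{0<..<1}|lborel. gauss_density t * indicator B t)"
      using set_integrable_cone_indicator[OF k' B] set_integrable_cone_indicator[OF gauss_density_cone B]
      by (subst set_integral_add) auto
    finally show ?thesis by (simp add: gauss_measure_def)
  qed
  \<comment> \<open>For \<gamma> = 1 there is no hole: one step is defined on all of (0, 1), so the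
    operator preserves mass.\<close>
  have "unit_mass k = (LINT t:{0<..<1}|lborel. k t * indicator ((gauss_preimage 1 ^^ Suc 0) UNIV) t)"
    unfolding unit_mass_def by (intro set_lebesgue_integral_cong) (auto simp: gauss_preimage_def)
  also have "\<dots> = (LINT t:{0<..<1}|lborel. transfer_op 1 k t * indicator UNIV t)"
    by (subst integral_gauss_preimage_power[OF k]) simp_all
  also have "\<dots> = unit_mass k' + m * ln 2 / 81"
  proof -
    have "gauss_measure UNIV = 1"
      using unit_mass_gauss_density by (simp add: gauss_measure_def unit_mass_def)
    then show ?thesis using Tm[of UNIV] by (simp add: unit_mass_def)
  qed
  finally have m': "unit_mass k' = (1 - ln 2 / 81) * m" by (simp add: m_def algebra_simps)
  have "(LINT t:{0<..<1}|lborel. k t * indicator ((gauss_preimage 1 ^^ Suc n) A) t) - m * gauss_measure A =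
     (LINT t:{0<..<1}|lborel. k' t * indicator ((gauss_preimage 1 ^^ n) A) t) - unit_mass k' * gauss_measure A"
    unfolding integral_gauss_preimage_power[OF k A] Tm[OF gauss_preimage_power_borel[OF A]] gauss_measure_invariant[OF A] m'
    by (simp add: algebra_simps)
  then show ?case using Suc.IH[OF k'] by (simp add: m' m_def mult_ac)
qed

section \<open>Extending mixing, without a rate, from the cone to all integrable densities\<close>

definition gauss_equidistributed :: "(real \<Rightarrow> complex) \<Rightarrow> bool" where
  "gauss_equidistributed F \<longleftrightarrow> (\<forall>A\<in>sets borel.
     (\<lambda>n. LINT t:{0<..<1}|lborel. F t * indicator ((gauss_preimage 1 ^^ n) A) t)
       \<longlonglongrightarrow> (LINT t:{0<..<1}|lborel. F t) * of_real (gauss_measure A))"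

lemma set_integrable_mult_indicator_complex:
  fixes F :: "real \<Rightarrow> complex"
  assumes "set_integrable lborel S F" and [measurable]: "A \<in> sets borel"
  shows "set_integrable lborel S (\<lambda>t. F t * indicator A t)"
proof -
  have "integrable lborel (\<lambda>t. indicator A t *\<^sub>R (indicator S t *\<^sub>R F t))"
    by (rule integrable_mult_indicator) (simp_all add: assms(1)[unfolded set_integrable_def])
  then show ?thesis unfolding set_integrable_def
    by (rule Bochner_Integration.integrable_cong[THEN iffD1, rotated 2]) (auto simp: indicator_def)
qed

lemma gauss_equidistributed_add:
  assumes "gauss_equidistributed F" "gauss_equidistributed G"
    "set_integrable lborel {0<..<1} F" "set_integrable lborel {0<..<1} G"
  shows "gauss_equidistributed (\<lambda>t. F t + G t)"
  unfolding gauss_equidistributed_def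
proof
  fix A :: "real set" assume A: "A \<in> sets borel"
  note B = gauss_preimage_power_borel[OF A]
  have "(\<lambda>n. (LINT t:{0<..<1}|lborel. F t * indicator ((gauss_preimage 1 ^^ n) A) t)
       + (LINT t:{0<..<1}|lborel. G t * indicator ((gauss_preimage 1 ^^ n) A) t))
       \<longlonglongrightarrow> (LINT t:{0<..<1}|lborel. F t) * of_real (gauss_measure A) + (LINT t:{0<..<1}|lborel. G t) * of_real (gauss_measure A)"
    using assms(1,2) A unfolding gauss_equidistributed_def by (intro tendsto_add) auto
  then show "(\<lambda>n. LINT t:{0<..<1}|lborel. (F t + G t) * indicator ((gauss_preimage 1 ^^ n) A) t)
       \<longlonglongrightarrow> (LINT t:{0<..<1}|lborel. F t + G t) * of_real (gauss_measure A)"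
    using assms(3,4) set_integrable_mult_indicator_complex[OF assms(3) B] set_integrable_mult_indicator_complex[OF assms(4) B]
    by (simp add: distrib_right set_integral_add)
qed

lemma gauss_equidistributed_scale:
  assumes "gauss_equidistributed F"
  shows "gauss_equidistributed (\<lambda>t. c * F t)"
  unfolding gauss_equidistributed_def
proof
  fix A :: "real set" assume A: "A \<in> sets borel"
  have "(\<lambda>n. c * (LINT t:{0<..<1}|lborel. F t * indicator ((gauss_preimage 1 ^^ n) A) t))
       \<longlonglongrightarrow> c * ((LINT t:{0<..<1}|lborel. F t) * of_real (gauss_measure A))"
    using assms A unfolding gauss_equidistributed_def by (intro tendsto_mult_left) auto
  then show "(\<lambda>n. LINT t:{0<..<1}|lborel. c * F t * indicator ((gauss_preimage 1 ^^ n) A) t)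
       \<longlonglongrightarrow> (LINT t:{0<..<1}|lborel. c * F t) * of_real (gauss_measure A)"
    by (simp add: mult.assoc)
qed

lemma norm_set_integral_mult_indicator_diff:
  fixes F G :: "real \<Rightarrow> complex"
  assumes F: "set_integrable lborel S F" and G: "set_integrable lborel S G" and A: "A \<in> sets borel"
  shows "norm ((LINT t:S|lborel. F t * indicator A t) - (LINT t:S|lborel. G t * indicator A t))
         \<le> (LINT t:S|lborel. norm (F t - G t))"
proof -
  note D = set_integral_diff(1)[OF F G]
  have "(LINT t:S|lborel. F t * indicator A t) - (LINT t:S|lborel. G t * indicator A t) =
      (LINT t:S|lborel. (F t - G t) * indicator A t)"
    using set_integrable_mult_indicator_complex[OF F A] set_integrable_mult_indicator_complex[OF G A]
    by (simp add: left_diff_distrib set_integral_diff)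
  also have "norm \<dots> \<le> (LINT t:S|lborel. norm ((F t - G t) * indicator A t))"
    by (rule set_integral_norm_bound[OF set_integrable_mult_indicator_complex[OF D A]])
  also have "\<dots> \<le> (LINT t:S|lborel. norm (F t - G t))"
    by (intro set_integral_mono set_integrable_norm set_integrable_mult_indicator_complex[OF D A] D)
       (auto simp: indicator_def norm_mult)
  finally show ?thesis .
qed

text \<open>Both sides of the limit relation change by at most the L1 distance of the densities,
  uniformly in n, so an argument with three thirds of \<open>r\<close> applies.\<close>

lemma gauss_equidistributed_limit:
  assumes Fi: "\<And>i. gauss_equidistributed (Fs i)" "\<And>i. set_integrable lborel {0<..<1} (Fs i)"
    and F: "set_integrable lborel {0<..<1} F"
    and lim: "(\<lambda>i. LINT t:{0<..<1}|lborel. norm (F t - Fs i t)) \<longlonglongrightarrow> 0"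
  shows "gauss_equidistributed F"
  unfolding gauss_equidistributed_def
proof
  fix A :: "real set" assume A: "A \<in> sets borel"
  note B = gauss_preimage_power_borel[OF A]
  let ?I = "\<lambda>G n. LINT t:{0<..<1}|lborel. G t * indicator ((gauss_preimage 1 ^^ n) A) t"
  let ?J = "\<lambda>G. LINT t:{0<..<1}|lborel. (G t :: complex)"
  let ?\<mu> = "complex_of_real (gauss_measure A)"
  show "?I F \<longlonglongrightarrow> ?J F * ?\<mu>"
  proof (rule LIMSEQ_I)
    fix r :: real assume r: "r > 0"
    have "eventually (\<lambda>i. (LINT t:{0<..<1}|lborel. norm (F t - Fs i t)) < r / 3) sequentially"
      using r by (intro order_tendstoD(2)[OF lim]) simp
    then obtain i where i: "(LINT t:{0<..<1}|lborel. norm (F t - Fs i t)) < r / 3"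
      using eventually_happens'[OF sequentially_bot] by auto
    obtain N where N: "\<And>n. n \<ge> N \<Longrightarrow> norm (?I (Fs i) n - ?J (Fs i) * ?\<mu>) < r / 3"
      using LIMSEQ_D[of "?I (Fs i)" "?J (Fs i) * ?\<mu>" "r / 3"] Fi(1)[of i] A r
      unfolding gauss_equidistributed_def by auto
    have "norm (?J F - ?J (Fs i)) \<le> (LINT t:{0<..<1}|lborel. norm (F t - Fs i t))"
      using norm_set_integral_mult_indicator_diff[OF F Fi(2), of UNIV] by simp
    then have J: "norm (?J F * ?\<mu> - ?J (Fs i) * ?\<mu>) < r / 3"
    proof -
      have "norm (?J F * ?\<mu> - ?J (Fs i) * ?\<mu>) = norm (?J F - ?J (Fs i)) * gauss_measure A"
        using gauss_measure_bounds[OF A] by (simp add: norm_mult flip: left_diff_distrib)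
      also have "\<dots> \<le> norm (?J F - ?J (Fs i))"
        using gauss_measure_bounds[OF A] by (intro mult_left_le) auto
      finally show ?thesis using i \<open>norm (?J F - ?J (Fs i)) \<le> _\<close> by linarith
    qed
    have tri: "norm (x - z) \<le> norm (x - y) + norm (y - w) + norm (z - w)" for x y z w :: complex
      using norm_triangle_ineq4[of "(x - y) + (y - w)" "z - w"] norm_triangle_ineq[of "x - y" "y - w"] by simp
    have "norm (?I F n - ?J F * ?\<mu>) < r" if "n \<ge> N" for n
    proof -
      have *: "norm (?I F n - ?J F * ?\<mu>) \<le> norm (?I F n - ?I (Fs i) n) + norm (?I (Fs i) n - ?J (Fs i) * ?\<mu>) + norm (?J F * ?\<mu> - ?J (Fs i) * ?\<mu>)"
        by (rule tri)
      have "norm (?I F n - ?I (Fs i) n) < r / 3"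
      proof (rule order_le_less_trans[OF _ i])
        show "norm (?I F n - ?I (Fs i) n) \<le> (LINT t:{0<..<1}|lborel. norm (F t - Fs i t))"
          by (rule norm_set_integral_mult_indicator_diff[OF F Fi(2) B])
      qed
      then have "norm (?I F n - ?I (Fs i) n) + norm (?I (Fs i) n - ?J (Fs i) * ?\<mu>) + norm (?J F * ?\<mu> - ?J (Fs i) * ?\<mu>) < r / 3 + r / 3 + r / 3"
        by (intro add_strict_mono N that J)
      with * show ?thesis by simp
    qed
    then show "\<exists>N. \<forall>n\<ge>N. norm (?I F n - ?J F * ?\<mu>) < r" by blast
  qed
qed

lemma gauss_equidistributed_cone:
  assumes k: "k \<in> gauss_cone"
  shows "gauss_equidistributed (\<lambda>t. of_real (k t))"
  unfolding gauss_equidistributed_def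
proof
  fix A :: "real set" assume A: "A \<in> sets borel"
  have "(\<lambda>n. (1 - ln 2 / 81) ^ n * unit_mass k) \<longlonglongrightarrow> 0 * unit_mass k"
    by (intro tendsto_mult_right LIMSEQ_realpow_zero gauss_mixing_rate_bounds)
  then have "(\<lambda>n. (LINT t:{0<..<1}|lborel. k t * indicator ((gauss_preimage 1 ^^ n) A) t) - unit_mass k * gauss_measure A) \<longlonglongrightarrow> 0"
    unfolding mult_zero_left
    by (rule Lim_null_comparison[rotated]) (rule always_eventually, simp only: real_norm_def gauss_cone_mixing[OF k A] simp_thms)
  then have "(\<lambda>n. complex_of_real (LINT t:{0<..<1}|lborel. k t * indicator ((gauss_preimage 1 ^^ n) A) t)) \<longlonglongrightarrow> of_real (unit_mass k * gauss_measure A)"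
    by (intro tendsto_of_real) (simp add: LIM_zero_cancel)
  moreover have "(LINT t:{0<..<1}|lborel. complex_of_real (k t) * indicator C t) = of_real (LINT t:{0<..<1}|lborel. k t * indicator C t)" for C
    unfolding set_lebesgue_integral_def
    by (subst integral_complex_of_real[symmetric]) (auto intro!: Bochner_Integration.integral_cong simp: indicator_def)
  moreover have "(LINT t:{0<..<1}|lborel. complex_of_real (k t)) = of_real (unit_mass k)"
    unfolding set_lebesgue_integral_def unit_mass_def
    by (subst integral_complex_of_real[symmetric]) (auto intro!: Bochner_Integration.integral_cong simp: indicator_def)
  ultimately show "(\<lambda>n. LINT t:{0<..<1}|lborel. complex_of_real (k t) * indicator ((gauss_preimage 1 ^^ n) A) t)
       \<longlonglongrightarrow> (LINT t:{0<..<1}|lborel. complex_of_real (k t)) * of_real (gauss_measure A)" by simp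
qed


text \<open>Adding \<open>M\<close> times the invariant density puts \<open>\<phi>\<close> into the
  cone. Decrease requires M / 4 \<ge> L; the other condition requires M to dominate 4 L + 4, a
  Lipschitz constant of (1 + s)^2 \<phi>(s) on the unit interval, since (1 + s)^2 times the density
  is 1 + s. Positivity is then automatic, the density being at least 1 / 2.\<close>

lemma gauss_equidistributed_lipschitz:
  assumes L: "\<And>s t. \<bar>\<phi> s - \<phi> t\<bar> \<le> L * \<bar>s - t\<bar>" and B: "\<And>t. \<bar>\<phi> t\<bar> \<le> 1"
    and [measurable]: "\<phi> \<in> borel_measurable borel"
  shows "gauss_equidistributed (\<lambda>t. complex_of_real (\<phi> t))"
proof -
  have L0: "0 \<le> L" using L[of 0 1] by simp
  define M where "M = 4 * L + 4"
  have M: "M \<ge> 4 * L + 4" "M \<ge> 4" using L0 by (auto simp: M_def)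
  have [measurable]: "gauss_density \<in> borel_measurable borel" by (rule gauss_coneD(1)[OF gauss_density_cone])
  define k where "k t = \<phi> t + M * gauss_density t" for t
  have "k \<in> gauss_cone"
  proof -
    have "0 \<le> k s" if "s \<in> {0<..<1}" for s
    proof -
      have "1 / 2 \<le> gauss_density s" using that by (simp add: gauss_density_def field_simps)
      then have "4 * (1 / 2) \<le> M * gauss_density s" using M by (intro mult_mono) auto
      then show ?thesis using B[of s] by (simp add: k_def)
    qed
    moreover have "k t \<le> k s \<and> (1 + s)\<^sup>2 * k s \<le> (1 + t)\<^sup>2 * k t" if st: "0 < s" "s \<le> t" "t < 1" for s t
    proof
      have "\<phi> t - \<phi> s \<le> L * (t - s)" using L[of s t] st by (auto simp: abs_if split: if_splits)
      moreover have "4 * L * ((t - s) / 4) \<le> M * (gauss_density s - gauss_density t)"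
        using gauss_density_diff(1)[OF st] M L0 st by (intro mult_mono) auto
      ultimately show "k t \<le> k s" by (simp add: k_def right_diff_distrib)
      have "\<bar>(1 + s)\<^sup>2 * \<phi> s - (1 + t)\<^sup>2 * \<phi> t\<bar> = \<bar>(1 + s)\<^sup>2 * (\<phi> s - \<phi> t) - ((1 + t)\<^sup>2 - (1 + s)\<^sup>2) * \<phi> t\<bar>"
        by (simp add: algebra_simps)
      also have "\<dots> \<le> (1 + s)\<^sup>2 * \<bar>\<phi> s - \<phi> t\<bar> + \<bar>(1 + t)\<^sup>2 - (1 + s)\<^sup>2\<bar> * \<bar>\<phi> t\<bar>"
        by (rule order_trans[OF abs_triangle_ineq4]) (simp add: abs_mult)
      also have "\<dots> \<le> 2\<^sup>2 * (L * (t - s)) + 4 * (t - s) * 1"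
      proof (intro add_mono mult_mono)
        show "(1 + s)\<^sup>2 \<le> 2\<^sup>2" using st by (intro power_mono) auto
        show "\<bar>\<phi> s - \<phi> t\<bar> \<le> L * (t - s)" using L[of s t] st by simp
        have "(1 + t)\<^sup>2 - (1 + s)\<^sup>2 = (t - s) * (2 + s + t)" by algebra
        moreover have "(t - s) * (2 + s + t) \<le> (t - s) * 4" using st by (intro mult_left_mono) auto
        moreover have "0 \<le> (t - s) * (2 + s + t)" using st by simp
        ultimately show "\<bar>(1 + t)\<^sup>2 - (1 + s)\<^sup>2\<bar> \<le> 4 * (t - s)" by simp
      qed (use B st in auto)
      also have "\<dots> = M * (t - s)" by (simp add: M_def algebra_simps)
      finally have "(1 + s)\<^sup>2 * \<phi> s - (1 + t)\<^sup>2 * \<phi> t \<le> M * (t - s)" by simp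
      moreover have eq: "(1 + r)\<^sup>2 * k r = (1 + r)\<^sup>2 * \<phi> r + M * (1 + r)" if "0 < r" for r
      proof -
        have "(1 + r)\<^sup>2 * gauss_density r = 1 + r"
          using that by (simp add: gauss_density_def power2_eq_square)
        then show ?thesis by (simp only: k_def distrib_left mult.left_commute[of _ M])
      qed
      moreover have "(1 + s)\<^sup>2 * k s = (1 + s)\<^sup>2 * \<phi> s + (M + M * s)" "(1 + t)\<^sup>2 * k t = (1 + t)\<^sup>2 * \<phi> t + (M + M * t)"
        using eq[of s] eq[of t] st by (simp_all add: distrib_left)
      ultimately show "(1 + s)\<^sup>2 * k s \<le> (1 + t)\<^sup>2 * k t" by (simp add: right_diff_distrib)
    qed
    ultimately show ?thesis by (auto simp: gauss_cone_def k_def[abs_def])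
  qed
  then have k: "gauss_equidistributed (\<lambda>t. of_real (k t))" "set_integrable lborel {0<..<1} k"
    by (rule gauss_equidistributed_cone set_integrable_gauss_cone)+
  have h: "gauss_equidistributed (\<lambda>t. of_real (- M) * of_real (gauss_density t))"
    by (intro gauss_equidistributed_scale gauss_equidistributed_cone gauss_density_cone)
  have c: "set_integrable lborel {0<..<1} (\<lambda>t. complex_of_real (g t))" if "set_integrable lborel {0<..<1} g" for g
    using integrable_of_real[OF that[unfolded set_integrable_def], where 'a = complex]
    by (simp add: set_integrable_def scaleR_conv_of_real)
  have "gauss_equidistributed (\<lambda>t. of_real (k t) + of_real (- M) * of_real (gauss_density t))"
    by (rule gauss_equidistributed_add[OF k(1) h c[OF k(2)] set_integrable_mult_right])
       (use c[OF set_integrable_gauss_cone[OF gauss_density_cone]] in auto)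
  then show ?thesis by (simp add: k_def)
qed

text \<open>Bounded pointwise limits preserve the property, so it spreads from Lipschitz ramps to
  half-lines and, by complements and disjoint unions, to all Borel sets.\<close>

lemma gauss_equidistributed_borel:
  assumes B: "B \<in> sets borel"
  shows "gauss_equidistributed (\<lambda>t. indicator B t)"
proof -
  have I: "set_integrable lborel {0<..<1} (\<lambda>t. indicator C t :: complex)" if [measurable]: "C \<in> sets borel" for C :: "real set"
  proof -
    have "set_integrable lborel {0<..<1} (\<lambda>t::real. 1 :: complex)" by (simp add: set_integrable_def)
    from set_integrable_mult_indicator_complex[OF this that] show ?thesis by simp
  qed
  have D: "set_integrable lborel {0<..<1} (\<lambda>t::real. C :: real)" for C
    by (simp add: set_integrable_def)
  have lim: "gauss_equidistributed F"
    if "\<And>i. gauss_equidistributed (Fs i)" "\<And>i. Fs i \<in> borel_measurable borel" "\<And>i t. norm (Fs i t) \<le> 1"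
      "F \<in> borel_measurable borel" "\<And>t. norm (F t) \<le> 1" "\<And>t. (\<lambda>i. Fs i t) \<longlonglongrightarrow> F t" for F Fs
  proof (rule gauss_equidistributed_limit)
    note [measurable] = that(2,4)
    have si: "set_integrable lborel {0<..<1} G" if [measurable]: "G \<in> borel_measurable borel" and "\<And>t. norm (G t) \<le> 1" for G :: "real \<Rightarrow> complex"
      unfolding set_integrable_def
      by (rule Bochner_Integration.integrable_bound[OF D[of 1, unfolded set_integrable_def]])
         (use that(2) in \<open>auto simp: indicator_def\<close>)
    show "set_integrable lborel {0<..<1} (Fs i)" "set_integrable lborel {0<..<1} F" for i
      using that by (intro si; simp)+
    have "(\<lambda>i. LINT t:{0<..<1}|lborel. norm (F t - Fs i t)) \<longlonglongrightarrow> (LINT t:{0<..<1::real}|lborel. 0)"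
      unfolding set_lebesgue_integral_def
    proof (rule integral_dominated_convergence[where w = "\<lambda>t. indicator {0<..<1} t *\<^sub>R 2"])
      show "AE x in lborel. (\<lambda>i. indicat_real {0<..<1} x *\<^sub>R cmod (F x - Fs i x)) \<longlonglongrightarrow> indicat_real {0<..<1} x *\<^sub>R 0"
      proof (intro AE_I2 tendsto_scaleR tendsto_const)
        fix x show "(\<lambda>i. cmod (F x - Fs i x)) \<longlonglongrightarrow> 0"
          using tendsto_norm[OF tendsto_diff[OF tendsto_const that(6)[of x]], of "F x"] by simp
      qed
      have "norm (F x - Fs i x) \<le> 2" for i x
        using norm_triangle_ineq4[of "F x" "Fs i x"] that(3)[of i x] that(5)[of x] by linarith
      then show "AE x in lborel. norm (indicat_real {0<..<1} x *\<^sub>R cmod (F x - Fs i x)) \<le> indicat_real {0<..<1} x *\<^sub>R 2" for i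
        by (auto simp: indicator_def)
    qed (use D[of 2] in \<open>auto simp: set_integrable_def\<close>)
    then show "(\<lambda>i. LINT t:{0<..<1}|lborel. norm (F t - Fs i t)) \<longlonglongrightarrow> 0"
      by (simp add: set_lebesgue_integral_def)
  qed (use that in auto)
  have one: "gauss_equidistributed (\<lambda>_. 1)"
    using gauss_equidistributed_lipschitz[of "\<lambda>_. 1" 0] by simp
  have "Int_stable (range lessThan :: real set set)"
  proof (rule Int_stableI_image)
    show "\<exists>c\<in>UNIV. {..<a} \<inter> {..<b} = {..<c}" for a b :: real
      by (intro bexI[of _ "min a b"]) auto
  qed
  moreover have "range lessThan \<subseteq> Pow (UNIV :: real set)" by simp
  moreover have "B \<in> sigma_sets UNIV (range lessThan)"
    using B by (simp add: borel_Iio)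
  ultimately show ?thesis
  proof (induction rule: sigma_sets_induct_disjoint[where \<Omega> = UNIV and G = "range lessThan"])
    case (basic X)
    then obtain a where X: "X = {..<a}" by auto
    \<comment> \<open>The ramp vanishes from \<open>a\<close> on and equals 1 up to a - 1 / i, so
      its limit is the indicator of the open half-line, including the value 0 at
      \<open>a\<close>.\<close>
    define \<phi> where "\<phi> i t = max 0 (min 1 (real i * (a - t)))" for i t
    show ?case
    proof (rule lim[where Fs = "\<lambda>i t. of_real (\<phi> i t)"])
      show "gauss_equidistributed (\<lambda>t. complex_of_real (\<phi> i t))" for i
      proof (rule gauss_equidistributed_lipschitz[where L = "real i"])
        fix s t
        have "\<bar>\<phi> i s - \<phi> i t\<bar> \<le> \<bar>real i * (a - s) - real i * (a - t)\<bar>" unfolding \<phi>_def by linarith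
        also have "\<dots> = real i * \<bar>s - t\<bar>" by (simp add: abs_mult abs_minus_commute flip: right_diff_distrib)
        finally show "\<bar>\<phi> i s - \<phi> i t\<bar> \<le> real i * \<bar>s - t\<bar>" .
      qed (auto simp: \<phi>_def)
      show "(\<lambda>i. complex_of_real (\<phi> i t)) \<longlonglongrightarrow> indicator X t" for t
      proof (cases "t < a")
        case False
        then have "real i * (a - t) \<le> 0" for i by (simp add: mult_nonneg_nonpos)
        then have "\<phi> i t = 0" for i by (simp add: \<phi>_def min.coboundedI2 max_absorb1)
        then show ?thesis using False by (simp add: X)
      next
        case True
        have "\<phi> i t = 1" if "i \<ge> nat \<lceil>1 / (a - t)\<rceil>" for i
        proof -
          have "1 / (a - t) \<le> real i" using that by linarith
          then have "1 \<le> real i * (a - t)" using True by (simp add: field_simps)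
          then show ?thesis by (simp add: \<phi>_def)
        qed
        then have "eventually (\<lambda>i. complex_of_real (\<phi> i t) = 1) sequentially"
          unfolding eventually_sequentially by (intro exI[of _ "nat \<lceil>1 / (a - t)\<rceil>"]) simp
        then show ?thesis using True by (simp add: X tendsto_eventually)
      qed
    qed (auto simp: \<phi>_def X indicator_def)
  next
    case empty
    show ?case using gauss_equidistributed_scale[OF one, of 0] by simp
  next
    case (compl C)
    then have C: "C \<in> sets borel" by (simp add: borel_Iio)
    have "gauss_equidistributed (\<lambda>t. 1 + (-1) * indicator C t)"
      by (intro gauss_equidistributed_add gauss_equidistributed_scale one compl(2) set_integrable_mult_right I C)
         (simp add: set_integrable_def)
    moreover have "indicator (UNIV - C) t = 1 + (-1) * (indicator C t :: complex)" for t
      by (simp add: indicator_def)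
    ultimately show ?case by (simp only:)
  next
    case (union C)
    then have C[measurable]: "C i \<in> sets borel" for i by (auto simp: borel_Iio)
    show ?case
    proof (rule lim[where Fs = "\<lambda>i t. indicator (\<Union>j<i. C j) t"])
      show "gauss_equidistributed (\<lambda>t. indicator (\<Union>j<i. C j) t)" for i
      proof (induction i)
        case 0
        show ?case using gauss_equidistributed_scale[OF one, of 0] by simp
      next
        case (Suc i)
        have "gauss_equidistributed (\<lambda>t. indicator (\<Union>j<i. C j) t + indicator (C i) t)"
          by (intro gauss_equidistributed_add Suc union(3) I) measurable
        moreover have "indicator (\<Union>j<Suc i. C j) t = indicator (\<Union>j<i. C j) t + (indicator (C i) t :: complex)" for t
        proof -
          have "C j \<inter> C i = {}" if "j < i" for j
            using disjoint_family_onD[OF union(1), of j i] that by simp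
          then have "(\<Union>j<i. C j) \<inter> C i = {}" by blast
          moreover have "(\<Union>j<Suc i. C j) = (\<Union>j<i. C j) \<union> C i" by (auto simp: lessThan_Suc)
          ultimately show ?thesis by (auto simp: indicator_def)
        qed
        ultimately show ?case by (simp only:)
      qed
      show "(\<lambda>i. indicator (\<Union>j<i. C j) t :: complex) \<longlonglongrightarrow> indicator (\<Union>i. C i) t" for t
        by (rule LIMSEQ_indicator_UN)
    qed (auto simp: indicator_def)
  qed
qed

lemma gauss_equidistributed_integrable:
  fixes F :: "real \<Rightarrow> complex"
  assumes "integrable lborel F"
  shows "gauss_equidistributed F"
  using assms
proof (induction rule: integrable_induct)
  case (base A c)
  have "gauss_equidistributed (\<lambda>t. c * indicator A t)"
    using base by (intro gauss_equidistributed_scale gauss_equidistributed_borel) auto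
  then show ?case by (simp add: scaleR_conv_of_real of_real_indicator mult.commute)
next
  case (add f g)
  have "set_integrable lborel {0<..<1::real} h" if "integrable lborel h" for h :: "real \<Rightarrow> complex"
    unfolding set_integrable_def by (rule integrable_mult_indicator) (use that in auto)
  with add show ?case by (intro gauss_equidistributed_add) auto
next
  case (lim f s)
  have si: "set_integrable lborel {0<..<1::real} h" if "integrable lborel h" for h :: "real \<Rightarrow> complex"
    unfolding set_integrable_def by (rule integrable_mult_indicator) (use that in auto)
  show ?case
  proof (rule gauss_equidistributed_limit[OF lim(5)])
    note [measurable] = borel_measurable_integrable[OF lim(1)] borel_measurable_integrable[OF lim(4)]
    have "(\<lambda>i. LINT t:{0<..<1}|lborel. norm (f t - s i t)) \<longlonglongrightarrow> (LINT t:{0<..<1::real}|lborel. 0)"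
      unfolding set_lebesgue_integral_def
    proof (rule integral_dominated_convergence[where w = "\<lambda>t. 3 * norm (f t)"])
      show "AE x in lborel. (\<lambda>i. indicat_real {0<..<1} x *\<^sub>R cmod (f x - s i x)) \<longlonglongrightarrow> indicat_real {0<..<1} x *\<^sub>R 0"
      proof (intro AE_I2 tendsto_scaleR tendsto_const)
        fix x :: real show "(\<lambda>i. cmod (f x - s i x)) \<longlonglongrightarrow> 0"
          using tendsto_norm[OF tendsto_diff[OF tendsto_const lim(2)[of x]], of "f x"] by simp
      qed
      have "norm (f x - s i x) \<le> 3 * norm (f x)" for i x
        using norm_triangle_ineq4[of "f x" "s i x"] lim(3)[of x i] by simp
      then show "AE x in lborel. norm (indicat_real {0<..<1} x *\<^sub>R cmod (f x - s i x)) \<le> 3 * norm (f x)" for i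
        by (auto simp: indicator_def)
    qed (use lim in auto)
    then show "(\<lambda>i. LINT t:{0<..<1}|lborel. norm (f t - s i t)) \<longlonglongrightarrow> 0"
      by (simp add: set_lebesgue_integral_def)
  qed (use lim si in auto)
qed

text \<open>By invariance the integral over \<open>A\<close> is the same for all even iterated
  preimages of \<open>A\<close>, while mixing makes it tend to the integral of \<open>f\<close> over
  (0, 1) times the Gauss measure of \<open>A\<close>, that is, to 0.\<close>

lemma frac_annihilated_critical:
  assumes f: "frac_annihilated 1 f" and 0: "(LINT t:{0<..<1}|lborel. f t) = 0"
  shows "AE t in lborel. f t = 0"
proof (rule frac_annihilated_eq_0[OF _ _ f])
  fix A :: "real set" assume A: "A \<in> sets borel" "A \<subseteq> {0<..<1}"
  have eq: "(LINT t|lborel. f t * indicator ((gauss_preimage 1 ^^ n) A) t) =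
      (LINT t:{0<..<1}|lborel. f t * indicator ((gauss_preimage 1 ^^ n) A) t)" for n
  proof -
    have "(gauss_preimage 1 ^^ n) A \<subseteq> {0<..<1}"
      using A(2) gauss_preimage_subset_unit[of 1] by (cases n) auto
    then show ?thesis
      unfolding set_lebesgue_integral_def
      by (intro Bochner_Integration.integral_cong) (auto simp: indicator_def)
  qed
  have "gauss_equidistributed f"
    using f by (intro gauss_equidistributed_integrable) (simp add: frac_annihilated_def)
  then have "(\<lambda>n. LINT t|lborel. f t * indicator ((gauss_preimage 1 ^^ n) A) t) \<longlonglongrightarrow> 0"
    using A(1) unfolding gauss_equidistributed_def eq by (simp add: 0)
  then have "(\<lambda>n. LINT t|lborel. f t * indicator ((gauss_preimage 1 ^^ (2 * n)) A) t) \<longlonglongrightarrow> 0"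
    by (rule LIMSEQ_subseq_LIMSEQ[of _ _ "\<lambda>n. 2 * n", unfolded o_def]) (simp add: strict_mono_def)
  then show "(LINT t|lborel. f t * indicator A t) = 0"
    using integral_gauss_preimage_even[OF _ _ f A] by (simp add: LIMSEQ_const_iff)
qed auto

section \<open>Periodization of continuously differentiable functions\<close>

definition C1 :: "(real \<Rightarrow> real) \<Rightarrow> bool" where
  "C1 u \<longleftrightarrow> (\<forall>x. u differentiable (at x)) \<and> continuous_on UNIV (deriv u)"

lemma C1I:
  assumes "\<And>x. (u has_real_derivative u' x) (at x)" "continuous_on UNIV u'"
  shows "C1 u" "deriv u = u'"
proof -
  show d: "deriv u = u'" using assms(1) by (auto intro!: DERIV_imp_deriv)
  show "C1 u" using assms by (auto simp: C1_def d real_differentiable_def)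
qed

lemma C1_deriv: "C1 u \<Longrightarrow> (u has_real_derivative deriv u x) (at x)"
  by (simp add: C1_def DERIV_deriv_iff_real_differentiable)

lemma C1_continuous_deriv: "C1 u \<Longrightarrow> continuous_on S (deriv u)"
  by (auto simp: C1_def intro: continuous_on_subset)

lemma C1_continuous: "C1 u \<Longrightarrow> continuous_on S u"
  using C1_deriv by (meson DERIV_isCont continuous_at_imp_continuous_on)

lemma
  assumes "C1 u" "C1 v"
  shows C1_add: "C1 (\<lambda>x. u x + v x)" and deriv_C1_add: "deriv (\<lambda>x. u x + v x) = (\<lambda>x. deriv u x + deriv v x)"
    and C1_mult: "C1 (\<lambda>x. u x * v x)" and deriv_C1_mult: "deriv (\<lambda>x. u x * v x) = (\<lambda>x. deriv u x * v x + deriv v x * u x)"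
proof -
  note c = C1_continuous_deriv[OF assms(1)] C1_continuous_deriv[OF assms(2)] C1_continuous[OF assms(1)] C1_continuous[OF assms(2)]
  have 1: "((\<lambda>x. u x + v x) has_real_derivative deriv u x + deriv v x) (at x)" for x
    by (intro derivative_intros C1_deriv assms)
  have 2: "((\<lambda>x. u x * v x) has_real_derivative deriv u x * v x + deriv v x * u x) (at x)" for x
    by (rule DERIV_mult[OF C1_deriv[OF assms(1)] C1_deriv[OF assms(2)]])
  show "C1 (\<lambda>x. u x + v x)" "deriv (\<lambda>x. u x + v x) = (\<lambda>x. deriv u x + deriv v x)"
    by (rule C1I[OF 1], intro continuous_intros c)+
  show "C1 (\<lambda>x. u x * v x)" "deriv (\<lambda>x. u x * v x) = (\<lambda>x. deriv u x * v x + deriv v x * u x)"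
    by (rule C1I[OF 2], intro continuous_intros c)+
qed

lemma
  assumes "C1 u"
  shows C1_cmult: "C1 (\<lambda>x. c * u x)" and deriv_C1_cmult: "deriv (\<lambda>x. c * u x) = (\<lambda>x. c * deriv u x)"
    and C1_affine: "C1 (\<lambda>x. u (c * x + d))" and deriv_C1_affine: "deriv (\<lambda>x. u (c * x + d)) = (\<lambda>x. c * deriv u (c * x + d))"
proof -
  note cc = C1_continuous_deriv[OF assms]
  have 1: "((\<lambda>x. c * u x) has_real_derivative c * deriv u x) (at x)" for x
    by (rule DERIV_cmult[OF C1_deriv[OF assms]])
  have 2: "((\<lambda>x. u (c * x + d)) has_real_derivative c * deriv u (c * x + d)) (at x)" for x
  proof -
    have "((\<lambda>x. c * x + d) has_real_derivative c) (at x)" by (auto intro!: derivative_eq_intros)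
    from DERIV_chain2[OF C1_deriv[OF assms] this] show ?thesis by (simp add: mult.commute)
  qed
  show "C1 (\<lambda>x. c * u x)" "deriv (\<lambda>x. c * u x) = (\<lambda>x. c * deriv u x)"
    by (rule C1I[OF 1], intro continuous_intros cc)+
  show "C1 (\<lambda>x. u (c * x + d))" "deriv (\<lambda>x. u (c * x + d)) = (\<lambda>x. c * deriv u (c * x + d))"
    by (rule C1I[OF 2], intro continuous_intros continuous_on_compose2[OF C1_continuous_deriv[OF assms, of UNIV]], auto)+
qed

lemma
  assumes "C1 u" "C1 v"
  shows C1_diff: "C1 (\<lambda>x. u x - v x)" and deriv_C1_diff: "deriv (\<lambda>x. u x - v x) = (\<lambda>x. deriv u x - deriv v x)"
  using C1_add[OF assms(1) C1_cmult[OF assms(2), of "-1"]] deriv_C1_add[OF assms(1) C1_cmult[OF assms(2), of "-1"]]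
  by (simp_all add: deriv_C1_cmult[OF assms(2)] deriv_C1_cmult[OF assms(2), of "-1", simplified])

lemma C1_const: "C1 (\<lambda>_. c)" and deriv_C1_const: "deriv (\<lambda>_. c :: real) = (\<lambda>_. 0)"
  by (rule C1I[of _ "\<lambda>_. 0"]; simp)+

lemma C1_sum:
  assumes "\<And>i. i \<in> I \<Longrightarrow> C1 (u i)"
  shows "C1 (\<lambda>x. \<Sum>i\<in>I. u i x) \<and> deriv (\<lambda>x. \<Sum>i\<in>I. u i x) = (\<lambda>x. \<Sum>i\<in>I. deriv (u i) x)"
  using assms
proof (induction I rule: infinite_finite_induct)
  case (insert i I)
  then show ?case using C1_add[of "u i" "\<lambda>x. \<Sum>i\<in>I. u i x"] deriv_C1_add[of "u i" "\<lambda>x. \<Sum>i\<in>I. u i x"] by simp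
qed (auto simp: C1_const deriv_C1_const)

section \<open>Lattice sums of functions with bounded support\<close>

definition supp_in :: "real \<Rightarrow> real \<Rightarrow> (real \<Rightarrow> 'a::zero) \<Rightarrow> bool" where
  "supp_in a b g \<longleftrightarrow> (\<forall>x. x < a \<or> b < x \<longrightarrow> g x = 0)"

lemma supp_inD: "supp_in a b g \<Longrightarrow> x < a \<or> b < x \<Longrightarrow> g x = 0"
  unfolding supp_in_def by blast

lemma supp_in_mono: "supp_in a b g \<Longrightarrow> a' \<le> a \<Longrightarrow> b \<le> b' \<Longrightarrow> supp_in a' b' g"
  by (force simp: supp_in_def)

lemma supp_in_deriv:
  assumes "supp_in a b (g :: real \<Rightarrow> real)"
  shows "supp_in a b (deriv g)"
  unfolding supp_in_def
proof (intro allI impI)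
  fix x assume x: "x < a \<or> b < x"
  have "(g has_real_derivative 0) (at x)"
  proof (rule has_field_derivative_transform_within_open)
    show "((\<lambda>_. 0) has_real_derivative 0) (at x)" by simp
    show "open ({..<a} \<union> {b<..})" by (intro open_Un) auto
    show "x \<in> {..<a} \<union> {b<..}" using x by auto
    show "0 = g y" if "y \<in> {..<a} \<union> {b<..}" for y
      using supp_inD[OF assms, of y] that by auto
  qed
  then show "deriv g x = 0" by (rule DERIV_imp_deriv)
qed

text \<open>Only indices with a nonzero term are summed over, which makes this an ordinary finite
  sum for a function of bounded support; with infinitely many such indices \<open>sum\<close>
  returns its default value 0.\<close>

definition per_sum :: "(real \<Rightarrow> 'a::comm_monoid_add) \<Rightarrow> real \<Rightarrow> 'a" where
  "per_sum g s = (\<Sum>j | g (s + of_int j) \<noteq> 0. g (s + of_int j))"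

text \<open>The window \<open>M\<close> may be enlarged freely, so functions with different
  supports, or one function at all points of a ball, share one index set and can be treated term by
  term.\<close>

lemma per_sum_eq:
  assumes "supp_in a b g" "\<bar>s\<bar> + \<bar>a\<bar> + \<bar>b\<bar> \<le> real M"
  shows "per_sum g s = (\<Sum>i<2 * M + 1. g (s + real i - real M))"
proof -
  have "per_sum g s = (\<Sum>j\<in>{- int M..int M}. g (s + of_int j))"
    unfolding per_sum_def
  proof (rule sum.mono_neutral_left)
    have "j \<in> {- int M..int M}" if "g (s + of_int j) \<noteq> 0" for j
    proof -
      have "a \<le> s + of_int j" "s + of_int j \<le> b"
        using supp_inD[OF assms(1), of "s + of_int j"] that by fastforce+
      then show ?thesis using assms(2) by (auto simp: abs_if split: if_splits)
    qed
    then show "{j. g (s + of_int j) \<noteq> 0} \<subseteq> {- int M..int M}" by blast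
  qed auto
  also have "\<dots> = (\<Sum>i<2 * M + 1. g (s + real i - real M))"
    by (rule sum.reindex_bij_witness[of _ "\<lambda>i. int i - int M" "\<lambda>j. nat (j + int M)"]) (auto simp: algebra_simps)
  finally show ?thesis .
qed

lemma per_sum_periodic: "per_sum g (s + 1) = per_sum g s"
  unfolding per_sum_def
  by (rule sum.reindex_bij_witness[of _ "\<lambda>j. j - 1" "\<lambda>j. j + 1"]) (auto simp: add_ac algebra_simps)

lemma per_sum_mult_periodic:
  fixes \<phi> :: "real \<Rightarrow> 'a::idom"
  assumes "\<And>x j. \<phi> (x + of_int j) = \<phi> x"
  shows "per_sum (\<lambda>x. \<phi> x * g x) s = \<phi> s * per_sum g s"
  by (cases "\<phi> s = 0") (simp_all add: per_sum_def assms sum_distrib_left)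

lemma per_sum_diff:
  fixes g h :: "real \<Rightarrow> 'a::ab_group_add"
  assumes "supp_in a b g" "supp_in c d h"
  shows "per_sum (\<lambda>x. g x - h x) s = per_sum g s - per_sum h s"
    and "per_sum (\<lambda>x. g x + h x) s = per_sum g s + per_sum h s"
proof -
  obtain M where M: "\<bar>s\<bar> + (\<bar>a\<bar> + \<bar>b\<bar> + \<bar>c\<bar> + \<bar>d\<bar>) \<le> real M" using real_arch_simple by blast
  have g: "supp_in (min a c) (max b d) g" and h: "supp_in (min a c) (max b d) h"
    by (rule supp_in_mono[OF assms(1)] supp_in_mono[OF assms(2)]; simp)+
  have gh: "supp_in (min a c) (max b d) (\<lambda>x. g x - h x)" "supp_in (min a c) (max b d) (\<lambda>x. g x + h x)"
    using g h by (auto simp: supp_in_def)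
  have M': "\<bar>s\<bar> + \<bar>min a c\<bar> + \<bar>max b d\<bar> \<le> real M" using M by linarith
  show "per_sum (\<lambda>x. g x - h x) s = per_sum g s - per_sum h s" "per_sum (\<lambda>x. g x + h x) s = per_sum g s + per_sum h s"
    unfolding per_sum_eq[OF g M'] per_sum_eq[OF h M'] per_sum_eq[OF gh(1) M'] per_sum_eq[OF gh(2) M']
    by (simp_all add: sum_subtractf sum.distrib)
qed

lemma per_sum_abs_le:
  fixes g h :: "real \<Rightarrow> real"
  assumes "supp_in a b h" "\<And>x. \<bar>g x\<bar> \<le> h x"
  shows "\<bar>per_sum g s\<bar> \<le> per_sum h s"
proof -
  obtain M where M: "\<bar>s\<bar> + \<bar>a\<bar> + \<bar>b\<bar> \<le> real M" using real_arch_simple by blast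
  have g: "supp_in a b g" using assms abs_le_zero_iff unfolding supp_in_def by metis
  show ?thesis
    unfolding per_sum_eq[OF g M] per_sum_eq[OF assms(1) M]
    by (intro order_trans[OF sum_abs] sum_mono assms(2))
qed

text \<open>The source of every partition of unity below: the differences between a step and its
  unit translate telescope along the lattice, from 0 far to the left to 1 far to the right.\<close>

lemma per_sum_telescope:
  fixes S :: "real \<Rightarrow> real"
  assumes "\<And>x. x \<le> a \<Longrightarrow> S x = 0" "\<And>x. b \<le> x \<Longrightarrow> S x = 1"
  shows "per_sum (\<lambda>x. S x - S (x - 1)) s = 1"
proof -
  have supp: "supp_in (min a b) (b + 1) (\<lambda>x. S x - S (x - 1))"
    using assms by (auto simp: supp_in_def)
  obtain M where M: "\<bar>s\<bar> + (\<bar>a\<bar> + \<bar>b\<bar> + \<bar>b\<bar> + 3) \<le> real M" using real_arch_simple by blast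
  then have M': "\<bar>s\<bar> + \<bar>min a b\<bar> + \<bar>b + 1\<bar> \<le> real M" by linarith
  have "per_sum (\<lambda>x. S x - S (x - 1)) s = (\<Sum>i<2 * M + 1. S (s + real (Suc i) - real M - 1) - S (s + real i - real M - 1))"
    unfolding per_sum_eq[OF supp M'] by (intro sum.cong) (auto simp: algebra_simps)
  also have "\<dots> = S (s + real (2 * M + 1) - real M - 1) - S (s - real M - 1)"
    by (subst sum_lessThan_telescope) simp
  also have "\<dots> = 1" using M by (subst assms(1), simp, subst assms(2)) auto
  finally show ?thesis .
qed

lemma C1_per_sum:
  assumes "C1 g" "supp_in a b g"
  shows "C1 (per_sum g)" "deriv (per_sum g) = per_sum (deriv g)"
proof -
  have D: "(per_sum g has_real_derivative per_sum (deriv g) s) (at s)"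
    and C: "isCont (per_sum (deriv g)) s" for s
  proof -
    obtain M where M: "\<bar>s\<bar> + 1 + \<bar>a\<bar> + \<bar>b\<bar> \<le> real M" using real_arch_simple by blast
    have near: "per_sum h x = (\<Sum>i<2 * M + 1. h (x + real i - real M))" if "x \<in> ball s 1" "supp_in a b h" for x h
      by (rule per_sum_eq[OF that(2)]) (use that(1) M in \<open>auto simp: dist_real_def\<close>)
    have "((\<lambda>x. \<Sum>i<2 * M + 1. g (x + real i - real M)) has_real_derivative
        (\<Sum>i<2 * M + 1. deriv g (s + real i - real M))) (at s)"
    proof (rule DERIV_sum)
      fix i show "((\<lambda>x. g (x + real i - real M)) has_real_derivative deriv g (s + real i - real M)) (at s)"
        using C1_deriv[OF C1_affine[OF assms(1), of 1 "real i - real M"], of s]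
        unfolding deriv_C1_affine[OF assms(1)] by (simp add: add_diff_eq)
    qed
    then show "(per_sum g has_real_derivative per_sum (deriv g) s) (at s)"
      unfolding near[OF centre_in_ball[THEN iffD2, OF zero_less_one] supp_in_deriv[OF assms(2)]]
      by (rule has_field_derivative_transform_within_open[where S = "ball s 1"])
         (simp_all only: open_ball centre_in_ball zero_less_one near[OF _ assms(2)])
    have "continuous_on (ball s 1) (\<lambda>x. \<Sum>i<2 * M + 1. deriv g (x + real i - real M))"
      by (intro continuous_intros continuous_on_compose2[OF C1_continuous_deriv[OF assms(1), of UNIV]]) auto
    then have "continuous_on (ball s 1) (per_sum (deriv g))"
      by (rule continuous_on_eq) (rule near[OF _ supp_in_deriv[OF assms(2)], symmetric])
    then show "isCont (per_sum (deriv g)) s" by (simp add: continuous_on_eq_continuous_at)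
  qed
  show "C1 (per_sum g)" "deriv (per_sum g) = per_sum (deriv g)"
    by (rule C1I[OF D], use C in \<open>simp add: continuous_at_imp_continuous_on\<close>)+
qed

lemma continuous_on_per_sum:
  fixes g :: "real \<Rightarrow> 'a::real_normed_vector"
  assumes "continuous_on UNIV g" "supp_in a b g"
  shows "continuous_on S (per_sum g)"
proof -
  have "isCont (per_sum g) s" for s
  proof -
    obtain M where M: "\<bar>s\<bar> + 1 + \<bar>a\<bar> + \<bar>b\<bar> \<le> real M" using real_arch_simple by blast
    have near: "per_sum g x = (\<Sum>i<2 * M + 1. g (x + real i - real M))" if "x \<in> ball s 1" for x
      by (rule per_sum_eq[OF assms(2)]) (use that(1) M in \<open>auto simp: dist_real_def\<close>)
    have "continuous_on (ball s 1) (\<lambda>x. \<Sum>i<2 * M + 1. g (x + real i - real M))"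
      by (intro continuous_intros continuous_on_compose2[OF assms(1)]) auto
    then have "continuous_on (ball s 1) (per_sum g)"
      by (rule continuous_on_eq) (rule near[symmetric])
    then show ?thesis by (simp add: continuous_on_eq_continuous_at)
  qed
  then show ?thesis by (simp add: continuous_at_imp_continuous_on)
qed

lemma integral_per_sum:
  fixes g :: "real \<Rightarrow> 'a::banach"
  assumes g: "continuous_on UNIV g" "supp_in a b g"
  shows "integral {0..1} (per_sum g) = integral {a..b} g"
proof -
  note cont = continuous_on_subset[OF g(1) subset_UNIV]
  obtain M where M: "1 + \<bar>a\<bar> + \<bar>b\<bar> \<le> real M" using real_arch_simple by blast
  have "integral {0..1} (per_sum g) = integral {0..1} (\<lambda>s. \<Sum>i<2 * M + 1. g (s + real i - real M))"
    by (rule integral_cong, rule per_sum_eq[OF g(2)]) (use M in auto)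
  also have "\<dots> = (\<Sum>i<2 * M + 1. integral {0..1} (\<lambda>s. g (s + real i - real M)))"
    by (intro integral_sum integrable_continuous_interval continuous_on_compose2[OF g(1)] continuous_intros) auto
  also have "\<dots> = (\<Sum>i<2 * M + 1. integral {real i - real M..real (Suc i) - real M} g)"
  proof (rule sum.cong[OF refl])
    fix i show "integral {0..1} (\<lambda>s. g (s + real i - real M)) = integral {real i - real M..real (Suc i) - real M} g"
      using integral_shift_Icc_real[of 0 1 g "real i - real M"] by (simp add: o_def algebra_simps)
  qed
  also have "\<dots> = integral {- real M..real (2 * M + 1) - real M} g"
  proof -
    have "(\<Sum>i<n. integral {real i - real M..real (Suc i) - real M} g) = integral {- real M..real n - real M} g" for n
    proof (induction n)
      case (Suc n)
      have "integral {- real M..real n - real M} g + integral {real n - real M..real (Suc n) - real M} g =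
          integral {- real M..real (Suc n) - real M} g"
        by (rule Henstock_Kurzweil_Integration.integral_combine) (auto intro: integrable_continuous_interval cont)
      then show ?case using Suc by simp
    qed simp
    then show ?thesis .
  qed
  also have "\<dots> = integral {a..b} g"
  proof (rule integral_unique, rule has_integral_on_superset)
    show "(g has_integral integral {a..b} g) {a..b}"
      by (intro integrable_integral integrable_continuous_interval cont)
  qed (use g(2) M in \<open>auto simp: supp_in_def\<close>)
  finally show ?thesis .
qed

section \<open>The transport operator\<close>

text \<open>The change of a density on the half-line under the involution t -> \<gamma> / t, with
  \<gamma> / s^2 as Jacobian; it is therefore itself an involution there and preserves
  integrals.\<close>

definition inversion :: "real \<Rightarrow> (real \<Rightarrow> real) \<Rightarrow> real \<Rightarrow> real" where
  "inversion \<gamma> h s = (if 0 < s then \<gamma> / s\<^sup>2 * h (\<gamma> / s) else 0)"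

lemma inversion_inversion: "0 < \<gamma> \<Longrightarrow> 0 < s \<Longrightarrow> inversion \<gamma> (inversion \<gamma> h) s = h s"
  by (simp add: inversion_def power2_eq_square)

lemma inversion_diff: "inversion \<gamma> (\<lambda>x. g x - h x) s = inversion \<gamma> g s - inversion \<gamma> h s"
  and inversion_add: "inversion \<gamma> (\<lambda>x. g x + h x) s = inversion \<gamma> g s + inversion \<gamma> h s"
  by (simp_all add: inversion_def algebra_simps)

context
  fixes \<gamma> a b :: real
  assumes \<gamma>: "0 < \<gamma>" and ab: "0 < a" "a \<le> b"
begin

lemma supp_in_inversion:
  assumes "supp_in a b h"
  shows "supp_in (\<gamma> / b) (\<gamma> / a) (inversion \<gamma> h)"
  unfolding supp_in_def
proof (intro allI impI)
  fix s assume s: "s < \<gamma> / b \<or> \<gamma> / a < s"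
  show "inversion \<gamma> h s = 0"
  proof (cases "0 < s")
    case True
    then have "\<gamma> / s < a \<or> b < \<gamma> / s" using s \<gamma> ab by (auto simp: field_simps)
    then show ?thesis using supp_inD[OF assms, of "\<gamma> / s"] by (simp add: inversion_def)
  qed (simp add: inversion_def)
qed

lemma inversion_locally:
  assumes "supp_in a b h"
  shows "x < \<gamma> / b \<Longrightarrow> inversion \<gamma> h x = 0"
  using supp_inD[OF supp_in_inversion[OF assms]] by auto

lemma continuous_on_inversion:
  assumes h: "continuous_on UNIV h" "supp_in a b h"
  shows "continuous_on S (inversion \<gamma> h)"
proof -
  have "continuous_on {0<..} (\<lambda>s. \<gamma> / s\<^sup>2 * h (\<gamma> / s))"
    by (intro continuous_intros continuous_on_compose2[OF h(1)]) auto
  then have 1: "continuous_on {0<..} (inversion \<gamma> h)"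
    by (rule continuous_on_eq) (simp add: inversion_def)
  have 2: "continuous_on {..<\<gamma> / b} (inversion \<gamma> h)"
    by (rule continuous_on_eq[of _ "\<lambda>_. 0"]) (use inversion_locally[OF h(2)] in auto)
  have "continuous_on ({0<..} \<union> {..<\<gamma> / b}) (inversion \<gamma> h)"
    by (rule continuous_on_open_Un[OF _ _ 1 2]) auto
  moreover have "{0<..} \<union> {..<\<gamma> / b} = UNIV"
  proof -
    have "0 < \<gamma> / b" using \<gamma> ab by simp
    then show ?thesis by (auto intro: order_le_less_trans)
  qed
  ultimately show ?thesis by (metis continuous_on_subset subset_UNIV)
qed

text \<open>The derivative is written as an \<open>inversion\<close> again so that its L1 norm can
  be computed by substitution. The factor t^2 / \<gamma>, the reciprocal of the modulus of the
  derivative of t -> \<gamma> / t, will be the contraction factor; the second summand contains no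
  derivative of \<open>h\<close>.\<close>

lemma
  assumes h: "C1 h" "supp_in a b h"
  shows C1_inversion: "C1 (inversion \<gamma> h)"
    and deriv_inversion: "deriv (inversion \<gamma> h) = inversion \<gamma> (\<lambda>t. - (deriv h t * (t\<^sup>2 / \<gamma>) + 2 * h t * (t / \<gamma>)))"
proof -
  let ?k = "\<lambda>t. - (deriv h t * (t\<^sup>2 / \<gamma>) + 2 * h t * (t / \<gamma>))"
  have c: "continuous_on UNIV h" "continuous_on UNIV (deriv h)"
    by (rule C1_continuous[OF h(1)], rule C1_continuous_deriv[OF h(1)])
  have k: "continuous_on UNIV ?k" "supp_in a b ?k"
    using \<gamma> by (auto intro!: continuous_intros c simp: supp_in_def supp_inD[OF h(2)] supp_inD[OF supp_in_deriv[OF h(2)]])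
  have D: "(inversion \<gamma> h has_real_derivative inversion \<gamma> ?k s) (at s)" for s
  proof (cases "0 < s")
    case True
    have d1: "((\<lambda>s. \<gamma> / s) has_real_derivative - (\<gamma> / s\<^sup>2)) (at s)"
      using True by (auto intro!: derivative_eq_intros simp: power2_eq_square)
    have d2: "((\<lambda>s. \<gamma> / s\<^sup>2) has_real_derivative - (2 * \<gamma> / s ^ 3)) (at s)"
      using True by (auto intro!: derivative_eq_intros simp: eval_nat_numeral)
    note d = d1 d2
    have "((\<lambda>s. \<gamma> / s\<^sup>2 * h (\<gamma> / s)) has_real_derivative
        - (2 * \<gamma> / s ^ 3) * h (\<gamma> / s) + deriv h (\<gamma> / s) * - (\<gamma> / s\<^sup>2) * (\<gamma> / s\<^sup>2)) (at s)"
      by (rule DERIV_mult[OF d(2) DERIV_chain2[OF C1_deriv[OF h(1)] d(1)]])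
    also have "- (2 * \<gamma> / s ^ 3) * h (\<gamma> / s) + deriv h (\<gamma> / s) * - (\<gamma> / s\<^sup>2) * (\<gamma> / s\<^sup>2) = inversion \<gamma> ?k s"
    proof -
      have "(\<gamma> / s)\<^sup>2 / \<gamma> = \<gamma> / s\<^sup>2" "\<gamma> / s / \<gamma> = 1 / s" using \<gamma> by (simp_all add: power2_eq_square)
      moreover have "2 * \<gamma> / s ^ 3 = \<gamma> / s\<^sup>2 * (2 * (1 / s))" by (simp add: power2_eq_square power3_eq_cube)
      ultimately show ?thesis using True unfolding inversion_def by (simp only: if_True) (simp only: algebra_simps mult_minus_left mult_minus_right)
    qed
    finally show ?thesis
      by (rule has_field_derivative_transform_within_open[where S = "{0<..}"])
         (simp_all add: inversion_def True)
  next
    case False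
    then have s: "s < \<gamma> / b" using \<gamma> ab by (auto intro: order_le_less_trans[of _ 0])
    have "((\<lambda>_. 0) has_real_derivative inversion \<gamma> ?k s) (at s)"
      using inversion_locally[OF k(2) s] by simp
    then show ?thesis
      by (rule has_field_derivative_transform_within_open[where S = "{..<\<gamma> / b}"])
         (use s inversion_locally[OF h(2)] in auto)
  qed
  show "C1 (inversion \<gamma> h)" "deriv (inversion \<gamma> h) = inversion \<gamma> ?k"
    by (rule C1I[OF D continuous_on_inversion[OF k]])+
qed

lemma integral_inversion:
  assumes h: "continuous_on UNIV h"
  shows "integral {\<gamma> / b..\<gamma> / a} (inversion \<gamma> h) = integral {a..b} h"
proof -
  have lt: "0 < \<gamma> / b" "\<gamma> / b \<le> \<gamma> / a" using \<gamma> ab by (auto simp: frac_le)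
  have pos: "0 < s" if "s \<in> {\<gamma> / b..\<gamma> / a}" for s
    using that lt(1) by (meson atLeastAtMost_iff order_less_le_trans)
  have "((\<lambda>s. - (\<gamma> / s\<^sup>2) *\<^sub>R h (\<gamma> / s)) has_integral
      (integral {\<gamma> / (\<gamma> / b)..\<gamma> / (\<gamma> / a)} h - integral {\<gamma> / (\<gamma> / a)..\<gamma> / (\<gamma> / b)} h)) {\<gamma> / b..\<gamma> / a}"
  proof (rule has_integral_substitution_general[where s = "{}" and c = a and d = b])
    show "(\<lambda>s. \<gamma> / s) ` {\<gamma> / b..\<gamma> / a} \<subseteq> {a..b}"
    proof (rule image_subsetI)
      fix s assume s: "s \<in> {\<gamma> / b..\<gamma> / a}"
      then have "\<gamma> \<le> s * b" "s * a \<le> \<gamma>" using ab by (auto simp: pos_divide_le_eq pos_le_divide_eq)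
      then show "\<gamma> / s \<in> {a..b}" using pos[OF s] by (auto simp: pos_divide_le_eq pos_le_divide_eq mult.commute)
    qed
    show "continuous_on {\<gamma> / b..\<gamma> / a} (\<lambda>s. \<gamma> / s)"
      by (intro continuous_intros ballI) (use pos in fastforce)
    show "((\<lambda>s. \<gamma> / s) has_real_derivative - (\<gamma> / s\<^sup>2)) (at s within {\<gamma> / b..\<gamma> / a})" if "s \<in> {\<gamma> / b..\<gamma> / a} - {}" for s
    proof -
      have "s \<noteq> 0" using pos[of s] that by auto
      then show ?thesis by (auto intro!: derivative_eq_intros simp: power2_eq_square)
    qed
    show "continuous_on {a..b} h" by (rule continuous_on_subset[OF h]) simp
  qed (simp_all add: lt)
  moreover have "\<gamma> / (\<gamma> / b) = b" "\<gamma> / (\<gamma> / a) = a" using \<gamma> by auto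
  \<comment> \<open>The substitution reverses orientation. The integral over the reversed interval
    is 0 by convention here, so only the negative term survives and matches the sign of the
    derivative.\<close>
  moreover have "integral {b..a} h = 0" using ab by (cases "a = b") auto
  ultimately have "((\<lambda>s. - (\<gamma> / s\<^sup>2) *\<^sub>R h (\<gamma> / s)) has_integral - integral {a..b} h) {\<gamma> / b..\<gamma> / a}" by simp
  from has_integral_neg[OF this] have "((\<lambda>s. \<gamma> / s\<^sup>2 * h (\<gamma> / s)) has_integral integral {a..b} h) {\<gamma> / b..\<gamma> / a}"
    by simp
  then have "(inversion \<gamma> h has_integral integral {a..b} h) {\<gamma> / b..\<gamma> / a}"
    by (rule has_integral_eq[rotated]) (simp only: inversion_def pos if_True)
  then show ?thesis by (rule integral_unique)
qed

end

text \<open>The quadratic spline equal to 2 x^2 on [0, 1/2] and to 1 - 2 (1 - x)^2 on [1/2, 1],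
  constant outside; its derivative is a piecewise linear hat of height 2.\<close>

definition smooth_step :: "real \<Rightarrow> real" where
  "smooth_step x = 2 * (max 0 x)\<^sup>2 - 4 * (max 0 (x - 1 / 2))\<^sup>2 + 2 * (max 0 (x - 1))\<^sup>2"

lemma DERIV_max_square: "((\<lambda>x::real. (max 0 (x - c))\<^sup>2) has_real_derivative 2 * max 0 (x - c)) (at x)"
proof -
  have base: "((\<lambda>x::real. (max 0 x)\<^sup>2) has_real_derivative 2 * max 0 x) (at x)" for x
  proof -
    consider "x < 0" | "x > 0" | "x = 0" by linarith
    then show ?thesis
    proof cases
      case 1
      have "((\<lambda>_. 0) has_real_derivative 2 * max 0 x) (at x)" using 1 by simp
      then show ?thesis
        by (rule has_field_derivative_transform_within_open[where S = "{..<0}"]) (use 1 in auto)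
    next
      case 2
      have "((\<lambda>x. x\<^sup>2) has_real_derivative 2 * max 0 x) (at x)"
        using 2 by (auto intro!: derivative_eq_intros)
      then show ?thesis
        by (rule has_field_derivative_transform_within_open[where S = "{0<..}"]) (use 2 in auto)
    next
      case 3
      have "(\<lambda>h::real. ((max 0 (0 + h))\<^sup>2 - (max 0 0)\<^sup>2) / h) \<midarrow>0\<rightarrow> 0"
      proof (rule Lim_null_comparison)
        show "\<forall>\<^sub>F h in at 0. norm (((max 0 (0 + h))\<^sup>2 - (max 0 (0::real))\<^sup>2) / h) \<le> \<bar>h\<bar>"
          by (auto simp: max_def power2_eq_square intro!: always_eventually)
        show "(\<lambda>h::real. \<bar>h\<bar>) \<midarrow>0\<rightarrow> 0" by (rule tendsto_rabs_zero) simp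
      qed
      then show ?thesis using 3 by (simp add: DERIV_def)
    qed
  qed
  have "((\<lambda>x. x - c) has_real_derivative 1) (at x)" by (auto intro!: derivative_eq_intros)
  from DERIV_chain2[OF base this] show ?thesis by simp
qed

lemma C1_smooth_step: "C1 smooth_step"
  and deriv_smooth_step: "deriv smooth_step = (\<lambda>x. 4 * max 0 x - 8 * max 0 (x - 1 / 2) + 4 * max 0 (x - 1))"
proof -
  have D: "(smooth_step has_real_derivative 4 * max 0 x - 8 * max 0 (x - 1 / 2) + 4 * max 0 (x - 1)) (at x)" for x
    unfolding smooth_step_def[abs_def]
    using DERIV_add[OF DERIV_diff[OF DERIV_cmult[OF DERIV_max_square[of 0 x], of 2] DERIV_cmult[OF DERIV_max_square[of "1 / 2" x], of 4]]
        DERIV_cmult[OF DERIV_max_square[of 1 x], of 2]] by simp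
  show "C1 smooth_step" "deriv smooth_step = (\<lambda>x. 4 * max 0 x - 8 * max 0 (x - 1 / 2) + 4 * max 0 (x - 1))"
    by (rule C1I[OF D], intro continuous_intros)+
qed

lemma smooth_step_0: "x \<le> 0 \<Longrightarrow> smooth_step x = 0"
  by (simp add: smooth_step_def)

lemma smooth_step_1: "1 \<le> x \<Longrightarrow> smooth_step x = 1"
  by (simp add: smooth_step_def power2_eq_square algebra_simps)

lemma deriv_smooth_step_bounds: "0 \<le> deriv smooth_step x" "deriv smooth_step x \<le> 2"
  by (auto simp: deriv_smooth_step max_def)

lemma smooth_step_mono: "x \<le> y \<Longrightarrow> smooth_step x \<le> smooth_step y"
  using C1_deriv[OF C1_smooth_step] deriv_smooth_step_bounds(1)
  by (blast intro: DERIV_nonneg_imp_nondecreasing)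

text \<open>A step rising on [d, 2 d] minus its unit translate, so the integer translates telescope
  to 1. The support begins at d > 0, which keeps the support of the inverted function bounded, and
  ends at 1 + 2 d, which is below \<surd>\<gamma> for small d.\<close>

definition cutoff :: "real \<Rightarrow> real \<Rightarrow> real" where
  "cutoff d x = smooth_step ((x - d) / d) - smooth_step ((x - 1 - d) / d)"

context
  fixes d :: real
  assumes d: "0 < d"
begin

lemma C1_cutoff: "C1 (cutoff d)"
proof -
  have "C1 (\<lambda>x. smooth_step ((1 / d) * x + - 1) - smooth_step ((1 / d) * x + (- (1 / d) - 1)))"
    by (intro C1_diff C1_affine C1_smooth_step)
  also have "(\<lambda>x. smooth_step ((1 / d) * x + - 1) - smooth_step ((1 / d) * x + (- (1 / d) - 1))) = cutoff d"
    unfolding cutoff_def[abs_def] using d by (simp add: diff_divide_distrib add_divide_distrib algebra_simps)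
  finally show ?thesis .
qed

lemma supp_in_cutoff: "supp_in d (1 + 2 * d) (cutoff d)"
  unfolding supp_in_def cutoff_def using d
  by (auto simp: smooth_step_0 smooth_step_1 divide_nonpos_pos pos_le_divide_eq)

lemma cutoff_nonneg: "0 \<le> cutoff d x"
  unfolding cutoff_def using d by (simp add: smooth_step_mono divide_right_mono)

lemma per_sum_cutoff: "per_sum (cutoff d) s = 1"
proof -
  have "per_sum (\<lambda>x. smooth_step ((x - d) / d) - smooth_step ((x - 1 - d) / d)) s = 1"
    by (rule per_sum_telescope[where a = d and b = "2 * d"])
       (use d in \<open>auto simp: smooth_step_0 smooth_step_1 divide_nonpos_pos pos_le_divide_eq\<close>)
  then show ?thesis by (simp add: cutoff_def[abs_def])
qed

end

lemma periodic_of_int: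
  assumes "\<And>x. u (x + 1) = u x"
  shows "u (x + of_int j) = u (x::real)"
proof -
  have nat: "u (x + real n) = u x" for n x
  proof (induction n)
    case (Suc n)
    show ?case using assms[of "x + real n"] Suc by (simp add: add_ac)
  qed simp
  show ?thesis
  proof (cases "j \<ge> 0")
    case True
    then show ?thesis using nat[of x "nat j"] by simp
  next
    case False
    then show ?thesis using nat[of "x + of_int j" "nat (- j)"] by simp
  qed
qed

section \<open>Periodic functions, their total variation and L1 norm over one period\<close>

definition C1per :: "(real \<Rightarrow> real) \<Rightarrow> bool" where
  "C1per u \<longleftrightarrow> C1 u \<and> (\<forall>x. u (x + 1) = u x)"

definition variation :: "(real \<Rightarrow> real) \<Rightarrow> real" where
  "variation u = integral {0..1} (\<lambda>x. \<bar>deriv u x\<bar>)"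

definition L1norm :: "(real \<Rightarrow> real) \<Rightarrow> real" where
  "L1norm u = integral {0..1} (\<lambda>x. \<bar>u x\<bar>)"

text \<open>Multiplication by the cutoff lifts a periodic \<open>u\<close> to a boundedly supported
  function whose lattice sum is \<open>u\<close>; the lift is inverted and made periodic
  again.\<close>

definition transport :: "real \<Rightarrow> real \<Rightarrow> (real \<Rightarrow> real) \<Rightarrow> real \<Rightarrow> real" where
  "transport \<gamma> d u = per_sum (inversion \<gamma> (\<lambda>t. cutoff d t * u t))"

lemma C1perD: "C1per u \<Longrightarrow> C1 u" "C1per u \<Longrightarrow> u (x + 1) = u x"
  by (auto simp: C1per_def)

lemma deriv_C1per:
  assumes "C1per u"
  shows "deriv u (x + 1) = deriv u x"
proof -
  have "deriv (\<lambda>x. u (1 * x + 1)) = (\<lambda>x. 1 * deriv u (1 * x + 1))"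
    by (rule deriv_C1_affine[OF C1perD(1)[OF assms]])
  moreover have "(\<lambda>x. u (1 * x + 1)) = u" using C1perD(2)[OF assms] by auto
  ultimately show ?thesis by (metis mult_1)
qed

lemma C1per_per_sum:
  assumes "C1 g" "supp_in a b g"
  shows "C1per (per_sum g)"
  using C1_per_sum[OF assms] by (simp add: C1per_def per_sum_periodic)

lemma
  assumes "C1per u" "C1per v"
  shows C1per_diff: "C1per (\<lambda>x. u x - v x)" and C1per_cmult: "C1per (\<lambda>x. c * u x)"
  using assms by (auto simp: C1per_def C1_diff C1_cmult)

lemma C1per_sum: "(\<And>i. i \<in> I \<Longrightarrow> C1per (u i)) \<Longrightarrow> C1per (\<lambda>x. \<Sum>i\<in>I. u i x)"
  using C1_sum[of I u] by (simp add: C1per_def)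

lemma variation_nonneg: "C1 u \<Longrightarrow> 0 \<le> variation u"
  unfolding variation_def
  by (intro integral_nonneg integrable_continuous_interval continuous_intros C1_continuous_deriv) auto

lemma L1norm_nonneg: "continuous_on {0..1} u \<Longrightarrow> 0 \<le> L1norm u"
  unfolding L1norm_def
  by (intro integral_nonneg integrable_continuous_interval continuous_intros) auto

lemma variation_diff:
  assumes "C1 u" "C1 v"
  shows "variation (\<lambda>x. u x - v x) \<le> variation u + variation v"
proof -
  have i: "(\<lambda>x. \<bar>deriv u x\<bar>) integrable_on {0..1}" "(\<lambda>x. \<bar>deriv v x\<bar>) integrable_on {0..1}"
    "(\<lambda>x. \<bar>deriv u x - deriv v x\<bar>) integrable_on {0..1}"
    using assms by (auto intro!: integrable_continuous_interval continuous_intros C1_continuous_deriv)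
  show ?thesis
    unfolding variation_def deriv_C1_diff[OF assms] integral_add[OF i(1,2), symmetric]
    by (rule integral_le) (use i in \<open>auto intro: integrable_add\<close>)
qed

lemma C1_diff_le_integral_deriv:
  assumes u: "C1 u" and xy: "x \<le> y"
  shows "\<bar>u y - u x\<bar> \<le> integral {x..y} (\<lambda>t. \<bar>deriv u t\<bar>)"
proof -
  have "(deriv u has_integral (u y - u x)) {x..y}"
    using xy C1_deriv[OF u]
    by (intro fundamental_theorem_of_calculus)
       (auto simp: has_real_derivative_iff_has_vector_derivative[symmetric] intro: has_field_derivative_at_within)
  then have "u y - u x = integral {x..y} (deriv u)" by (simp add: integral_unique)
  also have "\<bar>\<dots>\<bar> \<le> integral {x..y} (\<lambda>t. \<bar>deriv u t\<bar>)"
    using integral_norm_bound_integral[of "deriv u" "{x..y}" "\<lambda>t. \<bar>deriv u t\<bar>"]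
    by (simp add: integrable_continuous_interval C1_continuous_deriv[OF u] continuous_on_rabs)
  finally show ?thesis .
qed

text \<open>Values in one period differ by at most the variation, hence so do a value and the mean.
  This turns the two quantities controlled under \<open>transport\<close> into a uniform
  bound.\<close>

lemma abs_le_variation_mean:
  assumes u: "C1per u"
  shows "\<bar>u x\<bar> \<le> variation u + \<bar>integral {0..1} u\<bar>"
proof -
  have C: "C1 u" by (rule C1perD[OF u])
  have osc: "\<bar>u s - u t\<bar> \<le> variation u" if "s \<in> {0..1}" "t \<in> {0..1}" for s t
  proof -
    have le: "\<bar>u s - u t\<bar> \<le> variation u" if "0 \<le> t" "t \<le> s" "s \<le> 1" for s t
    proof -
      have "\<bar>u s - u t\<bar> \<le> integral {t..s} (\<lambda>t. \<bar>deriv u t\<bar>)" by (rule C1_diff_le_integral_deriv[OF C that(2)])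
      also have "\<dots> \<le> variation u"
        unfolding variation_def using that
        by (intro integral_subset_le integrable_continuous_interval continuous_intros C1_continuous_deriv C) auto
      finally show ?thesis .
    qed
    show ?thesis using le[of t s] le[of s t] that by (cases "t \<le> s") (auto simp: abs_minus_commute)
  qed
  define s where "s = x + of_int (- \<lfloor>x\<rfloor>)"
  have s: "s \<in> {0..1}" unfolding s_def by (simp add: less_imp_le) linarith
  have us: "u s = u x" unfolding s_def by (rule periodic_of_int) (rule C1perD(2)[OF u])
  have ui: "u integrable_on {0..1}" by (intro integrable_continuous_interval C1_continuous C)
  have "\<bar>u s - integral {0..1} u\<bar> = \<bar>integral {0..1} (\<lambda>t. u s - u t)\<bar>"
    using ui by (subst integral_diff) auto
  also have "\<dots> \<le> integral {0..1} (\<lambda>_::real. variation u)"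
  proof -
    have "(\<lambda>t. u s - u t) integrable_on {0..1}" using ui by (intro integrable_diff) auto
    from integral_norm_bound_integral[OF this, of "\<lambda>_. variation u"] show ?thesis using osc[OF s] by auto
  qed
  finally show ?thesis using us by simp
qed

lemma variation_per_sum:
  assumes g: "C1 g" "supp_in a b g"
  shows "variation (per_sum g) \<le> integral {a..b} (\<lambda>x. \<bar>deriv g x\<bar>)"
proof -
  have c: "continuous_on UNIV (\<lambda>x. \<bar>deriv g x\<bar>)" "supp_in a b (\<lambda>x. \<bar>deriv g x\<bar>)"
    using supp_in_deriv[OF g(2)] by (auto intro!: continuous_intros C1_continuous_deriv g simp: supp_in_def)
  have "variation (per_sum g) = integral {0..1} (\<lambda>x. \<bar>per_sum (deriv g) x\<bar>)"
    unfolding variation_def C1_per_sum(2)[OF g] ..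
  also have "\<dots> \<le> integral {0..1} (per_sum (\<lambda>x. \<bar>deriv g x\<bar>))"
    using C1_continuous_deriv[OF g(1)] supp_in_deriv[OF g(2)]
    by (intro integral_le integrable_continuous_interval continuous_intros continuous_on_per_sum[OF c]
        continuous_on_per_sum[of _ a b] per_sum_abs_le[OF c(2)]) auto
  also have "\<dots> = integral {a..b} (\<lambda>x. \<bar>deriv g x\<bar>)" by (rule integral_per_sum[OF c])
  finally show ?thesis .
qed

lemma L1norm_per_sum:
  assumes g: "continuous_on UNIV g" "supp_in a b g"
  shows "L1norm (per_sum g) \<le> integral {a..b} (\<lambda>x. \<bar>g x\<bar>)"
proof -
  have c: "continuous_on UNIV (\<lambda>x. \<bar>g x\<bar>)" "supp_in a b (\<lambda>x. \<bar>g x\<bar>)"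
    using g by (auto intro!: continuous_intros simp: supp_in_def)
  have "L1norm (per_sum g) \<le> integral {0..1} (per_sum (\<lambda>x. \<bar>g x\<bar>))"
    unfolding L1norm_def
    by (intro integral_le integrable_continuous_interval continuous_intros continuous_on_per_sum[OF c]
        continuous_on_per_sum[OF g] per_sum_abs_le[OF c(2)]) auto
  also have "\<dots> = integral {a..b} (\<lambda>x. \<bar>g x\<bar>)" by (rule integral_per_sum[OF c])
  finally show ?thesis .
qed

section \<open>A Lasota-Yorke inequality for the transport operator\<close>

context
  fixes \<gamma> d :: real
  assumes d: "0 < d" and \<gamma>d: "(1 + 2 * d)\<^sup>2 < \<gamma>"
begin

lemma \<gamma>_pos: "0 < \<gamma>" using \<gamma>d by (rule order_le_less_trans[rotated]) simp

lemma d_le: "d \<le> 1 + 2 * d" using d by simp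

lemma supp_in_cutoff_mult: "supp_in d (1 + 2 * d) (\<lambda>t. cutoff d t * u t)"
  using supp_in_cutoff[OF d] by (simp add: supp_in_def)

lemma supp_in_inversion_cutoff:
  "supp_in (\<gamma> / (1 + 2 * d)) (\<gamma> / d) (inversion \<gamma> (\<lambda>t. cutoff d t * u t))"
  by (rule supp_in_inversion[OF \<gamma>_pos d d_le supp_in_cutoff_mult])

lemma continuous_cutoff_mult: "continuous_on UNIV u \<Longrightarrow> continuous_on UNIV (\<lambda>t. cutoff d t * u t)"
  by (rule continuous_on_mult[OF C1_continuous[OF C1_cutoff[OF d]]])

lemma C1_cutoff_mult: "C1 u \<Longrightarrow> C1 (\<lambda>t. cutoff d t * u t)"
  by (intro C1_mult C1_cutoff d)

lemma C1per_transport: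
  assumes "C1 u"
  shows "C1per (transport \<gamma> d u)"
  unfolding transport_def
  by (rule C1per_per_sum[OF C1_inversion[OF \<gamma>_pos d d_le C1_cutoff_mult[OF assms] supp_in_cutoff_mult] supp_in_inversion_cutoff])

lemma continuous_on_transport:
  assumes "continuous_on UNIV u"
  shows "continuous_on S (transport \<gamma> d u)"
  unfolding transport_def
  by (rule continuous_on_per_sum[OF continuous_on_inversion[OF \<gamma>_pos d d_le continuous_cutoff_mult[OF assms] supp_in_cutoff_mult] supp_in_inversion_cutoff])

lemma transport_periodic: "transport \<gamma> d u (x + 1) = transport \<gamma> d u x"
  unfolding transport_def by (rule per_sum_periodic)

text \<open>The lattice sum of \<open>cutoff d t * u t\<close> gives back the periodic
  \<open>u\<close>, because the translates of the cutoff sum to 1.\<close>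

lemma integral_cutoff_mult:
  assumes "continuous_on UNIV u" "\<And>x. u (x + 1) = u x"
  shows "integral {d..1 + 2 * d} (\<lambda>t. cutoff d t * u t) = integral {0..1} u"
proof -
  have "per_sum (\<lambda>t. u t * cutoff d t) s = u s" for s
    using per_sum_mult_periodic[of u "cutoff d" s] periodic_of_int[of u] assms(2) by (simp add: per_sum_cutoff[OF d])
  then have "per_sum (\<lambda>t. cutoff d t * u t) = u" by (simp add: fun_eq_iff mult.commute)
  then have "integral {0..1} u = integral {0..1} (per_sum (\<lambda>t. cutoff d t * u t))" by simp
  also have "\<dots> = integral {d..1 + 2 * d} (\<lambda>t. cutoff d t * u t)"
    by (rule integral_per_sum[OF continuous_cutoff_mult[OF assms(1)] supp_in_cutoff_mult])
  finally show ?thesis by simp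
qed

lemma integral_transport:
  assumes "continuous_on UNIV u" "\<And>x. u (x + 1) = u x"
  shows "integral {0..1} (transport \<gamma> d u) = integral {0..1} u"
  unfolding transport_def
  by (subst integral_per_sum[OF continuous_on_inversion[OF \<gamma>_pos d d_le continuous_cutoff_mult[OF assms(1)] supp_in_cutoff_mult] supp_in_inversion_cutoff])
     (simp add: integral_inversion[OF \<gamma>_pos d d_le continuous_cutoff_mult[OF assms(1)]] integral_cutoff_mult[OF assms])

lemma L1norm_transport:
  assumes u: "continuous_on UNIV u" "\<And>x. u (x + 1) = u x"
  shows "L1norm (transport \<gamma> d u) \<le> L1norm u"
proof -
  have a: "continuous_on UNIV (\<lambda>x. \<bar>u x\<bar>)" using u(1) by (intro continuous_intros)
  have "\<bar>inversion \<gamma> (\<lambda>t. cutoff d t * u t) x\<bar> = inversion \<gamma> (\<lambda>t. cutoff d t * \<bar>u t\<bar>) x" for x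
    using \<gamma>_pos cutoff_nonneg[OF d] by (simp add: inversion_def abs_mult)
  then have "L1norm (transport \<gamma> d u) \<le> integral {\<gamma> / (1 + 2 * d)..\<gamma> / d} (inversion \<gamma> (\<lambda>t. cutoff d t * \<bar>u t\<bar>))"
    unfolding transport_def
    using L1norm_per_sum[OF continuous_on_inversion[OF \<gamma>_pos d d_le continuous_cutoff_mult[OF u(1)] supp_in_cutoff_mult] supp_in_inversion_cutoff]
    by simp
  also have "\<dots> = L1norm u"
    unfolding L1norm_def integral_inversion[OF \<gamma>_pos d d_le continuous_cutoff_mult[OF a]]
    by (rule integral_cutoff_mult[OF a]) (simp add: u(2))
  finally show ?thesis .
qed

text \<open>After substitution the derivative of \<open>u\<close> carries the factor t^2 / \<gamma>,
  below 1 on the support of the cutoff. As the translates sum to 1, integrating the cutoff against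
  the modulus of that derivative yields the variation with no extra constant, so the leading factor
  stays below 1. All other terms involve \<open>u\<close> undifferentiated and are controlled by the
  L1 norm, the lattice sum of the modulus of the cutoff's derivative being bounded by
  \<open>D\<close>.\<close>

lemma variation_transport:
  obtains C where "0 \<le> C"
    "\<And>u. C1per u \<Longrightarrow> variation (transport \<gamma> d u) \<le> (1 + 2 * d)\<^sup>2 / \<gamma> * variation u + C * L1norm u"
proof -
  define b where "b = 1 + 2 * d"
  define \<theta> where "\<theta> = b\<^sup>2 / \<gamma>"
  have b0: "0 < b" using d by (simp add: b_def)
  have \<theta>0: "0 \<le> \<theta>" using \<gamma>_pos by (simp add: \<theta>_def)
  let ?w = "cutoff d"
  have cw': "continuous_on UNIV (\<lambda>x. \<bar>deriv ?w x\<bar>)" "supp_in d b (\<lambda>x. \<bar>deriv ?w x\<bar>)"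
    using supp_in_deriv[OF supp_in_cutoff[OF d]]
    by (auto intro!: continuous_intros C1_continuous_deriv C1_cutoff d simp: supp_in_def b_def)
  have "bounded (per_sum (\<lambda>x. \<bar>deriv ?w x\<bar>) ` {0..1})"
    by (intro compact_imp_bounded compact_continuous_image continuous_on_per_sum[OF cw']) simp
  then obtain D where "\<forall>y \<in> per_sum (\<lambda>x. \<bar>deriv ?w x\<bar>) ` {0..1}. norm y \<le> D"
    unfolding bounded_iff by blast
  then have D: "\<bar>per_sum (\<lambda>x. \<bar>deriv ?w x\<bar>) x\<bar> \<le> D" if "x \<in> {0..1}" for x
    using that by auto
  have D0: "0 \<le> D" using D[of 0] by (meson abs_ge_zero atLeastAtMost_iff order_refl order_trans zero_le_one)
  show thesis
  proof (rule that)
    show "0 \<le> \<theta> * D + 2 * b / \<gamma>" using \<theta>0 D0 b0 \<gamma>_pos by simp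
    fix u assume u: "C1per u"
    have C: "C1 u" and p: "\<And>x. u (x + 1) = u x" by (rule C1perD[OF u])+
    have cu: "continuous_on UNIV u" "continuous_on UNIV (deriv u)" by (rule C1_continuous[OF C], rule C1_continuous_deriv[OF C])
    have cau: "continuous_on UNIV (\<lambda>x. \<bar>u x\<bar>)" "continuous_on UNIV (\<lambda>x. \<bar>deriv u x\<bar>)" using cu by (auto intro!: continuous_intros)
    define h where "h t = ?w t * u t" for t
    have h: "C1 h" "supp_in d b h" unfolding h_def[abs_def] b_def by (rule C1_cutoff_mult[OF C], rule supp_in_cutoff_mult)
    have dh: "deriv h = (\<lambda>t. deriv ?w t * u t + deriv u t * ?w t)"
      unfolding h_def[abs_def] by (rule deriv_C1_mult[OF C1_cutoff[OF d] C])
    let ?k = "\<lambda>t. - (deriv h t * (t\<^sup>2 / \<gamma>) + 2 * h t * (t / \<gamma>))"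
    have ch: "continuous_on UNIV h" "continuous_on UNIV (deriv h)" by (rule C1_continuous[OF h(1)], rule C1_continuous_deriv[OF h(1)])
    have ck: "continuous_on UNIV (\<lambda>t. \<bar>?k t\<bar>)" using \<gamma>_pos by (intro continuous_intros ch) auto
    have db: "d \<le> b" using d by (simp add: b_def)
    have wu: "continuous_on S (\<lambda>t. ?w t * \<bar>deriv u t\<bar>)" "continuous_on S (\<lambda>t. ?w t * \<bar>u t\<bar>)" "continuous_on S (\<lambda>t. \<bar>u t\<bar> * \<bar>deriv ?w t\<bar>)" for S
      using continuous_cutoff_mult[OF cau(2)] continuous_cutoff_mult[OF cau(1)] continuous_on_mult[OF cau(1) cw'(1)]
      by (auto intro: continuous_on_subset)
    have "variation (transport \<gamma> d u) \<le> integral {\<gamma> / b..\<gamma> / d} (\<lambda>x. \<bar>deriv (inversion \<gamma> h) x\<bar>)"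
      unfolding transport_def h_def[abs_def, symmetric]
      by (rule variation_per_sum[OF C1_inversion[OF \<gamma>_pos d db h] supp_in_inversion[OF \<gamma>_pos d db h(2)]])
    also have "\<dots> = integral {\<gamma> / b..\<gamma> / d} (inversion \<gamma> (\<lambda>t. \<bar>?k t\<bar>))"
      unfolding deriv_inversion[OF \<gamma>_pos d db h] using \<gamma>_pos
      by (intro integral_cong) (simp add: inversion_def abs_mult)
    also have "\<dots> = integral {d..b} (\<lambda>t. \<bar>?k t\<bar>)" by (rule integral_inversion[OF \<gamma>_pos d db ck])
    also have "\<dots> \<le> integral {d..b} (\<lambda>t. \<theta> * (?w t * \<bar>deriv u t\<bar>) + (\<theta> * (\<bar>u t\<bar> * \<bar>deriv ?w t\<bar>) + 2 * b / \<gamma> * (?w t * \<bar>u t\<bar>)))"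
    proof (rule integral_le)
      show "(\<lambda>t. \<bar>?k t\<bar>) integrable_on {d..b}" by (intro integrable_continuous_interval continuous_on_subset[OF ck]) simp
      show "(\<lambda>t. \<theta> * (?w t * \<bar>deriv u t\<bar>) + (\<theta> * (\<bar>u t\<bar> * \<bar>deriv ?w t\<bar>) + 2 * b / \<gamma> * (?w t * \<bar>u t\<bar>))) integrable_on {d..b}"
        by (intro integrable_continuous_interval continuous_on_add continuous_on_mult continuous_on_const wu)
      fix t assume t: "t \<in> {d..b}"
      have w0: "0 \<le> ?w t" by (rule cutoff_nonneg[OF d])
      have "\<bar>deriv h t\<bar> \<le> \<bar>u t\<bar> * \<bar>deriv ?w t\<bar> + ?w t * \<bar>deriv u t\<bar>"
        unfolding dh using abs_triangle_ineq[of "deriv ?w t * u t" "deriv u t * ?w t"] w0 by (simp add: abs_mult mult.commute)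
      moreover have "t\<^sup>2 / \<gamma> \<le> \<theta>" unfolding \<theta>_def using t d \<gamma>_pos by (intro divide_right_mono power_mono) auto
      ultimately have 1: "\<bar>deriv h t\<bar> * (t\<^sup>2 / \<gamma>) \<le> (\<bar>u t\<bar> * \<bar>deriv ?w t\<bar> + ?w t * \<bar>deriv u t\<bar>) * \<theta>"
        using w0 \<gamma>_pos by (intro mult_mono) auto
      have 2: "\<bar>h t\<bar> * (t / \<gamma>) \<le> (?w t * \<bar>u t\<bar>) * (b / \<gamma>)"
        unfolding h_def abs_mult using t d \<gamma>_pos w0 by (intro mult_mono divide_right_mono) auto
      have "\<bar>?k t\<bar> \<le> \<bar>deriv h t * (t\<^sup>2 / \<gamma>)\<bar> + \<bar>2 * h t * (t / \<gamma>)\<bar>"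
        unfolding abs_minus_cancel by (rule abs_triangle_ineq)
      also have "\<dots> = \<bar>deriv h t\<bar> * (t\<^sup>2 / \<gamma>) + 2 * (\<bar>h t\<bar> * (t / \<gamma>))"
        using t d \<gamma>_pos by (simp add: abs_mult)
      finally have k: "\<bar>?k t\<bar> \<le> \<bar>deriv h t\<bar> * (t\<^sup>2 / \<gamma>) + 2 * (\<bar>h t\<bar> * (t / \<gamma>))" .
      show "\<bar>?k t\<bar> \<le> \<theta> * (?w t * \<bar>deriv u t\<bar>) + (\<theta> * (\<bar>u t\<bar> * \<bar>deriv ?w t\<bar>) + 2 * b / \<gamma> * (?w t * \<bar>u t\<bar>))"
      proof -
        have eq: "\<theta> * X + (\<theta> * Y + 2 * b / \<gamma> * Z) = (Y + X) * \<theta> + 2 * (Z * (b / \<gamma>))" for X Y Z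
          by (simp add: algebra_simps)
        show ?thesis unfolding eq using k 1 2 by linarith
      qed
    qed
    also have "\<dots> = \<theta> * integral {d..b} (\<lambda>t. ?w t * \<bar>deriv u t\<bar>) + (\<theta> * integral {d..b} (\<lambda>t. \<bar>u t\<bar> * \<bar>deriv ?w t\<bar>) + 2 * b / \<gamma> * integral {d..b} (\<lambda>t. ?w t * \<bar>u t\<bar>))"
      by (subst integral_add integral_mult_right; (intro integrable_continuous_interval continuous_on_add continuous_on_mult continuous_on_const wu)?)+ simp
    also have "integral {d..b} (\<lambda>t. ?w t * \<bar>deriv u t\<bar>) = variation u"
      unfolding variation_def b_def by (rule integral_cutoff_mult[OF cau(2)]) (simp add: deriv_C1per[OF u])
    also have "integral {d..b} (\<lambda>t. ?w t * \<bar>u t\<bar>) = L1norm u"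
      unfolding L1norm_def b_def by (rule integral_cutoff_mult[OF cau(1)]) (simp add: p)
    also have "integral {d..b} (\<lambda>t. \<bar>u t\<bar> * \<bar>deriv ?w t\<bar>) = integral {0..1} (per_sum (\<lambda>t. \<bar>u t\<bar> * \<bar>deriv ?w t\<bar>))"
      using wu(3)[of UNIV] cw'(2) by (intro integral_per_sum[symmetric]) (auto simp: supp_in_def)
    finally have *: "variation (transport \<gamma> d u) \<le> \<theta> * variation u + (\<theta> * integral {0..1} (per_sum (\<lambda>t. \<bar>u t\<bar> * \<bar>deriv ?w t\<bar>)) + 2 * b / \<gamma> * L1norm u)" .
    have ps: "per_sum (\<lambda>t. \<bar>u t\<bar> * \<bar>deriv ?w t\<bar>) s = \<bar>u s\<bar> * per_sum (\<lambda>t. \<bar>deriv ?w t\<bar>) s" for s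
      by (rule per_sum_mult_periodic) (simp add: periodic_of_int[of u, OF p])
    have "integral {0..1} (per_sum (\<lambda>t. \<bar>u t\<bar> * \<bar>deriv ?w t\<bar>)) \<le> integral {0..1} (\<lambda>s. D * \<bar>u s\<bar>)"
    proof (rule integral_le)
      show "per_sum (\<lambda>t. \<bar>u t\<bar> * \<bar>deriv ?w t\<bar>) integrable_on {0..1}"
        unfolding ps[abs_def]
        by (intro integrable_continuous_interval continuous_on_mult continuous_on_per_sum[OF cw'] continuous_on_subset[OF cau(1)]) simp
      show "(\<lambda>s. D * \<bar>u s\<bar>) integrable_on {0..1}"
        by (intro integrable_continuous_interval continuous_on_mult continuous_on_const continuous_on_subset[OF cau(1)]) simp
      show "per_sum (\<lambda>t. \<bar>u t\<bar> * \<bar>deriv ?w t\<bar>) s \<le> D * \<bar>u s\<bar>" if "s \<in> {0..1}" for s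
        unfolding ps using D[OF that] mult_left_mono[of "per_sum (\<lambda>t. \<bar>deriv ?w t\<bar>) s" D "\<bar>u s\<bar>"] by (simp add: mult.commute)
    qed
    also have "\<dots> = D * L1norm u" by (simp add: L1norm_def)
    finally have "\<theta> * integral {0..1} (per_sum (\<lambda>t. \<bar>u t\<bar> * \<bar>deriv ?w t\<bar>)) \<le> \<theta> * (D * L1norm u)"
      using \<theta>0 by (rule mult_left_mono)
    then show "variation (transport \<gamma> d u) \<le> (1 + 2 * d)\<^sup>2 / \<gamma> * variation u + (\<theta> * D + 2 * b / \<gamma>) * L1norm u"
      using * unfolding \<theta>_def[symmetric] b_def[symmetric] by (simp add: distrib_right mult.assoc)
  qed
qed

end

section \<open>Approximation by operators of finite rank\<close>

text \<open>A difference of neighbouring steps at scale 1 / N, supported on [c / N, (c + 2) / N].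
  Summation over c telescopes, which makes these the pieces of a partition of unity.\<close>

definition bump :: "nat \<Rightarrow> real \<Rightarrow> real \<Rightarrow> real" where
  "bump N c x = smooth_step (real N * x - c) - smooth_step (real N * x - c - 1)"

definition hat :: "nat \<Rightarrow> nat \<Rightarrow> real \<Rightarrow> real" where
  "hat N i = per_sum (bump N (real i))"

text \<open>A quasi-interpolation of finite rank: it sees \<open>u\<close> only through
  \<open>N\<close> point values, and these values become the finitely many obstructions later
  on.\<close>

definition interp :: "nat \<Rightarrow> (real \<Rightarrow> real) \<Rightarrow> real \<Rightarrow> real" where
  "interp N u x = (\<Sum>i<N. u (real i / real N) * hat N i x)"

text \<open>One-sided because the support of each bump lies to the right of the node i / N at which
  \<open>u\<close> is sampled: from a point x of that support the node is found by looking
  left.\<close>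

definition window :: "real \<Rightarrow> (real \<Rightarrow> real) \<Rightarrow> real \<Rightarrow> real" where
  "window \<delta> u x = integral {- \<delta>..0} (\<lambda>z. \<bar>deriv u (x + z)\<bar>)"

lemma integral_periodic_shift:
  fixes \<phi> :: "real \<Rightarrow> real"
  assumes c: "continuous_on UNIV \<phi>" and p: "\<And>x. \<phi> (x + 1) = \<phi> x" and z: "- 1 \<le> z" "z \<le> 0"
  shows "integral {0..1} (\<lambda>x. \<phi> (x + z)) = integral {0..1} \<phi>"
proof -
  have i: "\<phi> integrable_on {s..t}" for s t
    by (intro integrable_continuous_interval continuous_on_subset[OF c]) simp
  have "integral {0..1} (\<lambda>x. \<phi> (x + z)) = integral {z..1 + z} \<phi>"
    using integral_shift_Icc_real[of 0 1 \<phi> z] by (simp add: o_def add.commute)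
  also have "\<dots> = integral {z..0} \<phi> + integral {0..1 + z} \<phi>"
    using z i by (intro Henstock_Kurzweil_Integration.integral_combine[symmetric]) auto
  also have "integral {z..0} \<phi> = integral {z + 1..0 + 1} \<phi>"
    using integral_shift_Icc_real[of z 0 \<phi> 1] p by (simp add: o_def add.commute)
  also have "integral {z + 1..0 + 1} \<phi> + integral {0..1 + z} \<phi> = integral {0..1} \<phi>"
    using z i Henstock_Kurzweil_Integration.integral_combine[of 0 "1 + z" 1 \<phi>] by (simp add: add.commute)
  finally show ?thesis .
qed

lemma per_sum_sum:
  fixes g :: "'i \<Rightarrow> real \<Rightarrow> real"
  assumes "\<And>i. i \<in> I \<Longrightarrow> supp_in a b (g i)"
  shows "per_sum (\<lambda>x. \<Sum>i\<in>I. g i x) s = (\<Sum>i\<in>I. per_sum (g i) s)"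
proof -
  obtain M where M: "\<bar>s\<bar> + \<bar>a\<bar> + \<bar>b\<bar> \<le> real M" using real_arch_simple by blast
  have "supp_in a b (\<lambda>x. \<Sum>i\<in>I. g i x)"
    using assms by (auto simp: supp_in_def intro!: sum.neutral)
  then have "per_sum (\<lambda>x. \<Sum>i\<in>I. g i x) s = (\<Sum>n<2 * M + 1. \<Sum>i\<in>I. g i (s + real n - real M))"
    by (rule per_sum_eq[OF _ M])
  also have "\<dots> = (\<Sum>i\<in>I. per_sum (g i) s)"
    by (subst sum.swap) (intro sum.cong refl per_sum_eq[OF assms M, symmetric])
  finally show ?thesis .
qed

lemma window_periodic: "C1per u \<Longrightarrow> window \<delta> u (x + 1) = window \<delta> u x"
  using deriv_C1per[of u] unfolding window_def by (metis (no_types, lifting) add.assoc add.commute)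

context
  fixes u :: "real \<Rightarrow> real"
  assumes u: "C1per u"
begin

lemma continuous_deriv_shift: "continuous_on S (\<lambda>(x, z). \<bar>deriv u (x + z)\<bar>)"
proof -
  have "continuous_on S (\<lambda>p. \<bar>deriv u (fst p + snd p)\<bar>)"
    by (intro continuous_intros continuous_on_compose2[OF C1_continuous_deriv[OF C1perD(1)[OF u], of UNIV]]) auto
  then show ?thesis by (simp add: case_prod_unfold)
qed

lemma continuous_on_window: "continuous_on {0..1} (window \<delta> u)"
proof -
  have "continuous_on {0..1} (\<lambda>x. integral (cbox (- \<delta>) 0) (\<lambda>z. \<bar>deriv u (x + z)\<bar>))"
    by (rule integral_continuous_on_param) (rule continuous_deriv_shift)
  then show ?thesis by (simp add: window_def[abs_def])
qed

text \<open>After exchanging the integrals, each shift \<open>z\<close> contributes one full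
  variation by periodicity. With \<delta> = 2 / N this is the source of the factor 1 / N in the
  interpolation error.\<close>

lemma integral_window:
  assumes "0 \<le> \<delta>" "\<delta> \<le> 1"
  shows "integral {0..1} (window \<delta> u) = \<delta> * variation u"
proof -
  have "integral {0..1} (window \<delta> u) = integral {- \<delta>..0} (\<lambda>z. integral {0..1} (\<lambda>x. \<bar>deriv u (x + z)\<bar>))"
    using integral_swap_continuous[of 0 "- \<delta>" 1 0 "\<lambda>x z. \<bar>deriv u (x + z)\<bar>"] continuous_deriv_shift
    by (simp add: window_def[abs_def])
  also have "\<dots> = integral {- \<delta>..0} (\<lambda>z. variation u)"
  proof (rule integral_cong)
    fix z assume z: "z \<in> {- \<delta>..0}"
    show "integral {0..1} (\<lambda>x. \<bar>deriv u (x + z)\<bar>) = variation u"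
      unfolding variation_def
      by (rule integral_periodic_shift)
         (use z assms deriv_C1per[OF u] in \<open>auto intro!: continuous_intros C1_continuous_deriv C1perD(1)[OF u]\<close>)
  qed
  also have "\<dots> = \<delta> * variation u" using assms by simp
  finally show ?thesis .
qed

lemma window_bound:
  assumes "x - \<delta> \<le> y" "y \<le> x"
  shows "\<bar>u y - u x\<bar> \<le> window \<delta> u x"
proof -
  have C: "C1 u" by (rule C1perD[OF u])
  have "\<bar>u x - u y\<bar> \<le> integral {y..x} (\<lambda>t. \<bar>deriv u t\<bar>)"
    by (rule C1_diff_le_integral_deriv[OF C assms(2)])
  also have "\<dots> \<le> integral {- \<delta> + x..0 + x} (\<lambda>t. \<bar>deriv u t\<bar>)"
    using assms by (intro integral_subset_le integrable_continuous_interval continuous_intros C1_continuous_deriv C) auto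
  also have "\<dots> = window \<delta> u x"
    unfolding integral_shift_Icc_real[symmetric] window_def by (simp add: o_def)
  finally show ?thesis by (simp add: abs_minus_commute)
qed

end

context
  fixes N :: nat
  assumes N: "2 \<le> N"
begin

lemma C1_bump: "C1 (bump N c)"
  and deriv_bump: "deriv (bump N c) = (\<lambda>x. real N * deriv smooth_step (real N * x - c) - real N * deriv smooth_step (real N * x - c - 1))"
proof -
  have 1: "C1 (\<lambda>x. smooth_step (real N * x + (- c)))" "C1 (\<lambda>x. smooth_step (real N * x + (- c - 1)))"
    by (rule C1_affine[OF C1_smooth_step])+
  have eq: "bump N c = (\<lambda>x. smooth_step (real N * x + (- c)) - smooth_step (real N * x + (- c - 1)))"
    by (simp add: bump_def[abs_def] add_diff_eq)
  show "C1 (bump N c)" unfolding eq by (rule C1_diff[OF 1])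
  show "deriv (bump N c) = (\<lambda>x. real N * deriv smooth_step (real N * x - c) - real N * deriv smooth_step (real N * x - c - 1))"
    unfolding eq deriv_C1_diff[OF 1] deriv_C1_affine[OF C1_smooth_step] by (simp add: add_diff_eq)
qed

lemma bump_nonneg: "0 \<le> bump N c x"
  unfolding bump_def by (simp add: smooth_step_mono)

lemma bump_outside: "real N * x < c \<or> c + 2 < real N * x \<Longrightarrow> bump N c x = 0"
  unfolding bump_def by (auto simp: smooth_step_0 smooth_step_1)

lemma supp_in_bump: "supp_in (c / real N) ((c + 2) / real N) (bump N c)"
  unfolding supp_in_def using N
  by (auto intro!: bump_outside simp: pos_less_divide_eq pos_divide_less_eq mult.commute)

lemma supp_in_bump': "i < N \<Longrightarrow> supp_in (- \<bar>c\<bar>) (\<bar>c\<bar> + 2) (bump N (real i + c))"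
  unfolding supp_in_def
proof (intro allI impI bump_outside)
  fix x assume i: "i < N" and x: "x < - \<bar>c\<bar> \<or> \<bar>c\<bar> + 2 < x"
  have c: "\<bar>c\<bar> \<le> real N * \<bar>c\<bar>" using N by (simp add: mult_le_cancel_right1)
  from x show "real N * x < real i + c \<or> real i + c + 2 < real N * x"
  proof
    assume "x < - \<bar>c\<bar>"
    then have "real N * x < real N * (- \<bar>c\<bar>)" using N by (intro mult_strict_left_mono) auto
    then show ?thesis using c by linarith
  next
    assume "\<bar>c\<bar> + 2 < x"
    then have "real N * (\<bar>c\<bar> + 2) < real N * x" using N by (intro mult_strict_left_mono) auto
    then have "\<bar>c\<bar> + 2 * real N < real N * x" using c by (simp add: distrib_left)
    then show ?thesis using i N by linarith
  qed
qed

text \<open>Two telescopings: the sum over \<open>i\<close> leaves a step minus its unit translate,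
  and the lattice sum of that is 1. The offset \<open>c\<close> is kept general because neighbouring
  bumps are needed to dominate a derivative.\<close>

lemma sum_per_sum_bump: "(\<Sum>i<N. per_sum (bump N (real i + c)) s) = 1"
proof -
  have "(\<Sum>i<N. bump N (real i + c) x) = smooth_step (real N * x - c) - smooth_step (real N * (x - 1) - c)" for x
  proof -
    have "(\<Sum>i<N. bump N (real i + c) x) = (\<Sum>i<N. smooth_step (real N * x - c - real i) - smooth_step (real N * x - c - real (Suc i)))"
      by (intro sum.cong) (auto simp: bump_def algebra_simps)
    also have "\<dots> = smooth_step (real N * x - c) - smooth_step (real N * x - c - real N)"
      by (subst sum_lessThan_telescope') simp
    finally show ?thesis by (simp add: algebra_simps)
  qed
  moreover have "(\<Sum>i<N. per_sum (bump N (real i + c)) s) = per_sum (\<lambda>x. \<Sum>i<N. bump N (real i + c) x) s"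
    by (rule per_sum_sum[symmetric, of _ "- \<bar>c\<bar>" "\<bar>c\<bar> + 2"]) (use supp_in_bump' in simp)
  moreover have "per_sum (\<lambda>x. smooth_step (real N * x - c) - smooth_step (real N * (x - 1) - c)) s = 1"
    using N by (intro per_sum_telescope[where a = "c / real N" and b = "(c + 1) / real N" and S = "\<lambda>x. smooth_step (real N * x - c)"])
       (auto intro!: smooth_step_0 smooth_step_1 simp: pos_le_divide_eq pos_divide_le_eq mult.commute)
  ultimately show ?thesis by simp
qed

lemma sum_hat: "(\<Sum>i<N. hat N i s) = 1"
  using sum_per_sum_bump[of 0 s] by (simp add: hat_def)

lemma C1per_hat: "C1per (hat N i)"
  unfolding hat_def by (rule C1per_per_sum[OF C1_bump supp_in_bump])

lemma deriv_hat: "deriv (hat N i) = per_sum (deriv (bump N (real i)))"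
  unfolding hat_def by (rule C1_per_sum(2)[OF C1_bump supp_in_bump])

lemma sum_deriv_hat: "(\<Sum>i<N. deriv (hat N i) s) = 0"
proof -
  have "deriv (\<lambda>x. \<Sum>i<N. hat N i x) = (\<lambda>x. \<Sum>i<N. deriv (hat N i) x)"
    using C1_sum[of "{..<N}" "hat N"] C1per_hat C1perD(1) by blast
  moreover have "(\<lambda>x. \<Sum>i<N. hat N i x) = (\<lambda>_. 1)" using sum_hat by auto
  ultimately show ?thesis using deriv_C1_const[of 1] by metis
qed

lemma C1per_interp: "C1per (interp N u)"
  unfolding interp_def[abs_def] by (intro C1per_sum C1per_cmult[OF C1per_hat C1per_hat])

lemma deriv_interp: "deriv (interp N u) s = (\<Sum>i<N. u (real i / real N) * deriv (hat N i) s)"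
proof -
  have h: "C1 (hat N i)" for i by (rule C1perD[OF C1per_hat])
  have "deriv (\<lambda>x. \<Sum>i<N. u (real i / real N) * hat N i x) = (\<lambda>x. \<Sum>i<N. deriv (\<lambda>x. u (real i / real N) * hat N i x) x)"
    using C1_sum[of "{..<N}" "\<lambda>i x. u (real i / real N) * hat N i x"] C1_cmult[OF h] by blast
  then show ?thesis unfolding interp_def[abs_def] deriv_C1_cmult[OF h] by simp
qed

text \<open>Expanding \<open>u x\<close> in the partition of unity \<open>hat N i\<close> turns both the interpolation error and
  its derivative into sums of differences \<open>u (i / N) - u y\<close> over \<open>y\<close> near \<open>i / N\<close>.\<close>

lemma sum_local_difference_le:
  assumes u: "C1per u" and g: "\<And>i. i < N \<Longrightarrow> supp_in (- 3) 3 (g i)" "\<And>i. i < N \<Longrightarrow> supp_in (- 3) 3 (k i)"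
    and gk: "\<And>i y. i < N \<Longrightarrow> \<bar>g i y\<bar> \<le> k i y"
    and loc: "\<And>i y. i < N \<Longrightarrow> g i y \<noteq> 0 \<Longrightarrow> real i \<le> real N * y \<and> real N * y \<le> real i + 2"
  shows "\<bar>\<Sum>i<N. (u (real i / real N) - u x) * per_sum (g i) x\<bar> \<le> window (2 / real N) u x * (\<Sum>i<N. per_sum (k i) x)"
proof -
  let ?I = "window (2 / real N) u"
  have "\<bar>(u (real i / real N) - u x) * per_sum (g i) x\<bar> \<le> ?I x * per_sum (k i) x" if i: "i < N" for i
  proof -
    have "(u (real i / real N) - u x) * per_sum (g i) x = per_sum (\<lambda>y. (u (real i / real N) - u y) * g i y) x"
      by (rule per_sum_mult_periodic[symmetric]) (simp add: periodic_of_int C1perD(2)[OF u])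
    also have "\<bar>\<dots>\<bar> \<le> per_sum (\<lambda>y. ?I y * k i y) x"
    proof (rule per_sum_abs_le)
      show "supp_in (- 3) 3 (\<lambda>y. ?I y * k i y)" using g(2)[OF i] by (simp add: supp_in_def)
      show "\<bar>(u (real i / real N) - u y) * g i y\<bar> \<le> ?I y * k i y" for y
      proof (cases "g i y = 0")
        case False
        have "real i / real N \<le> y" "y - 2 / real N \<le> real i / real N"
        proof -
          have "y \<le> (real i + 2) / real N" "real i / real N \<le> y"
            using loc[OF i False] N by (auto simp: pos_le_divide_eq pos_divide_le_eq mult.commute)
          then show "real i / real N \<le> y" "y - 2 / real N \<le> real i / real N"
            by (simp_all add: add_divide_distrib)
        qed
        then have "\<bar>u (real i / real N) - u y\<bar> \<le> ?I y" by (intro window_bound[OF u])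
        then show ?thesis unfolding abs_mult using gk[OF i, of y] by (intro mult_mono) auto
      next
        case True
        have "0 \<le> ?I y" using window_bound[OF u, of y "2 / real N" y] by simp
        then show ?thesis using True gk[OF i, of y] by simp
      qed
    qed
    also have "\<dots> = ?I x * per_sum (k i) x"
      by (rule per_sum_mult_periodic) (simp add: periodic_of_int window_periodic[OF u])
    finally show ?thesis .
  qed
  then have "(\<Sum>i<N. \<bar>(u (real i / real N) - u x) * per_sum (g i) x\<bar>) \<le> (\<Sum>i<N. ?I x * per_sum (k i) x)"
    by (intro sum_mono) simp
  from order_trans[OF sum_abs this] show ?thesis by (simp only: sum_distrib_left)
qed

lemma interp_error_le:
  assumes u: "C1per u"
  shows "\<bar>u x - interp N u x\<bar> \<le> window (2 / real N) u x"
proof -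
  have "interp N u x - u x = (\<Sum>i<N. (u (real i / real N) - u x) * per_sum (bump N (real i)) x)"
    using sum_hat[of x] by (simp add: interp_def hat_def[symmetric] left_diff_distrib sum_subtractf sum_distrib_left[symmetric])
  also have "\<bar>\<dots>\<bar> \<le> window (2 / real N) u x * (\<Sum>i<N. per_sum (bump N (real i)) x)"
  proof (rule sum_local_difference_le[OF u])
    show "supp_in (- 3) 3 (bump N (real i))" if "i < N" for i
      using supp_in_mono[OF supp_in_bump'[OF that, of 0]] by simp
    then show "supp_in (- 3) 3 (bump N (real i))" if "i < N" for i using that by simp
    show "real i \<le> real N * y \<and> real N * y \<le> real i + 2" if "bump N (real i) y \<noteq> 0" for i y
      using bump_outside[of y "real i"] that by fastforce
  qed (use bump_nonneg in simp)
  also have "(\<Sum>i<N. per_sum (bump N (real i)) x) = 1" using sum_hat[of x] by (simp add: hat_def)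
  finally show ?thesis by (simp add: abs_minus_commute)
qed

text \<open>The derivative of a bump is at most 2 N in modulus and lives where the sum of the bump
  and its two neighbours equals 1. Replacing it by 2 N times that sum makes the partition of unity
  applicable three times, whence 6 N.\<close>

lemma deriv_interp_le:
  assumes u: "C1per u"
  shows "\<bar>deriv (interp N u) x\<bar> \<le> 6 * real N * window (2 / real N) u x"
proof -
  define k where "k i y = 2 * real N * (bump N (real i + - 1) y + bump N (real i + 0) y + bump N (real i + 1) y)" for i y
  have "deriv (interp N u) x = (\<Sum>i<N. (u (real i / real N) - u x) * per_sum (deriv (bump N (real i))) x)"
    using sum_deriv_hat[of x] by (simp add: deriv_interp deriv_hat[symmetric] left_diff_distrib sum_subtractf sum_distrib_left[symmetric])
  also have "\<bar>\<dots>\<bar> \<le> window (2 / real N) u x * (\<Sum>i<N. per_sum (k i) x)"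
  proof (rule sum_local_difference_le[OF u])
    show "supp_in (- 3) 3 (deriv (bump N (real i)))" if "i < N" for i
      using supp_in_mono[OF supp_in_deriv[OF supp_in_bump'[OF that, of 0]]] by simp
    show "supp_in (- 3) 3 (k i)" if "i < N" for i
      using supp_in_mono[OF supp_in_bump'[OF that, of "- 1"], of "- 3" 3]
        supp_in_mono[OF supp_in_bump'[OF that, of 0], of "- 3" 3] supp_in_mono[OF supp_in_bump'[OF that, of 1], of "- 3" 3]
      by (simp add: supp_in_def k_def)
    show loc: "real i \<le> real N * y \<and> real N * y \<le> real i + 2" if "deriv (bump N (real i)) y \<noteq> 0" for i y
    proof (rule ccontr)
      assume "\<not> ?thesis"
      then show False using that unfolding deriv_bump deriv_smooth_step by (auto simp: max_def not_le)
    qed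
    show "\<bar>deriv (bump N (real i)) y\<bar> \<le> k i y" for i y
    proof (cases "deriv (bump N (real i)) y = 0")
      case True
      then show ?thesis by (simp add: k_def bump_nonneg)
    next
      case False
      from loc[OF this] have "k i y = 2 * real N"
        by (simp add: k_def bump_def algebra_simps smooth_step_0 smooth_step_1)
      moreover have "\<bar>deriv (bump N (real i)) y\<bar> \<le> 2 * real N"
      proof -
        have "\<bar>p - q\<bar> \<le> 2" if "0 \<le> p" "p \<le> 2" "0 \<le> q" "q \<le> 2" for p q :: real using that by linarith
        from mult_left_mono[OF this[OF deriv_smooth_step_bounds deriv_smooth_step_bounds], of "real N"]
        show ?thesis unfolding deriv_bump right_diff_distrib[symmetric] abs_mult by (simp add: mult.commute)
      qed
      ultimately show ?thesis by simp
    qed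
  qed
  also have "(\<Sum>i<N. per_sum (k i) x) = 6 * real N"
  proof -
    have "per_sum (k i) x = 2 * real N * (per_sum (bump N (real i + - 1)) x + per_sum (bump N (real i + 0)) x + per_sum (bump N (real i + 1)) x)"
      if i: "i < N" for i
    proof -
      note s = supp_in_bump'[OF i]
      have 2: "supp_in (- 3) 3 (\<lambda>y. bump N (real i + - 1) y + bump N (real i + 0) y)"
        using supp_in_mono[OF s[of "- 1"], of "- 3" 3] supp_in_mono[OF s[of 0], of "- 3" 3] by (simp add: supp_in_def)
      show ?thesis
        unfolding k_def[abs_def]
        by (simp only: per_sum_mult_periodic[of "\<lambda>_. 2 * real N"] per_sum_diff(2)[OF 2 s[of 1]] per_sum_diff(2)[OF s[of "- 1"] s[of 0]])
    qed
    then have "(\<Sum>i<N. per_sum (k i) x) = 2 * real N * ((\<Sum>i<N. per_sum (bump N (real i + - 1)) x) + (\<Sum>i<N. per_sum (bump N (real i + 0)) x) + (\<Sum>i<N. per_sum (bump N (real i + 1)) x))"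
      by (simp only: sum.distrib[symmetric] sum_distrib_left) (intro sum.cong, auto)
    then show ?thesis unfolding sum_per_sum_bump by simp
  qed
  finally show ?thesis by (simp add: mult_ac)
qed

text \<open>Integrating the pointwise bounds, where the window has integral 2 / N times the
  variation. The L1 error becomes small with N, whereas the variation is only kept bounded, 12 being
  6 N times 2 / N.\<close>

lemma
  assumes u: "C1per u"
  shows L1norm_interp_error: "L1norm (\<lambda>x. u x - interp N u x) \<le> 2 / real N * variation u"
    and variation_interp: "variation (interp N u) \<le> 12 * variation u"
proof -
  have \<delta>: "0 \<le> 2 / real N" "2 / real N \<le> 1" using N by auto
  have C: "C1 u" "C1 (interp N u)" by (rule C1perD[OF u], rule C1perD[OF C1per_interp])
  note cw = continuous_on_window[OF u, of "2 / real N"]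
  have "L1norm (\<lambda>x. u x - interp N u x) \<le> integral {0..1} (window (2 / real N) u)"
    unfolding L1norm_def
    by (intro integral_le integrable_continuous_interval continuous_on_rabs continuous_on_diff C1_continuous C cw interp_error_le[OF u])
  then show "L1norm (\<lambda>x. u x - interp N u x) \<le> 2 / real N * variation u"
    unfolding integral_window[OF u \<delta>] .
  have "variation (interp N u) \<le> integral {0..1} (\<lambda>x. 6 * real N * window (2 / real N) u x)"
    unfolding variation_def
    by (intro integral_le integrable_continuous_interval continuous_on_rabs continuous_on_mult continuous_on_const C1_continuous_deriv C cw deriv_interp_le[OF u])
  also have "\<dots> = 12 * variation u"
    using N by (simp add: integral_window[OF u \<delta>])
  finally show "variation (interp N u) \<le> 12 * variation u" .
qed

end

text \<open>Linearity together with sequential continuity for pointwise convergence on the space of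
  all functions. Operators that are at each point a finite combination of point evaluations have
  this property, and it suffices to pass to the limit in a Neumann series.\<close>

definition pw_linear :: "((real \<Rightarrow> real) \<Rightarrow> real \<Rightarrow> real) \<Rightarrow> bool" where
  "pw_linear T \<longleftrightarrow>
     (\<forall>u v. T (\<lambda>x. u x + v x) = (\<lambda>x. T u x + T v x)) \<and>
     (\<forall>c u. T (\<lambda>x. c * u x) = (\<lambda>x. c * T u x)) \<and>
     (\<forall>us u. (\<forall>x. (\<lambda>k. us k x) \<longlonglongrightarrow> u x) \<longrightarrow> (\<forall>x. (\<lambda>k. T (us k) x) \<longlonglongrightarrow> T u x))"

lemma pw_linearD:
  assumes "pw_linear T"
  shows "T (\<lambda>x. u x + v x) = (\<lambda>x. T u x + T v x)"
    and "T (\<lambda>x. c * u x) = (\<lambda>x. c * T u x)"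
    and "(\<And>x. (\<lambda>k. us k x) \<longlonglongrightarrow> u x) \<Longrightarrow> (\<lambda>k. T (us k) x) \<longlonglongrightarrow> T u x"
  using assms unfolding pw_linear_def by blast+

lemma pw_linear_diff:
  assumes "pw_linear T"
  shows "T (\<lambda>x. u x - v x) = (\<lambda>x. T u x - T v x)"
  using pw_linearD(1)[OF assms, of u "\<lambda>x. - 1 * v x"] pw_linearD(2)[OF assms, of "- 1" v] by simp

lemma pw_linear_sum:
  fixes I :: "nat set"
  assumes "pw_linear T" "finite I"
  shows "T (\<lambda>x. \<Sum>i\<in>I. u i x) = (\<lambda>x. \<Sum>i\<in>I. T (u i) x)"
  using assms(2)
proof (induction I rule: finite_induct)
  case empty
  show ?case using pw_linearD(2)[OF assms(1), of 0 "\<lambda>_. 0"] by simp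
next
  case (insert i I)
  then show ?case using pw_linearD(1)[OF assms(1), of "u i" "\<lambda>x. \<Sum>i\<in>I. u i x"] by simp
qed

lemma pw_linear_compose: "pw_linear S \<Longrightarrow> pw_linear T \<Longrightarrow> pw_linear (\<lambda>u. S (T u))"
  unfolding pw_linear_def by (intro conjI allI impI) simp_all

lemma pw_linear_funpow: "pw_linear T \<Longrightarrow> pw_linear (T ^^ n)"
proof (induction n)
  case (Suc n)
  then show ?case using pw_linear_compose[of T "T ^^ n"] by (simp add: o_def[abs_def])
qed (simp add: pw_linear_def)

lemma pw_linear_interp: "pw_linear (interp N)"
  unfolding pw_linear_def interp_def[abs_def]
  by (auto simp: distrib_right sum.distrib sum_distrib_left mult.assoc intro!: tendsto_intros)

text \<open>By \<open>abs_le_variation_mean\<close> this dominates the supremum of a continuously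
  differentiable periodic function.\<close>

definition sup_norm_bound :: "(real \<Rightarrow> real) \<Rightarrow> real" where
  "sup_norm_bound u = variation u + \<bar>integral {0..1} u\<bar>"

section \<open>Inverting 1 - T^n up to an operator of finite rank\<close>

context
  fixes \<gamma> d :: real
  assumes d: "0 < d" and \<gamma>d: "(1 + 2 * d)\<^sup>2 < \<gamma>"
begin

lemma pw_linear_transport: "pw_linear (transport \<gamma> d)"
proof -
  define c where "c x = (if 0 < x then \<gamma> / x\<^sup>2 * cutoff d (\<gamma> / x) else 0)" for x
  have inv: "inversion \<gamma> (\<lambda>t. cutoff d t * u t) x = c x * u (\<gamma> / x)" for u x
    by (simp add: inversion_def c_def)
  \<comment> \<open>The evaluation nodes and their number depend on the point \<open>s\<close> but
    not on \<open>u\<close>; this uniformity gives linearity and pointwise continuity.\<close>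
  have "\<exists>(M::nat) x. \<forall>u. transport \<gamma> d u s = (\<Sum>i<M. c (x i) * u (\<gamma> / x i))" for s
  proof -
    obtain M where M: "\<bar>s\<bar> + \<bar>\<gamma> / (1 + 2 * d)\<bar> + \<bar>\<gamma> / d\<bar> \<le> real M" using real_arch_simple by blast
    have "transport \<gamma> d u s = (\<Sum>i<2 * M + 1. c (s + real i - real M) * u (\<gamma> / (s + real i - real M)))" for u
      unfolding transport_def per_sum_eq[OF supp_in_inversion_cutoff[OF d \<gamma>d] M] inv ..
    then show ?thesis
      by (intro exI[of _ "2 * M + 1"] exI[of _ "\<lambda>i. s + real i - real M"] allI)
  qed
  then have "\<forall>s. \<exists>M x. \<forall>u. transport \<gamma> d u s = (\<Sum>i<(M::nat). c (x i) * u (\<gamma> / x i))" by simp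
  from choice[OF this] obtain M where "\<forall>s. \<exists>x. \<forall>u. transport \<gamma> d u s = (\<Sum>i<(M s :: nat). c (x i) * u (\<gamma> / x i))" ..
  from choice[OF this] obtain x where T: "\<And>u s. transport \<gamma> d u s = (\<Sum>i<M s. c (x s i) * u (\<gamma> / x s i))" by blast
  show ?thesis
    unfolding pw_linear_def T[abs_def]
    by (auto simp: distrib_left sum.distrib sum_distrib_left mult.left_commute intro!: tendsto_intros)
qed

lemma C1per_transport_power: "C1per v \<Longrightarrow> C1per ((transport \<gamma> d ^^ m) v)"
  by (induction m) (auto intro: C1per_transport[OF d \<gamma>d] C1perD)

lemma transport_power_continuous_periodic:
  assumes "continuous_on UNIV v" "\<And>x. v (x + 1) = v x"
  shows "continuous_on UNIV ((transport \<gamma> d ^^ m) v)" "(transport \<gamma> d ^^ m) v (x + 1) = (transport \<gamma> d ^^ m) v x"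
  using assms by (induction m) (auto intro: continuous_on_transport[OF d \<gamma>d] simp: transport_periodic[OF d \<gamma>d])

lemma integral_transport_power:
  assumes "continuous_on UNIV v" "\<And>x. v (x + 1) = v x"
  shows "integral {0..1} ((transport \<gamma> d ^^ m) v) = integral {0..1} v"
    and "L1norm ((transport \<gamma> d ^^ m) v) \<le> L1norm v"
proof (induction m)
  case (Suc m)
  {
    case 1
    show ?case using integral_transport[OF d \<gamma>d transport_power_continuous_periodic[OF assms]] Suc by simp
  next
    case 2
    show ?case using L1norm_transport[OF d \<gamma>d transport_power_continuous_periodic[OF assms], of m] Suc by simp
  }
qed auto

text \<open>For \<open>n\<close> and then \<open>N\<close> large, \<open>T\<^sup>n (1 - interp N)\<close> is a contraction,
  so \<open>1 - T\<^sup>n\<close> can be inverted up to an error of finite rank.\<close>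

lemma transport_power_contraction:
  obtains n N where "2 \<le> N"
    "\<And>u. C1per u \<Longrightarrow> sup_norm_bound ((transport \<gamma> d ^^ n) (\<lambda>x. u x - interp N u x)) \<le> 1 / 2 * sup_norm_bound u"
proof -
  obtain C where C: "0 \<le> C"
    and var: "\<And>u. C1per u \<Longrightarrow> variation (transport \<gamma> d u) \<le> (1 + 2 * d)\<^sup>2 / \<gamma> * variation u + C * L1norm u"
    using variation_transport[OF d \<gamma>d] by blast
  define \<theta> where "\<theta> = (1 + 2 * d)\<^sup>2 / \<gamma>"
  have \<theta>: "0 \<le> \<theta>" "\<theta> < 1" using \<gamma>d \<gamma>_pos[OF d \<gamma>d] by (auto simp: \<theta>_def)
  have pow: "variation ((transport \<gamma> d ^^ m) v) \<le> \<theta> ^ m * variation v + real m * C * L1norm v" if v: "C1per v" for m v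
  proof (induction m)
    case (Suc m)
    have cv: "continuous_on UNIV v" "\<And>x. v (x + 1) = v x" using v by (auto intro: C1_continuous C1perD)
    have l: "0 \<le> L1norm v" by (rule L1norm_nonneg[OF continuous_on_subset[OF cv(1)]]) simp
    have "variation ((transport \<gamma> d ^^ Suc m) v) \<le> \<theta> * variation ((transport \<gamma> d ^^ m) v) + C * L1norm ((transport \<gamma> d ^^ m) v)"
      using var[OF C1per_transport_power[OF v]] by (simp add: \<theta>_def)
    also have "\<dots> \<le> \<theta> * (\<theta> ^ m * variation v + real m * C * L1norm v) + C * L1norm v"
      using Suc \<theta>(1) C integral_transport_power(2)[OF cv] by (intro add_mono mult_left_mono) auto
    also have "\<dots> \<le> \<theta> ^ Suc m * variation v + real m * C * L1norm v + C * L1norm v"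
      using mult_right_mono[of \<theta> 1 "real m * C * L1norm v"] \<theta> C l by (simp add: distrib_left mult.assoc)
    finally show ?case by (simp add: algebra_simps)
  qed simp
  \<comment> \<open>Here 52 = 4 * 13, and 13 = 1 + 12 bounds the variation of the interpolation
    error. The main term thus contributes at most 1 / 4; \<open>N\<close> is chosen afterwards,
    depending on \<open>n\<close>, so that the L1 terms contribute the other 1 / 4.\<close>
  obtain n where n: "\<theta> ^ n < 1 / 52" using real_arch_pow_inv[of "1 / 52" \<theta>] \<theta>(2) by auto
  obtain N where "8 * (real n * C + 1) \<le> real N" using real_arch_simple by blast
  then have N': "8 * (real n * C + 1) \<le> real (N + 2)" by simp
  define N2 where "N2 = N + 2"
  have N: "2 \<le> N2" and Nr: "(real n * C + 1) * (2 / real N2) \<le> 1 / 4" using N' by (auto simp: N2_def field_simps)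
  show thesis
  proof (rule that[OF N])
    fix u assume u: "C1per u"
    define v where "v x = u x - interp N2 u x" for x
    have v: "C1per v" unfolding v_def[abs_def] by (rule C1per_diff[OF u C1per_interp[OF N]])
    have cv: "continuous_on UNIV v" "\<And>x. v (x + 1) = v x" using v by (auto intro: C1_continuous C1perD)
    have V0: "0 \<le> variation u" by (rule variation_nonneg[OF C1perD(1)[OF u]])
    have Vv: "variation v \<le> 13 * variation u"
      using variation_diff[OF C1perD(1)[OF u] C1perD(1)[OF C1per_interp[OF N]], of u] variation_interp[OF N u]
      by (simp add: v_def[abs_def])
    have Lv: "L1norm v \<le> 2 / real N2 * variation u"
      using L1norm_interp_error[OF N u] by (simp add: v_def[abs_def])
    have "\<bar>integral {0..1} v\<bar> \<le> L1norm v"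
      unfolding L1norm_def using continuous_on_subset[OF cv(1), of "{0..1}"]
        integral_norm_bound_integral[of v "{0..1}" "\<lambda>x. \<bar>v x\<bar>"]
      by (simp add: integrable_continuous_interval continuous_on_rabs)
    then have "sup_norm_bound ((transport \<gamma> d ^^ n) v) \<le> \<theta> ^ n * variation v + real n * C * L1norm v + L1norm v"
      unfolding sup_norm_bound_def integral_transport_power(1)[OF cv] using pow[OF v, of n] by linarith
    also have "\<dots> \<le> 1 / 52 * (13 * variation u) + (real n * C + 1) * (2 / real N2 * variation u)"
    proof -
      have "\<theta> ^ n * variation v \<le> 1 / 52 * (13 * variation u)"
        using n Vv \<theta> variation_nonneg[OF C1perD(1)[OF v]] by (intro mult_mono) auto
      moreover have "(real n * C + 1) * L1norm v \<le> (real n * C + 1) * (2 / real N2 * variation u)"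
        using Lv C by (intro mult_left_mono) auto
      ultimately show ?thesis by (simp add: distrib_right)
    qed
    also have "\<dots> \<le> 1 / 52 * (13 * variation u) + 1 / 4 * variation u"
      using mult_right_mono[OF Nr V0] by (simp only: mult.assoc add_left_mono)
    also have "\<dots> \<le> 1 / 2 * sup_norm_bound u" by (simp add: sup_norm_bound_def)
    finally show "sup_norm_bound ((transport \<gamma> d ^^ n) (\<lambda>x. u x - interp N2 u x)) \<le> 1 / 2 * sup_norm_bound u"
      by (simp add: v_def[abs_def])
  qed
qed

text \<open>The Neumann series y of K = T^n (1 - interp N) satisfies y = b + K y, and separating the
  interpolation part leaves the finite sum. The partial sums contract in
  \<open>sup_norm_bound\<close>, so they converge uniformly; the limit is continuous, and the
  equation survives because all operators respect pointwise limits.\<close>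

lemma transport_resolvent:
  obtains n N where "2 \<le> N"
    "\<And>b. C1per b \<Longrightarrow> \<exists>y. continuous_on UNIV y \<and> (\<forall>x. y (x + 1) = y x) \<and>
       (\<forall>x. y x - (transport \<gamma> d ^^ n) y x = b x - (\<Sum>l<N. y (real l / real N) * (transport \<gamma> d ^^ n) (hat N l) x))"
proof -
  obtain n N where N: "2 \<le> N"
    and contr: "\<And>u. C1per u \<Longrightarrow> sup_norm_bound ((transport \<gamma> d ^^ n) (\<lambda>x. u x - interp N u x)) \<le> 1 / 2 * sup_norm_bound u"
    using transport_power_contraction by blast
  let ?T = "transport \<gamma> d ^^ n"
  define K where "K u = ?T (\<lambda>x. u x - interp N u x)" for u
  have T: "pw_linear ?T" by (rule pw_linear_funpow[OF pw_linear_transport])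
  have K: "K u = (\<lambda>x. ?T u x - ?T (interp N u) x)" for u
    unfolding K_def by (rule pw_linear_diff[OF T])
  have TQ: "pw_linear (\<lambda>u. ?T (interp N u))" by (rule pw_linear_compose[OF T pw_linear_interp])
  show thesis
  proof (rule that[OF N])
    fix b assume b: "C1per b"
    have X: "C1per ((K ^^ m) b)" for m
    proof (induction m)
      case (Suc m)
      then show ?case unfolding funpow.simps o_apply K_def
        by (intro C1per_transport_power C1per_diff C1per_interp[OF N])
    qed (simp add: b)
    have bd: "sup_norm_bound ((K ^^ m) b) \<le> (1 / 2) ^ m * sup_norm_bound b" for m
    proof (induction m)
      case (Suc m)
      have "sup_norm_bound ((K ^^ Suc m) b) \<le> 1 / 2 * sup_norm_bound ((K ^^ m) b)"
        using contr[OF X] by (simp add: K_def)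
      with Suc show ?case by simp
    qed simp
    have bd': "norm ((K ^^ m) b x) \<le> (1 / 2) ^ m * sup_norm_bound b" for m x
      using abs_le_variation_mean[OF X, of m x] bd[of m] by (simp add: sup_norm_bound_def)
    have sm: "summable (\<lambda>m. (1 / 2) ^ m * sup_norm_bound b)"
      by (intro summable_mult2 summable_geometric) simp
    define y where "y x = (\<Sum>m. (K ^^ m) b x)" for x
    define Y where "Y M x = (\<Sum>m<M. (K ^^ m) b x)" for M x
    have unif: "uniform_limit UNIV Y y sequentially"
      unfolding Y_def[abs_def] y_def[abs_def] by (rule Weierstrass_m_test[OF bd' sm])
    have lim: "(\<lambda>M. Y M x) \<longlonglongrightarrow> y x" for x
      using tendsto_uniform_limitI[OF unif] by simp
    have cont: "continuous_on UNIV y"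
    proof (rule uniform_limit_theorem[OF _ unif])
      show "\<forall>\<^sub>F M in sequentially. continuous_on UNIV (Y M)"
        unfolding Y_def[abs_def] by (intro always_eventually allI continuous_on_sum C1_continuous C1perD X)
    qed simp
    have per: "y (x + 1) = y x" for x unfolding y_def using C1perD(2)[OF X] by simp
    have step: "Y (Suc M) x = b x + (?T (Y M) x - ?T (interp N (Y M)) x)" for M x
    proof -
      have "Y (Suc M) x = b x + (\<Sum>m<M. K ((K ^^ m) b) x)"
        unfolding Y_def by (subst sum.lessThan_Suc_shift) simp
      also have "(\<Sum>m<M. K ((K ^^ m) b) x) = ?T (Y M) x - ?T (interp N (Y M)) x"
        unfolding K sum_subtractf Y_def[abs_def] pw_linear_sum[OF T finite_lessThan] pw_linear_sum[OF TQ finite_lessThan] ..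
      finally show ?thesis .
    qed
    have "y x = b x + (?T y x - ?T (interp N y) x)" for x
    proof (rule LIMSEQ_unique)
      show "(\<lambda>M. Y (Suc M) x) \<longlonglongrightarrow> y x" by (rule LIMSEQ_Suc[OF lim])
      show "(\<lambda>M. Y (Suc M) x) \<longlonglongrightarrow> b x + (?T y x - ?T (interp N y) x)"
        unfolding step by (intro tendsto_intros pw_linearD(3)[OF T] pw_linearD(3)[OF TQ] lim)
    qed
    moreover have "?T (interp N y) x = (\<Sum>l<N. y (real l / real N) * ?T (hat N l) x)" for x
      unfolding interp_def[abs_def] pw_linear_sum[OF T finite_lessThan] pw_linearD(2)[OF T] ..
    ultimately have "y x - ?T y x = b x - (\<Sum>l<N. y (real l / real N) * ?T (hat N l) x)" for x
      by (simp add: algebra_simps)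
    with cont per show "\<exists>y. continuous_on UNIV y \<and> (\<forall>x. y (x + 1) = y x) \<and>
       (\<forall>x. y x - ?T y x = b x - (\<Sum>l<N. y (real l / real N) * ?T (hat N l) x))" by blast
  qed
qed

end

section \<open>Solutions in the supercritical case\<close>

definition spike :: "real \<Rightarrow> real \<Rightarrow> real \<Rightarrow> real" where
  "spike p q x = (max 0 (x - p))\<^sup>2 * (max 0 (q - x))\<^sup>2"

lemma C1_spike: "C1 (spike p q)"
proof -
  have m: "C1 (\<lambda>x. (max 0 (x - c))\<^sup>2)" for c :: real
    by (rule C1I[OF DERIV_max_square]) (intro continuous_intros)
  have "C1 (\<lambda>x. (max 0 (x - p))\<^sup>2 * (max 0 (- 1 * x + q - 0))\<^sup>2)"
    using C1_mult[OF m[of p] C1_affine[OF m[of 0], of "- 1" q]] .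
  then show ?thesis by (simp add: spike_def[abs_def])
qed

lemma supp_in_spike: "supp_in p q (spike p q)"
  by (auto simp: supp_in_def spike_def)

lemma spike_pos: "p < x \<Longrightarrow> x < q \<Longrightarrow> 0 < spike p q x"
  by (simp add: spike_def)

text \<open>Gaussian elimination, one coordinate at a time: if some vector \<open>k\<close> keeps a
  residue in the new coordinate, adding \<open>k\<close> to the generators removes all residues.
  This serves to cancel the obstruction vectors of a whole sequence with finitely many
  indices.\<close>

lemma real_vectors_finitely_generated:
  fixes v :: "nat \<Rightarrow> nat \<Rightarrow> real"
  shows "\<exists>I. finite I \<and> (\<forall>i. \<exists>c. \<forall>l<N. v i l = (\<Sum>j\<in>I. c j * v j l))"
proof (induction N)
  case 0
  show ?case by (intro exI[of _ "{}"]) simp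
next
  case (Suc N)
  then obtain I where I: "finite I" "\<forall>i. \<exists>c. \<forall>l<N. v i l = (\<Sum>j\<in>I. c j * v j l)" by blast
  from choice[OF I(2)] obtain c where "\<forall>i. \<forall>l<N. v i l = (\<Sum>j\<in>I. c i j * v j l)" ..
  then have c: "\<And>i l. l < N \<Longrightarrow> v i l = (\<Sum>j\<in>I. c i j * v j l)" by simp
  define r where "r i = v i N - (\<Sum>j\<in>I. c i j * v j N)" for i
  show ?case
  proof (cases "\<forall>i. r i = 0")
    case True
    have "v i l = (\<Sum>j\<in>I. c i j * v j l)" if "l < Suc N" for i l
    proof (cases "l = N")
      case l: True
      have "v i N - (\<Sum>j\<in>I. c i j * v j N) = 0" using spec[OF True, of i] unfolding r_def .
      then show ?thesis using l by (simp only: right_minus_eq)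
    next
      case False
      then have "l < N" using that by simp
      then show ?thesis by (rule c)
    qed
    then have "\<forall>i. \<exists>c. \<forall>l<Suc N. v i l = (\<Sum>j\<in>I. c j * v j l)" by blast
    with I(1) show ?thesis by blast
  next
    case False
    then obtain k where k: "r k \<noteq> 0" by blast
    have res: "v i l - (\<Sum>j\<in>I. c i j * v j l) = r i / r k * (v k l - (\<Sum>j\<in>I. c k j * v j l))" if "l < Suc N" for i l
    proof (cases "l = N")
      case True
      show ?thesis unfolding True r_def[symmetric] using k by simp
    next
      case False
      then have "l < N" using that by simp
      then have "v i l - (\<Sum>j\<in>I. c i j * v j l) = 0" for i by (subst right_minus_eq) (rule c)
      then show ?thesis by (simp only: mult_zero_right)
    qed
    \<comment> \<open>The pivot \<open>k\<close> may already belong to \<open>I\<close>; adding two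
      separate cases gives the right coefficient either way.\<close>
    define e where "e i j = (if j \<in> I then c i j - r i / r k * c k j else 0) + (if j = k then r i / r k else 0)" for i j
    have "v i l = (\<Sum>j\<in>insert k I. e i j * v j l)" if l: "l < Suc N" for i l
    proof -
      have "(\<Sum>j\<in>insert k I. e i j * v j l) = (\<Sum>j\<in>insert k I. if j \<in> I then (c i j - r i / r k * c k j) * v j l else 0)
          + (\<Sum>j\<in>insert k I. if j = k then r i / r k * v j l else 0)"
        unfolding sum.distrib[symmetric] by (intro sum.cong) (auto simp: e_def distrib_right)
      also have "(\<Sum>j\<in>insert k I. if j = k then r i / r k * v j l else 0) = r i / r k * v k l"
        using I(1) by (simp add: sum.delta)
      also have "(\<Sum>j\<in>insert k I. if j \<in> I then (c i j - r i / r k * c k j) * v j l else 0) =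
          (\<Sum>j\<in>I. (c i j - r i / r k * c k j) * v j l)"
        using I(1) by (intro sum.mono_neutral_cong_right) auto
      also have "\<dots> = (\<Sum>j\<in>I. c i j * v j l) - r i / r k * (\<Sum>j\<in>I. c k j * v j l)"
        by (simp add: left_diff_distrib sum_subtractf sum_distrib_left mult.assoc)
      finally have "(\<Sum>j\<in>insert k I. e i j * v j l) =
          (\<Sum>j\<in>I. c i j * v j l) + r i / r k * (v k l - (\<Sum>j\<in>I. c k j * v j l))"
        unfolding right_diff_distrib by linarith
      then show ?thesis unfolding res[OF l, of i, symmetric] by simp
    qed
    then have "\<forall>i. \<exists>c. \<forall>l<Suc N. v i l = (\<Sum>j\<in>insert k I. c j * v j l)" by blast
    moreover have "finite (insert k I)" using I(1) by simp
    ultimately show ?thesis by blast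
  qed
qed

text \<open>With \<open>f = H - inversion \<gamma> H\<close> the second family of conditions follows from the first one,
  and for \<open>H = h + cutoff d \<cdot> u\<close> the first one reads \<open>u - transport \<gamma> d u = b\<close> with \<open>b\<close> determined by \<open>h\<close>.\<close>

lemma supercritical_family:
  fixes \<gamma> :: real
  assumes \<gamma>: "1 < \<gamma>"
  obtains f :: "nat \<Rightarrow> real \<Rightarrow> real" and v :: "nat \<Rightarrow> nat \<Rightarrow> real" and G :: "nat \<Rightarrow> real \<Rightarrow> real"
    and N :: nat and p q :: "nat \<Rightarrow> real" and \<alpha> \<beta> :: real
  where "0 < \<alpha>" "\<And>k. continuous_on UNIV (f k)" "\<And>k. supp_in \<alpha> \<beta> (f k)"
    "\<And>k s. 0 < s \<Longrightarrow> inversion \<gamma> (f k) s = - f k s"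
    "\<And>k s. per_sum (f k) s = (\<Sum>l<N. v k l * G l s)"
    "\<And>k. p k < q k" "\<And>k x. p k < x \<Longrightarrow> x < q k \<Longrightarrow> 0 < f k x"
    "\<And>j k x. j \<noteq> k \<Longrightarrow> p k < x \<Longrightarrow> x < q k \<Longrightarrow> f j x = 0"
proof -
  define r where "r = sqrt \<gamma>"
  have r: "1 < r" "r\<^sup>2 = \<gamma>" using \<gamma> by (auto simp: r_def)
  have \<gamma>0: "0 < \<gamma>" using \<gamma> by simp
  have \<gamma>r: "\<gamma> / r = r" using r by (simp add: r(2)[symmetric] power2_eq_square)
  \<comment> \<open>With this choice b = 1 + 2 d = (2 r + 1) / 3 stays below r, which both makes the
    transport contracting and leaves the gap (b, r) free.\<close>
  define d where "d = (r - 1) / 3"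
  have d: "0 < d" using r by (simp add: d_def)
  define b where "b = 1 + 2 * d"
  have br: "b < r" "0 < b" 
  proof -
    have "b = (2 * r + 1) / 3" by (simp add: b_def d_def field_simps)
    then show "b < r" "0 < b" using r(1) by simp_all
  qed
  have \<gamma>d: "(1 + 2 * d)\<^sup>2 < \<gamma>" 
  proof -
    have "b\<^sup>2 < r\<^sup>2" by (rule power_strict_mono) (use br in simp_all)
    then show ?thesis by (simp only: r(2) b_def)
  qed
  let ?w = "cutoff d" and ?J = "inversion \<gamma>" and ?T = "transport \<gamma> d"
  obtain n N where N: "2 \<le> N"
    and res: "\<And>b. C1per b \<Longrightarrow> \<exists>y. continuous_on UNIV y \<and> (\<forall>x. y (x + 1) = y x) \<and>
       (\<forall>x. y x - (?T ^^ n) y x = b x - (\<Sum>l<N. y (real l / real N) * (?T ^^ n) (hat N l) x))"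
    by (rule transport_resolvent[OF d \<gamma>d]) (rule that)
  \<comment> \<open>Infinitely many disjoint intervals (p k, q k) in the gap (b, r), accumulating at
    b.\<close>
  define q where "q k = b + (r - b) / real (k + 1)" for k
  define p where "p k = q (Suc k)" for k
  have qmono: "q k \<le> q j" if "j \<le> k" for j k
    unfolding q_def using that br by (intro add_left_mono divide_left_mono) auto
  have pq: "p k < q k" for k
    unfolding p_def q_def using br by (intro add_strict_left_mono divide_strict_left_mono) auto
  have pb: "b \<le> p k" and qr: "q k \<le> r" for k
  proof -
    show "b \<le> p k" unfolding p_def q_def using br by simp
    have "(r - b) / real (k + 1) \<le> (r - b) / 1" using br by (intro divide_left_mono) auto
    then show "q k \<le> r" unfolding q_def by simp
  qed
  define h where "h k = spike (p k) (q k)" for k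
  have h: "C1 (h k)" "supp_in b r (h k)" for k
    unfolding h_def by (rule C1_spike, rule supp_in_mono[OF supp_in_spike pb qr])
  have br': "b \<le> r" using br by simp
  have Jh: "C1 (?J (h k))" "supp_in (\<gamma> / r) (\<gamma> / b) (?J (h k))" for k
    by (rule C1_inversion[OF \<gamma>0 br(2) br' h], rule supp_in_inversion[OF \<gamma>0 br(2) br' h(2)])
  define B where "B k x = per_sum (?J (h k)) x - per_sum (h k) x" for k x
  have B: "C1per (B k)" for k
    unfolding B_def[abs_def] by (intro C1per_diff C1per_per_sum[OF h] C1per_per_sum[OF Jh])
  have "\<forall>k. \<exists>y. continuous_on UNIV y \<and> (\<forall>x. y (x + 1) = y x) \<and>
       (\<forall>x. y x - (?T ^^ n) y x = B k x - (\<Sum>l<N. y (real l / real N) * (?T ^^ n) (hat N l) x))"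
    using res[OF B] by blast
  from choice[OF this] obtain y where y: "\<And>k. continuous_on UNIV (y k)" "\<And>k x. y k (x + 1) = y k x"
    "\<And>k x. y k x - (?T ^^ n) (y k) x = B k x - (\<Sum>l<N. y k (real l / real N) * (?T ^^ n) (hat N l) x)" by blast
  \<comment> \<open>The resolvent treats T^n; this geometric sum telescopes and turns y - T^n y into
    u - T u.\<close>
  define u where "u k x = (\<Sum>i<n. (?T ^^ i) (y k) x)" for k x
  have cu: "continuous_on UNIV (u k)" for k
    unfolding u_def[abs_def] by (intro continuous_on_sum transport_power_continuous_periodic(1)[OF d \<gamma>d] y)
  have pu: "u k (x + 1) = u k x" for k x
    unfolding u_def by (intro sum.cong refl transport_power_continuous_periodic(2)[OF d \<gamma>d] y)
  have Tu: "u k x - ?T (u k) x = y k x - (?T ^^ n) (y k) x" for k x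
  proof -
    have "?T (u k) x = (\<Sum>i<n. (?T ^^ Suc i) (y k) x)"
      unfolding u_def[abs_def] pw_linear_sum[OF pw_linear_transport[OF d \<gamma>d] finite_lessThan] by simp
    then have "u k x - ?T (u k) x = (\<Sum>i<n. (?T ^^ i) (y k) x - (?T ^^ Suc i) (y k) x)"
      by (simp add: u_def sum_subtractf)
    also have "\<dots> = y k x - (?T ^^ n) (y k) x"
      by (subst sum_lessThan_telescope') simp
    finally show ?thesis .
  qed
  define H where "H k x = h k x + ?w x * u k x" for k x
  define f where "f k x = H k x - ?J (H k) x" for k x
  have wu: "continuous_on UNIV (\<lambda>x. ?w x * u k x)" "supp_in d b (\<lambda>x. ?w x * u k x)" for k
    unfolding b_def by (rule continuous_cutoff_mult[OF d \<gamma>d cu], rule supp_in_cutoff_mult[OF d \<gamma>d])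
  have db: "d \<le> b" "d \<le> r" using d br by (auto simp: b_def)
  have Jwu: "supp_in (\<gamma> / b) (\<gamma> / d) (?J (\<lambda>x. ?w x * u k x))" for k
    by (rule supp_in_inversion[OF \<gamma>0 d db(1) wu(2)])
  have H: "continuous_on UNIV (H k)" "supp_in d r (H k)" for k
    unfolding H_def[abs_def]
    by (intro continuous_on_add C1_continuous h wu)
       (use h(2)[of k] wu(2)[of k] db br in \<open>auto simp: supp_in_def\<close>)
  have JH: "continuous_on UNIV (?J (H k))" "supp_in r (\<gamma> / d) (?J (H k))" for k
    using continuous_on_inversion[OF \<gamma>0 d db(2) H] supp_in_inversion[OF \<gamma>0 d db(2) H(2)] by (simp_all add: \<gamma>r)
  have rd: "r \<le> \<gamma> / d"
  proof -
    have "r * d \<le> r * r" using db r by (intro mult_left_mono) auto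
    then show ?thesis using d by (simp add: pos_le_divide_eq r(2)[symmetric] power2_eq_square)
  qed
  have JHeq: "?J (H k) = (\<lambda>x. ?J (h k) x + ?J (\<lambda>x. ?w x * u k x) x)" for k
    unfolding H_def[abs_def] by (rule ext) (rule inversion_add)
  \<comment> \<open>In the gap nothing else is present: \<open>?w * u k\<close> ends at b, and the
    inverted part begins at \<gamma> / r = r. There the functions keep the disjoint supports of the
    spikes.\<close>
  have fh: "f k x = h k x" if "b < x" "x < r" for k x
  proof -
    have "?w x * u k x = 0" using supp_inD[OF wu(2)] that by blast
    moreover have "?J (H k) x = 0" using supp_inD[OF JH(2)] that by blast
    ultimately show ?thesis by (simp add: f_def H_def)
  qed
  have in_range: "b < x \<and> x < r" if "p k < x" "x < q k" for k x
    using pb[of k] qr[of k] that by linarith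
  show thesis
  proof (rule that[of d f "\<gamma> / d" "\<lambda>k l. - y k (real l / real N)" "\<lambda>l. (?T ^^ n) (hat N l)" N p q])
    show "0 < d" by (rule d)
    show "continuous_on UNIV (f k)" for k
      unfolding f_def[abs_def] by (intro continuous_on_diff H JH)
    show "supp_in d (\<gamma> / d) (f k)" for k
      using supp_in_mono[OF H(2) order_refl rd] supp_in_mono[OF JH(2) db(2) order_refl]
      by (simp add: supp_in_def f_def)
    show "inversion \<gamma> (f k) s = - f k s" if "0 < s" for k s
      unfolding f_def[abs_def] inversion_diff inversion_inversion[OF \<gamma>0 that] by simp
    show "per_sum (f k) s = (\<Sum>l<N. - y k (real l / real N) * (?T ^^ n) (hat N l) s)" for k s
    proof -
      have "per_sum (f k) s = per_sum (H k) s - per_sum (?J (H k)) s"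
        unfolding f_def[abs_def] by (rule per_sum_diff(1)[OF H(2) JH(2)])
      also have "per_sum (H k) s = per_sum (h k) s + per_sum (\<lambda>x. ?w x * u k x) s"
        unfolding H_def[abs_def] by (rule per_sum_diff(2)[OF h(2) wu(2)])
      also have "per_sum (?J (H k)) s = per_sum (?J (h k)) s + ?T (u k) s"
        unfolding JHeq transport_def by (rule per_sum_diff(2)[OF Jh(2) Jwu])
      also have "per_sum (\<lambda>x. ?w x * u k x) s = u k s"
        using per_sum_mult_periodic[of "u k" ?w s] periodic_of_int[of "u k", OF pu] per_sum_cutoff[OF d] by (simp add: mult.commute)
      finally have "per_sum (f k) s = (u k s - ?T (u k) s) - B k s" by (simp add: B_def)
      also have "\<dots> = - (\<Sum>l<N. y k (real l / real N) * (?T ^^ n) (hat N l) s)"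
        unfolding Tu y(3) by simp
      finally show ?thesis by (simp add: sum_negf)
    qed
    show "p k < q k" for k by (rule pq)
    show "0 < f k x" if "p k < x" "x < q k" for k x
      using fh in_range[OF that] spike_pos[OF that] by (simp add: h_def)
    show "f j x = 0" if "j \<noteq> k" "p k < x" "x < q k" for j k x
    proof -
      have "x < p j \<or> q j < x"
        using qmono[of "Suc j" k] qmono[of "Suc k" j] that unfolding p_def by linarith
      then have "h j x = 0" unfolding h_def by (rule supp_inD[OF supp_in_spike])
      then show ?thesis using fh in_range[OF that(2,3)] by simp
    qed
  qed
qed

section \<open>Elements of \<open>L\<^sup>1\<close>\<close>

text \<open>These integrals are linear functionals on the quotient: the one over (0, 2) normalizes
  the critical element, those over disjoint intervals prove linear independence.\<close>

lift_definition L1_integral :: "real \<Rightarrow> real \<Rightarrow> L1 \<Rightarrow> complex" is "\<lambda>a b f. LINT x:{a<..<b}|lborel. f x"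
  unfolding L1_rel_def set_lebesgue_integral_def
  by (intro integral_cong_AE) (auto elim: AE_mp)

lemma L1_integral_add: "L1_integral a b (F + G) = L1_integral a b F + L1_integral a b G"
proof -
  have i: "set_integrable lborel {a<..<b} f" if "integrable lborel f" for f :: "real \<Rightarrow> complex" and a b
    unfolding set_integrable_def by (rule integrable_mult_indicator) (use that in auto)
  show ?thesis
    by transfer (rule set_integral_add(2)[OF i i]; simp add: L1_rel_def)
qed

lemma L1_integral_scale: "L1_integral a b (L1_scale c F) = c * L1_integral a b F"
proof (induction F rule: L1.abs_induct)
  case (1 f)
  have "L1_rel (\<lambda>x. c * f x) (\<lambda>x. c * f x)" using 1 by (simp add: L1_rel_def)
  then show ?case
    unfolding L1_scale.abs_eq[OF 1] L1_integral.abs_eq[OF 1]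
    by (subst L1_integral.abs_eq) (assumption, rule set_integral_mult_right)
qed

text \<open>Substituting x = 2 t changes period 2 into period 1 and 4 \<gamma> / x into 2 \<gamma> /
  t, so the conditions concern the fractional parts of t and of \<gamma> / t. Setting
  \<open>g\<close> to 0 for t \<le> 0 selects the required representative.\<close>

lemma frac_annihilated_rescaled:
  fixes f :: "real \<Rightarrow> complex"
  assumes f: "integrable lborel f" and neg: "AE x in lborel. x < 0 \<longrightarrow> f x = 0"
    and perp: "\<And>n::int. (LINT x|lborel. f x * exp (\<i> * of_int n * of_real pi * of_real x)) = 0"
      "\<And>n::int. (LINT x|lborel. f x * exp (\<i> * of_int n * of_real pi * of_real (4 * \<gamma> / x))) = 0"
  defines "g \<equiv> \<lambda>t. if 0 < t then f (2 * t) else 0"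
  shows "frac_annihilated \<gamma> g" and "(AE t in lborel. g t = 0) \<Longrightarrow> AE x in lborel. f x = 0"
    and "(LINT t:{0<..<1}|lborel. g t) = (LINT x:{0<..<2}|lborel. f x) / 2"
proof -
  have [measurable]: "f \<in> borel_measurable borel" using f by auto
  have g_meas[measurable]: "g \<in> borel_measurable borel" unfolding g_def by measurable
  have null: "AE t in lborel. t \<noteq> (0::real)" by (rule AE_lborel_singleton)
  have "AE t in lborel. 0 + 2 * t < 0 \<longrightarrow> f (0 + 2 * t) = 0"
    by (rule AE_borel_affine) (use neg in auto)
  then have eq: "AE t in lborel. f (2 * t) = g t"
    using null by eventually_elim (auto simp: g_def)
  have sub: "(LINT x|lborel. h x) = 2 * (LINT t|lborel. h (2 * t))" for h :: "real \<Rightarrow> complex"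
    using lborel_integral_real_affine[of 2 h 0] by (simp add: scaleR_conv_of_real)
  have f2: "integrable lborel (\<lambda>t. f (2 * t))"
    using lborel_integrable_real_affine[OF f, of 2 0] by simp
  have gi: "integrable lborel g"
    by (rule Bochner_Integration.integrable_cong_AE[THEN iffD1, OF _ _ eq f2]) auto
  have int_g: "(LINT x|lborel. f x * h (x / 2)) = 2 * (LINT t|lborel. g t * h t)" if [measurable]: "h \<in> borel_measurable borel" for h :: "real \<Rightarrow> complex"
  proof -
    have "(LINT x|lborel. f x * h (x / 2)) = 2 * (LINT t|lborel. f (2 * t) * h t)"
      by (subst sub) simp
    also have "(LINT t|lborel. f (2 * t) * h t) = (LINT t|lborel. g t * h t)"
      by (rule integral_cong_AE) (use eq in \<open>auto elim: AE_mp\<close>)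
    finally show ?thesis .
  qed
  have m1: "(LINT t|lborel. g t * exp (\<i> * of_int n * of_real (2 * pi * t))) = 0" for n :: int
    using int_g[of "\<lambda>t. exp (\<i> * of_int n * of_real (2 * pi * t))"] perp(1)[of n] by (simp add: mult_ac)
  have m2: "(LINT t|lborel. g t * exp (\<i> * of_int n * of_real (2 * pi * (\<gamma> / t)))) = 0" for n :: int
  proof -
    have "(\<lambda>t. exp (\<i> * of_int n * of_real (2 * pi * (\<gamma> / t)))) \<in> borel_measurable borel" by measurable
    moreover have "exp (\<i> * of_int n * of_real (2 * pi * (\<gamma> / (x / 2)))) = exp (\<i> * of_int n * of_real pi * of_real (4 * \<gamma> / x))" for x
      by (simp add: mult_ac)
    ultimately show ?thesis using int_g[of "\<lambda>t. exp (\<i> * of_int n * of_real (2 * pi * (\<gamma> / t)))"] perp(2)[of n] by simp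
  qed
  show "frac_annihilated \<gamma> g"
    unfolding frac_annihilated_def
  proof (intro conjI ballI gi)
    show "\<forall>t\<le>0. g t = 0" by (simp add: g_def)
    fix A :: "real set" assume A: "A \<in> sets borel"
    show "(LINT t|lborel. g t * indicator A (frac t)) = 0"
      by (rule fourier_zero_imp_frac_zero[of "\<lambda>t. t", OF _ gi m1 A]) simp
    show "(LINT t|lborel. g t * indicator A (frac (\<gamma> / t))) = 0"
      by (rule fourier_zero_imp_frac_zero[of "\<lambda>t. \<gamma> / t", OF _ gi m2 A]) measurable
  qed
  show "AE x in lborel. f x = 0" if "AE t in lborel. g t = 0"
  proof -
    have "AE x in lborel. g (0 + 1 / 2 * x) = 0"
      by (rule AE_borel_affine) (use that in auto)
    then show ?thesis
      using neg AE_lborel_singleton[of 0] by eventually_elim (auto simp: g_def)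
  qed
  have "(LINT x|lborel. f x * indicator {0<..<1} (x / 2)) = 2 * (LINT t|lborel. g t * indicator {0<..<1} t)"
    by (rule int_g) measurable
  moreover have "(LINT x:{0<..<2}|lborel. f x) = (LINT x|lborel. f x * indicator {0<..<1} (x / 2))"
    "(LINT t:{0<..<1}|lborel. g t) = (LINT t|lborel. g t * indicator {0<..<1} t)"
    unfolding set_lebesgue_integral_def
    by (auto intro!: Bochner_Integration.integral_cong simp: indicator_def)
  ultimately show "(LINT t:{0<..<1}|lborel. g t) = (LINT x:{0<..<2}|lborel. f x) / 2" by simp
qed

lemma exp_i_of_int_eq_cis: "exp (\<i> * of_int n * of_real x) = cis (of_int n * x)"
  by (simp only: cis_conv_exp of_real_mult of_real_of_int_eq mult.assoc)

lemma M_perp_pos_subcritical: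
  assumes "0 < \<gamma>" "\<gamma> < 1" "in_M_perp (4 * \<gamma>) F" "vanishes_on_neg F"
  shows "F = 0"
  using assms
proof transfer
  fix \<gamma> :: real and f :: "real \<Rightarrow> complex"
  assume \<gamma>: "0 < \<gamma>" "\<gamma> < 1" and f: "L1_rel f f"
    and perp: "\<forall>n::int. (LINT x|lborel. f x * exp (\<i> * of_int n * of_real pi * of_real x)) = 0 \<and>
      (LINT x|lborel. f x * exp (\<i> * of_int n * of_real pi * of_real (4 * \<gamma> / x))) = 0"
    and neg: "AE x in lborel. x < 0 \<longrightarrow> f x = 0"
  have fi: "integrable lborel f" using f by (simp add: L1_rel_def)
  note R = frac_annihilated_rescaled[OF fi neg perp[rule_format, THEN conjunct1] perp[rule_format, THEN conjunct2]]
  have "AE x in lborel. f x = 0"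
    by (rule R(2)[OF frac_annihilated_subcritical[OF \<gamma> R(1)]])
  then show "L1_rel f (\<lambda>_. 0)" using fi by (simp add: L1_rel_def)
qed

lemma M_perp_pos_critical:
  assumes "in_M_perp 4 F" "vanishes_on_neg F" "L1_integral 0 2 F = 0"
  shows "F = 0"
  using assms
proof transfer
  fix f :: "real \<Rightarrow> complex"
  assume f: "L1_rel f f"
    and perp: "\<forall>n::int. (LINT x|lborel. f x * exp (\<i> * of_int n * of_real pi * of_real x)) = 0 \<and>
      (LINT x|lborel. f x * exp (\<i> * of_int n * of_real pi * of_real (4 / x))) = 0"
    and neg: "AE x in lborel. x < 0 \<longrightarrow> f x = 0" and 0: "(LINT x:{0<..<2}|lborel. f x) = 0"
  have fi: "integrable lborel f" using f by (simp add: L1_rel_def)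
  have perp': "(LINT x|lborel. f x * exp (\<i> * of_int n * of_real pi * of_real (4 * 1 / x))) = 0" for n :: int
    using perp by simp
  note R = frac_annihilated_rescaled[OF fi neg perp[rule_format, THEN conjunct1] perp']
  have "AE x in lborel. f x = 0"
    by (rule R(2)[OF frac_annihilated_critical[OF R(1)]]) (simp add: R(3) 0)
  then show "L1_rel f (\<lambda>_. 0)" using fi by (simp add: L1_rel_def)
qed

text \<open>The exponential is 1-periodic and factors out of the partial sums over unit intervals,
  which tend to 0 boundedly. Working with one-sided partial sums rather than \<open>per_sum\<close>
  covers functions of unbounded support, such as the critical density.\<close>

lemma fourier_zero_of_periodization:
  fixes g :: "real \<Rightarrow> real"
  assumes g: "integrable lborel g" "\<And>t. t \<le> 0 \<Longrightarrow> g t = 0"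
    and lim: "\<And>s. 0 < s \<Longrightarrow> s < 1 \<Longrightarrow> (\<lambda>n. \<Sum>j<n. g (s + real j)) \<longlonglongrightarrow> 0"
    and bound: "\<And>n s. 0 < s \<Longrightarrow> s < 1 \<Longrightarrow> \<bar>\<Sum>j<n. g (s + real j)\<bar> \<le> C"
  shows "(LINT t|lborel. complex_of_real (g t) * exp (\<i> * of_int m * of_real (2 * pi * t))) = 0"
proof -
  let ?e = "\<lambda>t. exp (\<i> * of_int m * of_real (2 * pi * t)) :: complex"
  have [measurable]: "g \<in> borel_measurable borel" using g(1) by auto
  have e1: "norm (?e t) = 1" for t unfolding exp_i_of_int_eq_cis by (rule norm_cis)
  have [measurable]: "?e \<in> borel_measurable borel" by measurable
  have per: "?e (s + real j) = ?e s" for s j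
  proof -
    have "of_int m * (2 * pi * (s + real j)) = of_int m * (2 * pi * s) + 2 * pi * of_int (m * int j)"
      by (simp add: algebra_simps)
    moreover have "cis (2 * pi * of_int (m * int j)) = 1" by (rule cis_multiple_2pi) simp
    ultimately show ?thesis unfolding exp_i_of_int_eq_cis by (simp only: cis_mult[symmetric] mult_1_right)
  qed
  define k where "k t = complex_of_real (g t) * ?e t" for t
  have [measurable]: "k \<in> borel_measurable borel" unfolding k_def[abs_def] by measurable
  have ki: "integrable lborel k"
    by (rule Bochner_Integration.integrable_bound[OF g(1)]) (auto simp: k_def norm_mult e1 simp del: of_real_mult)
  have ks: "set_integrable lborel S k" if "S \<in> sets borel" for S
    unfolding set_integrable_def by (rule integrable_mult_indicator) (use that ki in auto)
  have kj: "integrable lborel (\<lambda>s. k (s + real j))" for j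
    using lborel_integrable_real_affine[OF ki, of 1 "real j"] by (simp add: add.commute)
  have "(LINT t|lborel. k t) = (LINT t:{real 0..}|lborel. k t)"
    unfolding set_lebesgue_integral_def using g(2)
    by (intro Bochner_Integration.integral_cong) (auto simp: indicator_def k_def)
  also have "\<dots> = (\<Sum>j. LINT s:{0..<1}|lborel. k (s + real (j + 0)))"
    by (rule integral_unfold_unit_interval[OF ks]) simp
  also have "\<dots> = 0"
  proof -
    have "(\<lambda>n. LINT s|lborel. indicat_real {0..<1} s *\<^sub>R (\<Sum>j<n. k (s + real j))) \<longlonglongrightarrow> (LINT s::real|lborel. (0::complex))"
    proof (rule integral_dominated_convergence[where w = "\<lambda>s. indicator {0..<1} s * \<bar>C\<bar>"])
      have sum: "(\<Sum>j<n. k (s + real j)) = of_real (\<Sum>j<n. g (s + real j)) * ?e s" for n s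
        unfolding k_def per by (simp add: sum_distrib_right)
      have "AE s in lborel. s \<noteq> (0::real)" by (rule AE_lborel_singleton)
      then show "AE s in lborel. (\<lambda>n. indicat_real {0..<1} s *\<^sub>R (\<Sum>j<n. k (s + real j))) \<longlonglongrightarrow> 0"
      proof eventually_elim
        case (elim s)
        show ?case
        proof (cases "s \<in> {0..<1}")
          case True
          then have "(\<lambda>n. of_real (\<Sum>j<n. g (s + real j)) * ?e s) \<longlonglongrightarrow> of_real 0 * ?e s"
            using elim by (intro tendsto_mult_right tendsto_of_real lim) auto
          with True show ?thesis unfolding sum by simp
        qed simp
      qed
      fix n
      have "AE s in lborel. s \<noteq> (0::real)" by (rule AE_lborel_singleton)
      then show "AE s in lborel. norm (indicat_real {0..<1} s *\<^sub>R (\<Sum>j<n. k (s + real j))) \<le> indicator {0..<1} s * \<bar>C\<bar>"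
      proof eventually_elim
        case (elim s)
        show ?case
        proof (cases "s \<in> {0..<1}")
          case True
          then have "\<bar>\<Sum>j<n. g (s + real j)\<bar> \<le> \<bar>C\<bar>" using bound[of s n] elim by auto
          with True show ?thesis unfolding sum norm_scaleR norm_mult e1 norm_of_real by simp
        qed simp
      qed
    next
      show "integrable lborel (\<lambda>s::real. indicat_real {0..<1} s * \<bar>C\<bar>)" by (intro integrable_mult_left integrable_real_indicator) auto
    qed auto
    moreover have "(LINT s|lborel. indicat_real {0..<1} s *\<^sub>R (\<Sum>j<n. k (s + real j))) = (\<Sum>j<n. LINT s:{0..<1}|lborel. k (s + real j))" for n
      unfolding set_lebesgue_integral_def scaleR_sum_right
      by (intro Bochner_Integration.integral_sum integrable_mult_indicator kj) auto
    ultimately show ?thesis by (simp add: sums_unique[symmetric] sums_def)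
  qed
  finally show ?thesis by (simp add: k_def)
qed

text \<open>Antisymmetry under the inversion turns each integral against exp of \<gamma> / t into
  minus the corresponding integral against exp of t, so the second family of conditions follows from
  the first.\<close>

lemma M_perp_pos_construct:
  fixes g :: "real \<Rightarrow> real"
  assumes \<gamma>: "0 < \<gamma>" and g: "integrable lborel g" "\<And>t. t \<le> 0 \<Longrightarrow> g t = 0"
    and anti: "\<And>s. 0 < s \<Longrightarrow> inversion \<gamma> g s = - g s"
    and lim: "\<And>s. 0 < s \<Longrightarrow> s < 1 \<Longrightarrow> (\<lambda>n. \<Sum>j<n. g (s + real j)) \<longlonglongrightarrow> 0"
    and bound: "\<And>n s. 0 < s \<Longrightarrow> s < 1 \<Longrightarrow> \<bar>\<Sum>j<n. g (s + real j)\<bar> \<le> C"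
  shows "integrable lborel (\<lambda>x. complex_of_real (g (x / 2)))"
    and "abs_L1 (\<lambda>x. complex_of_real (g (x / 2))) \<in> M_perp_pos (4 * \<gamma>)"
proof -
  let ?f = "\<lambda>x. complex_of_real (g (x / 2))"
  have [measurable]: "g \<in> borel_measurable borel" using g(1) by auto
  have gc: "integrable lborel (\<lambda>t. complex_of_real (g t))" using g(1) by simp
  show fi: "integrable lborel ?f"
    using lborel_integrable_real_affine[OF gc, of "1 / 2" 0] by simp
  then have rel: "L1_rel ?f ?f" by (simp add: L1_rel_def)
  have sub: "(LINT x|lborel. h x) = 2 * (LINT t|lborel. h (2 * t))" for h :: "real \<Rightarrow> complex"
    using lborel_integral_real_affine[of 2 h 0] by (simp add: scaleR_conv_of_real)
  have m1: "(LINT t|lborel. complex_of_real (g t) * exp (\<i> * of_int n * of_real (2 * pi * t))) = 0" for n :: int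
    by (rule fourier_zero_of_periodization[OF g lim bound])
  have m2: "(LINT t|lborel. complex_of_real (g t) * exp (\<i> * of_int n * of_real (2 * pi * (\<gamma> / t)))) = 0" for n :: int
  proof -
    let ?k = "\<lambda>t. complex_of_real (g t) * exp (\<i> * of_int n * of_real (2 * pi * (\<gamma> / t)))"
    have [measurable]: "?k \<in> borel_measurable borel" by measurable
    have nk: "norm (exp (\<i> * of_int n * of_real (2 * pi * (\<gamma> / t))) :: complex) = 1" for t
      unfolding exp_i_of_int_eq_cis by (rule norm_cis)
    have ki: "integrable lborel ?k"
      by (rule Bochner_Integration.integrable_bound[OF g(1)]) (auto simp: norm_mult nk simp del: of_real_mult of_real_divide)
    then have ks: "set_integrable lborel {0<..} ?k"
      unfolding set_integrable_def by (intro integrable_mult_indicator) auto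
    have "(LINT t|lborel. ?k t) = (LINT t:{0<..}|lborel. ?k t)"
      unfolding set_lebesgue_integral_def using g(2)
      by (intro Bochner_Integration.integral_cong) (auto simp: indicator_def not_less)
    also have "\<dots> = (LINT s:{0<..}|lborel. (\<gamma> / s\<^sup>2) *\<^sub>R ?k (\<gamma> / s))"
      by (rule set_integral_inversion[OF \<gamma> _ ks, symmetric]) measurable
    also have "\<dots> = (LINT s:{0<..}|lborel. - (complex_of_real (g s) * exp (\<i> * of_int n * of_real (2 * pi * s))))"
    proof (intro set_lebesgue_integral_cong allI impI)
      fix s :: real assume "s \<in> {0<..}"
      then have s: "0 < s" by simp
      have "(\<gamma> / s\<^sup>2) *\<^sub>R complex_of_real (g (\<gamma> / s)) = of_real (inversion \<gamma> g s)"
        using s by (simp add: inversion_def scaleR_conv_of_real)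
      also have "\<dots> = - complex_of_real (g s)" by (simp add: anti[OF s])
      moreover have "\<gamma> / (\<gamma> / s) = s" using \<gamma> by simp
      ultimately show "(\<gamma> / s\<^sup>2) *\<^sub>R ?k (\<gamma> / s) = - (complex_of_real (g s) * exp (\<i> * of_int n * of_real (2 * pi * s)))"
        by (simp only: mult_scaleR_left[symmetric] mult_minus_left)
    qed simp
    also have "\<dots> = - (LINT t|lborel. complex_of_real (g t) * exp (\<i> * of_int n * of_real (2 * pi * t)))"
      unfolding set_lebesgue_integral_def integral_minus[symmetric] using g(2)
      by (intro Bochner_Integration.integral_cong) (auto simp: indicator_def not_less)
    also have "\<dots> = 0" unfolding m1 by simp
    finally show ?thesis .
  qed
  have "in_M_perp (4 * \<gamma>) (abs_L1 ?f)"
    unfolding in_M_perp.abs_eq[OF rel]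
  proof (intro allI conjI)
    fix n :: int
    show "(LINT x|lborel. ?f x * exp (\<i> * of_int n * of_real pi * of_real x)) = 0"
      using m1[of n] by (subst sub) (simp add: mult_ac)
    have "exp (\<i> * of_int n * of_real pi * of_real (4 * \<gamma> / (2 * t))) = exp (\<i> * of_int n * of_real (2 * pi * (\<gamma> / t)))" for t
      by (simp add: mult_ac)
    then show "(LINT x|lborel. ?f x * exp (\<i> * of_int n * of_real pi * of_real (4 * \<gamma> / x))) = 0"
      using m2[of n] by (subst sub) simp
  qed
  moreover have "vanishes_on_neg (abs_L1 ?f)"
    unfolding vanishes_on_neg.abs_eq[OF rel] by (simp add: g(2))
  ultimately show "abs_L1 ?f \<in> M_perp_pos (4 * \<gamma>)" by (simp add: M_perp_pos_def M_perp_def)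
qed

section \<open>The explicit element at the critical parameter\<close>

definition critical_base :: "real \<Rightarrow> real" where
  "critical_base t = indicator {0<..<1} t / (1 + t)"

text \<open>The Gauss density on (0, 1), continued antisymmetrically to (1, \<infinity>), the
  involution being s -> 1 / s for \<gamma> = 1.\<close>

definition critical_density :: "real \<Rightarrow> real" where
  "critical_density t = critical_base t - inversion 1 critical_base t"

lemma critical_density_eq:
  "critical_density t = (if 0 < t \<and> t < 1 then 1 / (1 + t) else if 1 < t then - (1 / (t * (t + 1))) else 0)"
proof (cases "1 < t")
  case True
  then have "1 / t\<^sup>2 * (1 / (1 + 1 / t)) = 1 / (t * (t + 1))" by (simp add: field_simps power2_eq_square)
  with True show ?thesis by (simp add: critical_density_def critical_base_def inversion_def)
next
  case False
  then show ?thesis by (auto simp: critical_density_def critical_base_def inversion_def indicator_def)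
qed

lemma integrable_critical_density: "integrable lborel critical_density"
proof -
  have [measurable]: "critical_base \<in> borel_measurable borel" unfolding critical_base_def by measurable
  have "integrable lborel critical_base"
  proof (rule Bochner_Integration.integrable_bound)
    show "integrable lborel (\<lambda>t::real. indicat_real {0<..<1} t)" by (intro integrable_real_indicator) auto
  qed (auto simp: critical_base_def indicator_def)
  then have i: "integrable lborel critical_base" .
  then have s: "set_integrable lborel {0<..} critical_base"
    unfolding set_integrable_def by (intro integrable_mult_indicator) auto
  have "integrable lborel (\<lambda>s. indicat_real {0<..} s *\<^sub>R ((1 / s\<^sup>2) *\<^sub>R critical_base (1 / s)))"
    using set_integrable_inversion[OF zero_less_one _ s] unfolding set_integrable_def by simp
  also have "(\<lambda>s. indicat_real {0<..} s *\<^sub>R ((1 / s\<^sup>2) *\<^sub>R critical_base (1 / s))) = inversion 1 critical_base"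
    by (auto simp: inversion_def)
  finally show ?thesis unfolding critical_density_def[abs_def] using i by simp
qed

text \<open>Telescoping, as 1 / x - 1 / (x (x + 1)) = 1 / (x + 1). The remainder tends to 0 and
  stays below 1, as the construction requires.\<close>

lemma sum_critical_density:
  assumes "0 < s" "s < 1"
  shows "(\<Sum>j<Suc n. critical_density (s + real j)) = 1 / (s + real (Suc n))"
proof (induction n)
  case 0
  show ?case using assms by (simp add: critical_density_eq add.commute)
next
  case (Suc n)
  define x where "x = s + real (Suc n)"
  have x: "x > 1" using assms by (simp add: x_def)
  have "1 / x + critical_density x = 1 / (x + 1)"
  proof -
    have "1 / x - 1 / (x * (x + 1)) = 1 / (x + 1)" using x by (simp add: divide_simps)
    then show ?thesis using x by (simp add: critical_density_eq)
  qed
  with Suc show ?case by (simp add: x_def add_ac)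
qed

text \<open>The nonzero integral over (0, 2) shows nontriviality and supplies the divisor with which
  every other element is compared. It is positive because the density exceeds 1 / 2 on (0,
  1).\<close>

lemma critical_element:
  obtains F where "F \<in> M_perp_pos 4" "L1_integral 0 2 F \<noteq> 0"
proof -
  have bound: "\<bar>\<Sum>j<n. critical_density (s + real j)\<bar> \<le> 1" if s: "0 < s" "s < 1" for n s
  proof (cases n)
    case (Suc m)
    then show ?thesis unfolding Suc sum_critical_density[OF s] using s by simp
  qed simp
  have lim: "(\<lambda>n. \<Sum>j<n. critical_density (s + real j)) \<longlonglongrightarrow> 0" if s: "0 < s" "s < 1" for s
  proof (rule LIMSEQ_imp_Suc)
    have "(\<lambda>n. 1 / (s + real (Suc n))) \<longlonglongrightarrow> 0" by real_asymp
    then show "(\<lambda>n. \<Sum>j<Suc n. critical_density (s + real j)) \<longlonglongrightarrow> 0"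
      unfolding sum_critical_density[OF s] .
  qed
  have anti: "inversion 1 critical_density s = - critical_density s" if "0 < s" for s
    unfolding critical_density_def[abs_def] inversion_diff inversion_inversion[OF zero_less_one that] by simp
  have zero: "critical_density t = 0" if "t \<le> 0" for t using that by (simp add: critical_density_eq)
  let ?f = "\<lambda>x. complex_of_real (critical_density (x / 2))"
  note el = M_perp_pos_construct[OF zero_less_one integrable_critical_density zero anti lim bound]
  have rel: "L1_rel ?f ?f" using el(1) by (simp add: L1_rel_def)
  have "L1_integral 0 2 (abs_L1 ?f) = (LINT x:{0<..<2}|lborel. ?f x)" by (rule L1_integral.abs_eq[OF rel])
  also have "\<dots> = of_real (LINT x:{0<..<2}|lborel. critical_density (x / 2))" (is "_ = of_real ?c")
    unfolding set_lebesgue_integral_def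
    by (subst integral_complex_of_real[symmetric]) (auto intro!: Bochner_Integration.integral_cong simp: indicator_def)
  finally have c: "L1_integral 0 2 (abs_L1 ?f) = of_real ?c" .
  have "?c \<noteq> 0"
  proof -
    have "(LINT x:{0<..<2::real}|lborel. 1 / 2) \<le> (LINT x:{0<..<2}|lborel. critical_density (x / 2))"
    proof (rule set_integral_mono)
      show "set_integrable lborel {0<..<2} (\<lambda>x. critical_density (x / 2))"
        unfolding set_integrable_def
        using lborel_integrable_real_affine[OF integrable_critical_density, of "1 / 2" 0]
        by (intro integrable_mult_indicator) simp_all
      show "1 / 2 \<le> critical_density (x / 2)" if "x \<in> {0<..<2}" for x
        using that by (simp add: critical_density_eq field_simps)
    qed (simp add: set_integrable_def)
    then show ?thesis by (simp add: set_lebesgue_integral_def)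
  qed
  then have "L1_integral 0 2 (abs_L1 ?f) \<noteq> 0" unfolding c by (simp only: of_real_eq_0_iff not_False_eq_True)
  with el(2) show thesis using that by simp
qed

section \<open>Infinite dimension in the supercritical case\<close>

lemma abs_L1_sum_scale:
  assumes "finite I" "\<And>i. i \<in> I \<Longrightarrow> integrable lborel (\<phi> i)"
  shows "(\<Sum>i\<in>I. L1_scale (c i) (abs_L1 (\<phi> i))) = abs_L1 (\<lambda>x. \<Sum>i\<in>I. c i * \<phi> i x)"
  using assms
proof (induction I rule: finite_induct)
  case empty
  show ?case by (simp add: zero_L1_def)
next
  case (insert i I)
  have "L1_rel (\<phi> i) (\<phi> i)" "L1_rel (\<lambda>x. c i * \<phi> i x) (\<lambda>x. c i * \<phi> i x)"
    "L1_rel (\<lambda>x. \<Sum>i\<in>I. c i * \<phi> i x) (\<lambda>x. \<Sum>i\<in>I. c i * \<phi> i x)"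
    using insert.prems by (auto simp: L1_rel_def)
  then show ?case using insert by (simp add: L1_scale.abs_eq plus_L1.abs_eq)
qed

text \<open>As \<open>g\<close> vanishes for t \<le> 0, the lattice sum at a point of (0, 1) only
  has terms with j \<ge> 0, so the partial sums are exactly 0 once they cover the support; the
  finitely many earlier ones are bounded by compactness.\<close>

lemma partial_sums_of_per_sum_zero:
  fixes g :: "real \<Rightarrow> real"
  assumes g_cont: "continuous_on UNIV g" and g_supp: "supp_in \<alpha> \<beta> g" and \<alpha>: "0 < \<alpha>"
    and per0: "\<And>s. per_sum g s = 0"
  obtains C where "\<And>s. 0 < s \<Longrightarrow> s < 1 \<Longrightarrow> (\<lambda>n. \<Sum>j<n. g (s + real j)) \<longlonglongrightarrow> 0"
    "\<And>n s. 0 < s \<Longrightarrow> s < 1 \<Longrightarrow> \<bar>\<Sum>j<n. g (s + real j)\<bar> \<le> C"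
proof -
  have gz: "g t = 0" if "t \<le> 0" for t using supp_inD[OF g_supp, of t] \<alpha> that by simp
  obtain M where M: "1 + \<bar>\<alpha>\<bar> + \<bar>\<beta>\<bar> \<le> real M" using real_arch_simple by blast
  have tail: "g (s + real j) = 0" if "0 < s" "M \<le> j" for s j
    using that M by (intro supp_inD[OF g_supp]) (auto simp: abs_if split: if_splits)
  have part: "(\<Sum>j<n. g (s + real j)) = 0" if s: "0 < s" "s < 1" and n: "M + 1 \<le> n" for s n
  proof -
    have "0 = (\<Sum>i<2 * M + 1. g (s + real i - real M))"
      using per_sum_eq[OF g_supp, of s M] per0[of s] s M by simp
    also have "\<dots> = (\<Sum>i\<in>{M..<2 * M + 1}. g (s + real i - real M))"
    proof (rule sum.mono_neutral_right)
      show "\<forall>i\<in>{..<2 * M + 1} - {M..<2 * M + 1}. g (s + real i - real M) = 0"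
      proof
        fix i assume "i \<in> {..<2 * M + 1} - {M..<2 * M + 1}"
        then have "real i + 1 \<le> real M" by auto
        then show "g (s + real i - real M) = 0" using s by (intro gz) simp
      qed
    qed auto
    also have "\<dots> = (\<Sum>j<M + 1. g (s + real j))"
      by (rule sum.reindex_bij_witness[of _ "\<lambda>j. j + M" "\<lambda>i. i - M"]) (auto simp: add_diff_eq)
    also have "\<dots> = (\<Sum>j<n. g (s + real j))"
      by (rule sum.mono_neutral_left) (use n tail[OF s(1)] in auto)
    finally show ?thesis by simp
  qed
  have lim: "(\<lambda>n. \<Sum>j<n. g (s + real j)) \<longlonglongrightarrow> 0" if "0 < s" "s < 1" for s
  proof (rule tendsto_eventually)
    show "\<forall>\<^sub>F n in sequentially. (\<Sum>j<n. g (s + real j)) = 0"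
      unfolding eventually_sequentially using part[OF that] by blast
  qed
  have "bounded (g ` {0..real M + 2})"
    by (intro compact_imp_bounded compact_continuous_image continuous_on_subset[OF g_cont]) auto
  then obtain C where "\<forall>y\<in>g ` {0..real M + 2}. norm y \<le> C" unfolding bounded_iff by blast
  then have C: "\<bar>g t\<bar> \<le> C" if "t \<in> {0..real M + 2}" for t using that by auto
  have C0: "0 \<le> C" using C[of 0] by simp
  have bound: "\<bar>\<Sum>j<n. g (s + real j)\<bar> \<le> real (M + 1) * C" if s: "0 < s" "s < 1" for n s
  proof (cases "M + 1 \<le> n")
    case True
    then show ?thesis using part[OF s] C0 by simp
  next
    case False
    have "\<bar>\<Sum>j<n. g (s + real j)\<bar> \<le> (\<Sum>j<n. C)"
      using s False by (intro order_trans[OF sum_abs] sum_mono C) auto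
    also have "\<dots> \<le> real (M + 1) * C" using False C0 by (simp add: mult_right_mono)
    finally show ?thesis .
  qed
  from lim bound show thesis by (rule that)
qed

text \<open>The classes \<open>F k\<close> themselves may violate the first family of conditions,
  but each differs from a combination of finitely many fixed ones by an element of the subspace. A
  finite spanning set of the subspace would therefore give a finite set whose span contains all
  \<open>F k\<close>, against their linear independence.\<close>

lemma M_perp_pos_supercritical:
  assumes \<gamma>: "1 < \<gamma>"
  shows "infinite_dimensional (M_perp_pos (4 * \<gamma>))"
  unfolding infinite_dimensional_def
proof
  assume "\<exists>B. finite B \<and> M_perp_pos (4 * \<gamma>) \<subseteq> L1.span B"
  then obtain B where B: "finite B" "M_perp_pos (4 * \<gamma>) \<subseteq> L1.span B" by blast
  obtain f v G N p q \<alpha> \<beta> where f: "0 < \<alpha>" "\<And>k::nat. continuous_on UNIV (f k)" "\<And>k. supp_in \<alpha> \<beta> (f k)"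
    "\<And>k s. 0 < s \<Longrightarrow> inversion \<gamma> (f k) s = - f k s"
    "\<And>k s. per_sum (f k) s = (\<Sum>l<(N::nat). v k l * G l s)"
    "\<And>k. p k < q k" "\<And>k x. p k < x \<Longrightarrow> x < q k \<Longrightarrow> 0 < f k x"
    "\<And>j k x. j \<noteq> k \<Longrightarrow> p k < x \<Longrightarrow> x < q k \<Longrightarrow> f j x = 0"
    by (rule supercritical_family[OF \<gamma>]) (rule that; assumption)
  have \<gamma>0: "0 < \<gamma>" using \<gamma> by simp
  have fi: "integrable lborel (f k)" for k
  proof -
    have "set_integrable lborel {\<alpha>..\<beta>} (f k)"
      by (rule borel_integrable_atLeastAtMost') (rule continuous_on_subset[OF f(2)], simp)
    also have "set_integrable lborel {\<alpha>..\<beta>} (f k) = integrable lborel (f k)"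
      unfolding set_integrable_def using f(3)[of k]
      by (intro Bochner_Integration.integrable_cong) (auto simp: indicator_def supp_in_def not_le[symmetric])
    finally show ?thesis .
  qed
  define \<phi> where "\<phi> k x = complex_of_real (f k (x / 2))" for k x
  have \<phi>i: "integrable lborel (\<phi> k)" for k
    using lborel_integrable_real_affine[OF integrable_of_real[OF fi[of k]], of "1 / 2" 0]
    by (simp add: \<phi>_def[abs_def])
  then have rel: "L1_rel (\<phi> k) (\<phi> k)" for k by (simp add: L1_rel_def)
  define F where "F k = abs_L1 (\<phi> k)" for k
  obtain I where I: "finite I" "\<And>i. \<exists>c. \<forall>l<N. v i l = (\<Sum>j\<in>I. c j * v j l)"
    using real_vectors_finitely_generated[of N v] by blast
  have F_span: "F i \<in> L1.span (B \<union> F ` I)" for i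
  proof -
    obtain c where c: "\<And>l. l < N \<Longrightarrow> v i l = (\<Sum>j\<in>I. c j * v j l)" using I(2)[of i] by blast
    \<comment> \<open>The coefficients cancel the obstruction vector \<open>v i\<close>, so the
      lattice sum of \<open>g\<close> vanishes.\<close>
    define g where "g t = f i t - (\<Sum>j\<in>I. c j * f j t)" for t
    have g_supp: "supp_in \<alpha> \<beta> g"
      using f(3) unfolding supp_in_def g_def by (auto intro!: sum.neutral)
    have g_cont: "continuous_on UNIV g"
      unfolding g_def[abs_def] by (intro continuous_intros f(2))
    have gi: "integrable lborel g"
      unfolding g_def[abs_def] using fi by (intro Bochner_Integration.integrable_diff Bochner_Integration.integrable_sum integrable_mult_right) auto
    have gz: "g t = 0" if "t \<le> 0" for t using supp_inD[OF g_supp, of t] f(1) that by simp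
    have anti: "inversion \<gamma> g s = - g s" if s: "0 < s" for s
    proof -
      have J: "\<gamma> / s\<^sup>2 * f j (\<gamma> / s) = - f j s" for j using f(4)[OF s, of j] s by (simp add: inversion_def)
      have "inversion \<gamma> g s = \<gamma> / s\<^sup>2 * f i (\<gamma> / s) - (\<Sum>j\<in>I. c j * (\<gamma> / s\<^sup>2 * f j (\<gamma> / s)))"
        using s by (simp add: inversion_def g_def right_diff_distrib sum_distrib_left mult.left_commute)
      then show ?thesis unfolding J by (simp add: g_def sum_negf)
    qed
    have per0: "per_sum g s = 0" for s
    proof -
      have fj: "supp_in \<alpha> \<beta> (\<lambda>t. c j * f j t)" for j using f(3) by (simp add: supp_in_def)
      have sum_supp: "supp_in \<alpha> \<beta> (\<lambda>t. \<Sum>j\<in>I. c j * f j t)" using fj by (auto simp: supp_in_def intro!: sum.neutral)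
      have cm: "per_sum (\<lambda>t. c j * f j t) s = c j * per_sum (f j) s" for j
        by (rule per_sum_mult_periodic) simp
      have "per_sum g s = per_sum (f i) s - (\<Sum>j\<in>I. c j * per_sum (f j) s)"
        unfolding g_def[abs_def] per_sum_diff(1)[OF f(3) sum_supp] per_sum_sum[OF fj] cm ..
      also have "(\<Sum>j\<in>I. c j * per_sum (f j) s) = (\<Sum>l<N. (\<Sum>j\<in>I. c j * v j l) * G l s)"
        unfolding f(5) sum_distrib_left sum_distrib_right by (subst sum.swap) (simp add: mult.assoc)
      also have "\<dots> = per_sum (f i) s" unfolding f(5) using c by (intro sum.cong) auto
      finally show ?thesis by simp
    qed
    obtain C where lim: "\<And>s. 0 < s \<Longrightarrow> s < 1 \<Longrightarrow> (\<lambda>n. \<Sum>j<n. g (s + real j)) \<longlonglongrightarrow> 0"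
      and bound: "\<And>n s. 0 < s \<Longrightarrow> s < 1 \<Longrightarrow> \<bar>\<Sum>j<n. g (s + real j)\<bar> \<le> C"
      by (rule partial_sums_of_per_sum_zero[OF g_cont g_supp f(1) per0]) (rule that)
    have mem: "abs_L1 (\<lambda>x. complex_of_real (g (x / 2))) \<in> M_perp_pos (4 * \<gamma>)"
      by (rule M_perp_pos_construct(2)[OF \<gamma>0 gi gz anti lim bound])
    have gi2: "integrable lborel (\<lambda>x. complex_of_real (g (x / 2)))"
      by (rule M_perp_pos_construct(1)[OF \<gamma>0 gi gz anti lim bound])
    have "F i = abs_L1 (\<lambda>x. complex_of_real (g (x / 2))) + (\<Sum>j\<in>I. L1_scale (of_real (c j)) (F j))"
    proof -
      have "(\<Sum>j\<in>I. L1_scale (of_real (c j)) (F j)) = abs_L1 (\<lambda>x. \<Sum>j\<in>I. of_real (c j) * \<phi> j x)"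
        unfolding F_def by (rule abs_L1_sum_scale[OF I(1) \<phi>i])
      moreover have "L1_rel (\<lambda>x. \<Sum>j\<in>I. of_real (c j) * \<phi> j x) (\<lambda>x. \<Sum>j\<in>I. of_real (c j) * \<phi> j x)"
        using \<phi>i by (auto simp: L1_rel_def)
      moreover have "(\<lambda>x. complex_of_real (g (x / 2)) + (\<Sum>j\<in>I. of_real (c j) * \<phi> j x)) = \<phi> i"
        by (simp add: g_def \<phi>_def[abs_def])
      ultimately show ?thesis using gi2 by (simp add: plus_L1.abs_eq L1_rel_def F_def)
    qed
    also have "\<dots> \<in> L1.span (B \<union> F ` I)"
    proof (intro L1.span_add L1.span_sum L1.span_scale)
      show "abs_L1 (\<lambda>x. complex_of_real (g (x / 2))) \<in> L1.span (B \<union> F ` I)"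
        using mem B(2) L1.span_mono[of B "B \<union> F ` I"] by blast
      show "F j \<in> L1.span (B \<union> F ` I)" if "j \<in> I" for j
        using that by (intro L1.span_base) simp
    qed
    finally show ?thesis .
  qed
  \<comment> \<open>The functionals form a diagonal system: over the k-th interval only
    \<open>f k\<close> is nonzero, and it is positive there. The endpoints are doubled by the
    rescaling x = 2 t.\<close>
  have sep: "L1_integral (2 * p k) (2 * q k) (F j) = 0 \<longleftrightarrow> j \<noteq> k" for j k
  proof -
    have eq: "L1_integral (2 * p k) (2 * q k) (F j) = of_real (LINT x:{2 * p k<..<2 * q k}|lborel. f j (x / 2))"
      unfolding F_def L1_integral.abs_eq[OF rel] unfolding \<phi>_def[abs_def] set_lebesgue_integral_def
      by (subst integral_complex_of_real[symmetric]) (auto intro!: Bochner_Integration.integral_cong simp: indicator_def)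
    show ?thesis
    proof (cases "j = k")
      case False
      have "(LINT x:{2 * p k<..<2 * q k}|lborel. f j (x / 2)) = (LINT x:{2 * p k<..<2 * q k}|lborel. 0)"
        by (intro set_lebesgue_integral_cong) (auto intro!: f(8)[OF False])
      then show ?thesis using False by (simp add: eq)
    next
      case True
      let ?S = "{2 * p k<..<2 * q k}"
      let ?h = "\<lambda>x. indicat_real ?S x *\<^sub>R f k (x / 2)"
      have hi: "integrable lborel ?h"
        using lborel_integrable_real_affine[OF fi[of k], of "1 / 2" 0] by (intro integrable_mult_indicator) simp_all
      have "(LINT x|lborel. ?h x) \<noteq> 0"
      proof
        assume "(LINT x|lborel. ?h x) = 0"
        then have "AE x in lborel. ?h x = 0"
          by (subst (asm) integral_nonneg_eq_0_iff_AE[OF hi])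
             (auto simp: indicator_def intro!: less_imp_le f(7))
        then have "AE x in lborel. x \<notin> ?S"
        proof eventually_elim
          case (elim x)
          show ?case using elim f(7)[of k "x / 2"] by auto
        qed
        moreover have "(AE x in lborel. x \<notin> ?S) \<longleftrightarrow> emeasure lborel ?S = 0"
          by (rule AE_iff_measurable) auto
        ultimately have "emeasure lborel ?S = 0" by simp
        then show False using f(6)[of k] by simp
      qed
      then show ?thesis unfolding eq unfolding True set_lebesgue_integral_def by (simp only: of_real_eq_0_iff simp_thms)
    qed
  qed
  have "inj F" using sep by (intro injI) metis
  have "L1.independent (range F)"
    unfolding L1.dependent_def
  proof clarify
    fix k assume k: "F k \<in> L1.span (range F - {F k})"
    let ?V = "{X. L1_integral (2 * p k) (2 * q k) X = 0}"
    have "L1.subspace ?V"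
    proof (rule L1.subspaceI; unfold mem_Collect_eq)
      have "L1_scale 0 (0 :: L1) = 0" by (rule L1.scale_zero_left)
      then show "L1_integral (2 * p k) (2 * q k) 0 = 0"
        using L1_integral_scale[of "2 * p k" "2 * q k" 0 0] by simp
    qed (simp_all add: L1_integral_add L1_integral_scale)
    moreover have "range F - {F k} \<subseteq> ?V" using sep by auto
    ultimately have "L1.span (range F - {F k}) \<subseteq> ?V" by (intro L1.span_minimal)
    with k sep show False by blast
  qed
  moreover have "range F \<subseteq> L1.span (B \<union> F ` I)" using F_span by blast
  ultimately have "finite (range F)"
    using L1.independent_span_bound[of "B \<union> F ` I" "range F"] B(1) I(1) by blast
  with \<open>inj F\<close> show False using finite_imageD[of F UNIV] by simp
qed

theorem corollary1p5:
  fixes \<beta> :: real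
  assumes "\<beta> > 0"
  shows "((\<exists>F \<in> M_perp \<beta>. F \<noteq> 0 \<and> vanishes_on_neg F) \<longleftrightarrow> \<beta> \<ge> 4) \<and>
         (\<beta> = 4 \<longrightarrow> L1.dim (M_perp_pos \<beta>) = 1) \<and>
         (\<beta> > 4 \<longrightarrow> infinite_dimensional (M_perp_pos \<beta>))"
proof -
  define \<gamma> where "\<gamma> = \<beta> / 4"
  have \<beta>: "\<beta> = 4 * \<gamma>" and \<gamma>0: "0 < \<gamma>" using assms by (auto simp: \<gamma>_def)
  have sub: "F = 0" if "\<beta> < 4" "F \<in> M_perp \<beta>" "vanishes_on_neg F" for F
    using M_perp_pos_subcritical[OF \<gamma>0, of F] that unfolding \<beta> M_perp_def by simp
  obtain F0 where F0: "F0 \<in> M_perp_pos 4" "L1_integral 0 2 F0 \<noteq> 0" by (rule critical_element)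
  have int0: "L1_integral a b 0 = 0" for a b
    using L1_integral_scale[of a b 0 0] by simp
  then have F0_nz: "F0 \<noteq> 0" using F0(2) by auto
  have dim: "L1.dim (M_perp_pos 4) = 1"
  proof (rule L1.dim_unique[of "{F0}"])
    show "M_perp_pos 4 \<subseteq> L1.span {F0}"
    proof
      fix F assume F: "F \<in> M_perp_pos 4"
      \<comment> \<open>Chosen so that the difference has integral 0 over (0, 2), the case in which
        the critical uniqueness applies.\<close>
      define c where "c = L1_integral 0 2 F / L1_integral 0 2 F0"
      have "F + L1_scale (- c) F0 \<in> M_perp_pos 4"
        by (intro L1.subspace_add[OF subspace_M_perp_pos F] L1.subspace_scale[OF subspace_M_perp_pos F0(1)])
      moreover have "L1_integral 0 2 (F + L1_scale (- c) F0) = 0"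
        using F0(2) unfolding L1_integral_add L1_integral_scale by (simp add: c_def)
      ultimately have "F + L1_scale (- c) F0 = 0"
        by (intro M_perp_pos_critical) (auto simp: M_perp_pos_def M_perp_def)
      then have "F = L1_scale c F0" by (simp add: add_eq_0_iff L1.scale_minus_left)
      then show "F \<in> L1.span {F0}" by (simp add: L1.span_scale L1.span_base)
    qed
  qed (use F0(1) F0_nz in auto)
  have sup: "infinite_dimensional (M_perp_pos \<beta>)" if "\<beta> > 4"
    using M_perp_pos_supercritical[of \<gamma>] that unfolding \<beta> by simp
  have "\<exists>F \<in> M_perp \<beta>. F \<noteq> 0 \<and> vanishes_on_neg F" if "\<beta> \<ge> 4"
  proof (cases "\<beta> = 4")
    case True
    then show ?thesis using F0(1) F0_nz by (auto simp: M_perp_pos_def)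
  next
    case False
    \<comment> \<open>The span of the empty set is the zero space, so infinite dimension tested on
      it yields a nonzero element.\<close>
    then have "\<not> M_perp_pos \<beta> \<subseteq> L1.span {}"
      using sup that unfolding infinite_dimensional_def by (metis finite.emptyI order_le_less)
    then show ?thesis by (auto simp: M_perp_pos_def)
  qed
  then show ?thesis using sub dim sup by (auto simp: not_le[symmetric])
qed

end
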